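(* Let $\alpha\ge 0$ be an integer, let $\ell$ be an odd prime with $\ell\equiv -1\pmod{2^{\alpha+12}}$, and let $n\ge 0$ be an integer with $\ell\nmid n$. Then $$\overline{p}(2^\alpha\ell^3 n)\equiv 0\pmod{2^{\alpha+12}}.$$
   Context: For a non-negative integer $n$, $\overline{p}(n)$ denotes the number of overpartitions of $n$, i.e. partitions of $n$ in which the first occurrence of each distinct part may be overlined; equivalently $\sum_{n\ge 0}\overline{p}(n)q^n=\prod_{k\ge 1}\frac{1+q^k}{1-q^k}$. *)

theory Defs
  imports "HOL-Number_Theory.Number_Theory" "HOL-Library.Multiset"
begin

(* An overpartition of n is encoded as a pair (P, S): P is the multiset of parts of the underlying
   partition of n, and S is the set of those part sizes whose first occurrence is overlined. *)
definition overpartitions :: "nat \<Rightarrow> (nat multiset \<times> nat set) set" where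
  "overpartitions n = {(P, S). 0 \<notin># P \<and> \<Sum>\<^sub># P = n \<and> S \<subseteq> set_mset P}"

definition overpartition_number :: "nat \<Rightarrow> nat" where
  "overpartition_number n = card (overpartitions n)"

(* In particular card above is the true number of overpartitions. *)
lemma finite_overpartitions: "finite (overpartitions n)"
proof -
  have size_le: "0 \<notin># P \<Longrightarrow> size P \<le> \<Sum>\<^sub># P" for P :: "nat multiset"
    by (induction P) auto
  have elem_le: "x \<le> \<Sum>\<^sub># P" if "x \<in># P" for x and P :: "nat multiset"
    using multi_member_split[OF that] by auto
  have "overpartitions n \<subseteq>
      (\<Union>k\<le>n. {P. set_mset P \<subseteq> {..n} \<and> size P = k}) \<times> Pow {..n}"
  proof (rule subrelI)
    fix P S
    assume "(P, S) \<in> overpartitions n"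
    then have P: "0 \<notin># P" "\<Sum>\<^sub># P = n" and S: "S \<subseteq> set_mset P"
      by (simp_all add: overpartitions_def)
    have "set_mset P \<subseteq> {..n}"
      using elem_le P(2) by blast
    with size_le[OF P(1)] P(2) S
    show "(P, S) \<in> (\<Union>k\<le>n. {P. set_mset P \<subseteq> {..n} \<and> size P = k}) \<times> Pow {..n}"
      by simp
  qed
  moreover have "finite {P. set_mset P \<subseteq> {..n} \<and> size P = k}" for k
    using finite_multisets_of_size[of "{..n}" k] by (simp add: multisets_of_size_def)
  ultimately show ?thesis
    by (simp add: finite_subset)
qed

end

theory Submission
  imports Defs "HOL-Number_Theory.Number_Theory" "HOL-Computational_Algebra.Formal_Power_Series"
begin

text \<open>
Write \<open>phi\<close> for the theta series of the squares and \<open>inv_phi = 1 / phi\<close>.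
By an identity of Gauss, the coefficients of \<open>inv_phi\<close> are the overpartition numbers up
to the sign \<open>(-1)^n\<close>. Three independent ideas combine.

\<^bold>\<open>Contraction.\<close> There is a modular function \<open>t_ser\<close> with zero
constant term such that taking every fourth coefficient of \<open>inv_phi * (f oo t_ser)\<close>
gives \<open>inv_phi * (contr f oo t_ser)\<close> for an explicit linear operator
\<open>contr\<close> on power series (\<open>U4_step\<close>). This operator fixes the constant term
of \<open>1\<close> and multiplies everything without constant term by higher and higher powers of 2
(\<open>contr_dyadic_2\<close>). Hence the overpartition numbers of \<open>4^j * n\<close> converge
2-adically, and so fast (\<open>overpartition_stable\<close>,
\<open>overpartition_stable_even\<close>) that for \<open>N\<close> of 2-adic valuation at least 4
the number agrees with the limit modulo the power of 2 that is claimed. For the valuations 0, 1, 2,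
3 of \<open>N\<close> a finite computation modulo \<open>2^20\<close> shows that the number at
\<open>N\<close> is, up to an odd factor, a multiple of the number at \<open>4 N\<close> or
\<open>16 N\<close> modulo the required power of 2 (\<open>compare_odd\<close>,
\<open>compare_4_odd\<close>, \<open>compare_twice_odd\<close>, \<open>compare_4_twice_odd\<close>).
In one case an obstruction remains, the coefficient of a theta series of \<open>2 x^2 + 8
y^2\<close>; it vanishes because a prime \<open>l\<close> that is 3 modulo 4 divides a sum of two
squares to an even power.

\<^bold>\<open>Lambert series.\<close> It remains to see that the limit vanishes. The Lambert series
with coefficients \<open>4 * (sum of chi d * d^(2 r) over the divisors d of N)\<close>, where
\<open>chi\<close> is the character modulo 4, is \<open>phi^(4 r + 2) * (f oo t_ser)\<close> for a
polynomial \<open>f\<close> with odd constant term (\<open>lambert_modular\<close>). It is the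
derivative of order \<open>2 r\<close> at \<open>z = 0\<close> of the elliptic function \<open>sum
of sech (z + n T)\<close>, and that function solves \<open>y'' = c y - 2 y^3\<close>, so all its
even derivatives are polynomials in \<open>y\<close>. For \<open>4 r + 4 = 2^M\<close> one has
\<open>phi^(2^M) = 1\<close> modulo \<open>2^(M + 1)\<close>; so modulo \<open>2^M\<close> the
product of \<open>phi\<close> with this Lambert series is \<open>inv_phi * (f oo t_ser)\<close>,
whose coefficient at \<open>4^j * n\<close> tends to \<open>f $ 0\<close> times the overpartition
number (\<open>contr_limit\<close>).

\<^bold>\<open>Quadratic forms.\<close> The coefficient of that product at a nonsquare
\<open>D\<close> is four times a sum of weights over the indefinite binary quadratic forms of
discriminant \<open>D\<close> that change sign on the geodesic from 0 to infinity. Such sums form a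
modular symbol for \<open>SL_2(Z)\<close>. When \<open>D\<close> contains a high power of 4, the
symbol is, 2-adically, close to the one of an Eisenstein series
(\<open>even_const_eventually\<close>, \<open>symb_eisenstein\<close>); and the Hecke relation at
\<open>l\<close> then shows that the symbol at \<open>l^2 * D\<close> is a multiple of \<open>l^(4 r
+ 1) + 1\<close>, hence divisible by \<open>2^M\<close> when \<open>l = -1\<close> modulo
\<open>2^M\<close> (\<open>hecke_vanish\<close>, \<open>divisor_sum_vanish\<close>).
\<close>

unbundle fps_syntax

section \<open>Indefinite binary quadratic forms and the vanishing of a divisor sum\<close>

definition qform :: "int \<times> int \<times> int \<Rightarrow> int \<times> int \<Rightarrow> int" where
  "qform = (\<lambda>(a, b, c) (x, y). a * x\<^sup>2 + 2 * b * x * y + c * y\<^sup>2)"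

text \<open>
A quarter of the usual discriminant, as the middle coefficient of every form here is even.
\<close>

definition discr :: "int \<times> int \<times> int \<Rightarrow> int" where
  "discr = (\<lambda>(a, b, c). b\<^sup>2 - a * c)"

definition polar :: "int \<times> int \<times> int \<Rightarrow> int \<times> int \<Rightarrow> int \<times> int \<Rightarrow> int" where
  "polar = (\<lambda>(a, b, c) (x, y) (z, t). a * x * z + b * (x * t + y * z) + c * y * t)"

text \<open>
In \<open>forms D u v\<close> the forms separate the two primitive vectors \<open>u\<close> and
\<open>v\<close>, that is, their geodesic crosses the one between the cusps \<open>u\<close> and
\<open>v\<close>, with a fixed orientation.
\<close>

definition forms :: "int \<Rightarrow> int \<times> int \<Rightarrow> int \<times> int \<Rightarrow> (int \<times> int \<times> int) set" where
  "forms D u v = {Q. discr Q = D \<and> qform Q u < 0 \<and> 0 < qform Q v}"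

definition form_symbol :: "(int \<Rightarrow> int) \<Rightarrow> int \<Rightarrow> int \<times> int \<Rightarrow> int \<times> int \<Rightarrow> int \<times> int \<Rightarrow> int" where
  "form_symbol w D u v x = (\<Sum>Q\<in>forms D u v. w (qform Q x))"

definition nonsquare :: "int \<Rightarrow> bool" where
  "nonsquare D \<longleftrightarrow> (\<forall>m. D \<noteq> m\<^sup>2)"

lemma qform_simp: "qform (a, b, c) (x, y) = a * x\<^sup>2 + 2 * b * x * y + c * y\<^sup>2"
  by (simp add: qform_def)
lemma discr_simp: "discr (a, b, c) = b\<^sup>2 - a * c"
  by (simp add: discr_def)
lemma polar_simp: "polar (a, b, c) (x, y) (z, t) = a * x * z + b * (x * t + y * z) + c * y * t"
  by (simp add: polar_def)

text \<open>
In the basis \<open>u\<close>, \<open>v\<close> the outer coefficients have opposite signs, so all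
coefficients are bounded by the discriminant.
\<close>

lemma finite_forms:
  assumes "u1 * v2 - u2 * v1 \<noteq> (0::int)"
  shows "finite (forms D (u1, u2) (v1, v2))"
proof -
  define n where "n = u1 * v2 - u2 * v1"
  define m where "m = \<bar>n\<^sup>2 * D\<bar>"
  define f where "f = (\<lambda>Q. (qform Q (u1, u2), polar Q (u1, u2) (v1, v2), qform Q (v1, v2)))"
  have n0: "n\<^sup>2 \<noteq> 0" using assms by (simp add: n_def)
  have "inj_on f (forms D (u1, u2) (v1, v2))"
  proof (rule inj_onI)
    fix Q Q' assume fQ: "f Q = f Q'"
    obtain a b c a' b' c' where Q: "Q = (a, b, c)" "Q' = (a', b', c')" by (cases Q, cases Q')
    have e: "f (a, b, c) = f (a', b', c')" using fQ unfolding Q .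
    have *: "n\<^sup>2 * a = v2\<^sup>2 * qform (a, b, c) (u1, u2) - 2 * u2 * v2 * polar (a, b, c) (u1, u2) (v1, v2)
        + u2\<^sup>2 * qform (a, b, c) (v1, v2)"
      "n\<^sup>2 * c = v1\<^sup>2 * qform (a, b, c) (u1, u2) - 2 * u1 * v1 * polar (a, b, c) (u1, u2) (v1, v2)
        + u1\<^sup>2 * qform (a, b, c) (v1, v2)"
      "n\<^sup>2 * b = - v1 * v2 * qform (a, b, c) (u1, u2) + (u1 * v2 + u2 * v1) * polar (a, b, c) (u1, u2) (v1, v2)
        - u1 * u2 * qform (a, b, c) (v1, v2)" for a b c
      unfolding n_def qform_simp polar_simp by (simp_all add: power2_eq_square algebra_simps)
    have e': "qform (a, b, c) (u1, u2) = qform (a', b', c') (u1, u2)" "qform (a, b, c) (v1, v2) = qform (a', b', c') (v1, v2)"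
      "polar (a, b, c) (u1, u2) (v1, v2) = polar (a', b', c') (u1, u2) (v1, v2)"
      using e by (simp_all add: f_def)
    have "n\<^sup>2 * a = n\<^sup>2 * a'" by (simp only: *(1)[of a b c] *(1)[of a' b' c'] e')
    moreover have "n\<^sup>2 * b = n\<^sup>2 * b'"
      by (simp only: *(3)[where a = a and b = b and c = c] *(3)[where a = a' and b = b' and c = c'] e')
    moreover have "n\<^sup>2 * c = n\<^sup>2 * c'"
      by (simp only: *(2)[where a = a and b = b and c = c] *(2)[where a = a' and b = b' and c = c'] e')
    ultimately show "Q = Q'" using n0 unfolding Q by simp
  qed
  moreover have "f ` forms D (u1, u2) (v1, v2) \<subseteq> {-m..m} \<times> {-m..m} \<times> {-m..m}"
  proof (rule image_subsetI)
    fix Q assume Q': "Q \<in> forms D (u1, u2) (v1, v2)"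
    obtain a b c where Q: "Q = (a, b, c)" by (cases Q)
    have d: "b\<^sup>2 - a * c = D" and A: "qform (a, b, c) (u1, u2) < 0" and C: "0 < qform (a, b, c) (v1, v2)"
      using Q' by (simp_all add: Q forms_def discr_simp)
    define A where "A = qform (a, b, c) (u1, u2)"
    define B where "B = polar (a, b, c) (u1, u2) (v1, v2)"
    define C where "C = qform (a, b, c) (v1, v2)"
    have eq: "B\<^sup>2 - A * C = n\<^sup>2 * D"
      unfolding d[symmetric] A_def B_def C_def n_def qform_simp polar_simp by (simp add: power2_eq_square algebra_simps)
    have AC: "A \<le> -1" "1 \<le> C" using A C by (simp_all add: A_def C_def)
    have B2: "\<bar>B\<bar> \<le> B\<^sup>2"
    proof (cases "B = 0")
      case False
      then have "\<bar>B\<bar> * 1 \<le> \<bar>B\<bar> * \<bar>B\<bar>" by (intro mult_left_mono) auto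
      then show ?thesis by (simp add: power2_eq_square)
    qed simp
    have "- A \<le> - A * C" "C \<le> - A * C"
      using AC mult_left_mono[of 1 C "-A"] mult_right_mono[of 1 "-A" C] by simp_all
    then have "-A \<le> m" "C \<le> m" "\<bar>B\<bar> \<le> m"
      using eq B2 AC zero_le_power2[of B] unfolding m_def by linarith+
    then show "f Q \<in> {-m..m} \<times> {-m..m} \<times> {-m..m}"
      using AC unfolding f_def Q A_def[symmetric] B_def[symmetric] C_def[symmetric] by auto
  qed
  then have "finite (f ` forms D (u1, u2) (v1, v2))"
    by (rule finite_subset) simp
  ultimately show ?thesis by (rule finite_imageD[rotated])
qed

lemma nonsquare_mult: assumes "nonsquare D" "x \<noteq> (0::int)" shows "D * x\<^sup>2 \<noteq> m\<^sup>2"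
proof
  assume e: "D * x\<^sup>2 = m\<^sup>2"
  then have "x\<^sup>2 dvd m\<^sup>2" by (metis dvd_triv_right)
  then have "x dvd m" by simp
  then obtain k where "m = x * k" by blast
  with e assms(2) have "D = k\<^sup>2" by (simp add: power_mult_distrib mult.commute)
  with assms(1) show False unfolding nonsquare_def by blast
qed

lemma qform_nonzero:
  assumes "nonsquare D" "discr Q = D" "(x, y) \<noteq> (0, 0)"
  shows "qform Q (x, y) \<noteq> 0"
proof (cases Q)
  case (fields a b c)
  show ?thesis
  proof
    assume "qform Q (x, y) = 0"
    then have q: "a * x\<^sup>2 + 2 * b * x * y + c * y\<^sup>2 = 0" and d: "D = b\<^sup>2 - a * c"
      using assms(2) by (simp_all add: fields qform_simp discr_simp)
    have e: "D * x\<^sup>2 = (b * x + c * y)\<^sup>2" "D * y\<^sup>2 = (a * x + b * y)\<^sup>2"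
    proof -
      have "D * x\<^sup>2 = (b * x + c * y)\<^sup>2 - c * (a * x\<^sup>2 + 2 * b * x * y + c * y\<^sup>2)"
        "D * y\<^sup>2 = (a * x + b * y)\<^sup>2 - a * (a * x\<^sup>2 + 2 * b * x * y + c * y\<^sup>2)"
        unfolding d by (simp_all add: power2_eq_square algebra_simps)
      then show "D * x\<^sup>2 = (b * x + c * y)\<^sup>2" "D * y\<^sup>2 = (a * x + b * y)\<^sup>2"
        unfolding q by simp_all
    qed
    show False
    proof (cases "x = 0")
      case True then show ?thesis using e(2) nonsquare_mult[OF assms(1)] assms(3) by blast
    next
      case False then show ?thesis using e(1) nonsquare_mult[OF assms(1)] by blast
    qed
  qed
qed

text \<open>
The cocycle relation of a modular symbol. A form of nonsquare discriminant does not vanish at any of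
the three vectors, so each form is sorted by the sign at the vector that its summand does not
mention. The forms of the summands on the left that do not separate \<open>u\<close> from
\<open>t\<close> are negatives of each other, and cancel as \<open>w\<close> is odd.
\<close>

lemma form_symbol_add:
  fixes w :: "int \<Rightarrow> int"
  assumes D: "nonsquare D" and w: "\<And>m. w (- m) = - w m"
    and d: "u1 * v2 - u2 * v1 \<noteq> (0::int)" "v1 * t2 - v2 * t1 \<noteq> 0" "u1 * t2 - u2 * t1 \<noteq> 0"
  shows "form_symbol w D (u1, u2) (v1, v2) x + form_symbol w D (v1, v2) (t1, t2) x = form_symbol w D (u1, u2) (t1, t2) x"
proof -
  let ?u = "(u1, u2)" and ?v = "(v1, v2)" and ?t = "(t1, t2)"
  let ?f = "\<lambda>Q. w (qform Q x)"
  have nz: "u1 \<noteq> 0 \<or> u2 \<noteq> 0" "v1 \<noteq> 0 \<or> v2 \<noteq> 0" "t1 \<noteq> 0 \<or> t2 \<noteq> 0" using d by auto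
  define E where "E = {Q \<in> forms D ?u ?v. qform Q ?t < 0}"
  define E' where "E' = {Q \<in> forms D ?v ?t. qform Q ?u > 0}"
  define G where "G = {Q \<in> forms D ?u ?v. qform Q ?t > 0}"
  define G' where "G' = {Q \<in> forms D ?v ?t. qform Q ?u < 0}"
  have nzq: "qform Q ?u \<noteq> 0" "qform Q ?v \<noteq> 0" "qform Q ?t \<noteq> 0" if "discr Q = D" for Q
    using qform_nonzero[OF D that] nz by auto
  have fin: "finite (forms D ?u ?v)" "finite (forms D ?v ?t)" "finite (forms D ?u ?t)"
    using finite_forms d by auto
  then have finE: "finite E" "finite E'" "finite G" "finite G'"
    by (simp_all add: E_def E'_def G_def G'_def)
  have s: "qform Q ?u < 0 \<or> qform Q ?u > 0" "qform Q ?v < 0 \<or> qform Q ?v > 0" "qform Q ?t < 0 \<or> qform Q ?t > 0"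
    if "discr Q = D" for Q
    using nzq[OF that] by linarith+
  have 1: "forms D ?u ?v = E \<union> G" "forms D ?v ?t = E' \<union> G'" "forms D ?u ?t = G \<union> G'"
  proof -
    have "Q \<in> forms D ?u ?v \<longleftrightarrow> Q \<in> E \<union> G" "Q \<in> forms D ?v ?t \<longleftrightarrow> Q \<in> E' \<union> G'"
      "Q \<in> forms D ?u ?t \<longleftrightarrow> Q \<in> G \<union> G'" for Q
      using s[of Q] unfolding E_def G_def E'_def G'_def forms_def Un_iff mem_Collect_eq by blast+
    then show "forms D ?u ?v = E \<union> G" "forms D ?v ?t = E' \<union> G'" "forms D ?u ?t = G \<union> G'"
      by blast+
  qed
  have 2: "E \<inter> G = {}" "E' \<inter> G' = {}" "G \<inter> G' = {}"
    by (auto simp: E_def G_def E'_def G'_def forms_def)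
  have ng: "qform (case Q of (a, b, c) \<Rightarrow> (-a, -b, -c)) z = - qform Q z" for Q z
    by (cases Q; cases z) (simp add: qform_simp)
  have dg: "discr (case Q of (a, b, c) \<Rightarrow> (-a, -b, -c)) = discr Q" for Q
    by (cases Q) (simp add: discr_simp)
  have "sum ?f E = (\<Sum>Q\<in>E'. - ?f Q)"
    by (rule sum.reindex_bij_witness[of _ "\<lambda>(a, b, c). (-a, -b, -c)" "\<lambda>(a, b, c). (-a, -b, -c)"])
      (use w ng dg in \<open>simp_all add: E_def E'_def forms_def split: prod.splits\<close>)
  then have "sum ?f E + sum ?f E' = 0" by (simp add: sum_negf)
  then show ?thesis
    unfolding form_symbol_def 1 using finE 2 by (simp add: sum.union_disjoint)
qed

text \<open>
Invariance under \<open>SL_2(Z)\<close>: substitution permutes the forms of given discriminant.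
\<close>

lemma form_symbol_basis:
  assumes "p * s - q * r = (1::int)"
  shows "form_symbol w D (p, r) (q, s) (p * x + q * y, r * x + s * y) = form_symbol w D (1, 0) (0, 1) (x, y)"
  unfolding form_symbol_def
proof (rule sum.reindex_bij_witness[of _
      "\<lambda>Q. (qform Q (s, -r), polar Q (s, -r) (-q, p), qform Q (-q, p))"
      "\<lambda>Q. (qform Q (p, r), polar Q (p, r) (q, s), qform Q (q, s))"])
  have d: "(p * s - q * r)\<^sup>2 = 1" by (simp add: assms)
  fix Q :: "int \<times> int \<times> int"
  obtain a b c where Q: "Q = (a, b, c)" by (cases Q)
  have i1: "qform (qform Q (p, r), polar Q (p, r) (q, s), qform Q (q, s)) (s, -r) = (p * s - q * r)\<^sup>2 * a"
    "polar (qform Q (p, r), polar Q (p, r) (q, s), qform Q (q, s)) (s, -r) (-q, p) = (p * s - q * r)\<^sup>2 * b"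
    "qform (qform Q (p, r), polar Q (p, r) (q, s), qform Q (q, s)) (-q, p) = (p * s - q * r)\<^sup>2 * c"
    unfolding Q qform_simp polar_simp discr_simp by (simp_all add: power2_eq_square algebra_simps)
  have i2: "qform (qform Q (s, -r), polar Q (s, -r) (-q, p), qform Q (-q, p)) (p, r) = (p * s - q * r)\<^sup>2 * a"
    "polar (qform Q (s, -r), polar Q (s, -r) (-q, p), qform Q (-q, p)) (p, r) (q, s) = (p * s - q * r)\<^sup>2 * b"
    "qform (qform Q (s, -r), polar Q (s, -r) (-q, p), qform Q (-q, p)) (q, s) = (p * s - q * r)\<^sup>2 * c"
    unfolding Q qform_simp polar_simp discr_simp by (simp_all add: power2_eq_square algebra_simps)
  have odd_fourth: "qform (qform Q (p, r), polar Q (p, r) (q, s), qform Q (q, s)) (x, y) = qform Q (p * x + q * y, r * x + s * y)" for x y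
    unfolding Q qform_simp polar_simp by (simp add: power2_eq_square algebra_simps)
  have ds: "discr (qform Q (p, r), polar Q (p, r) (q, s), qform Q (q, s)) = (p * s - q * r)\<^sup>2 * discr Q"
    "discr (qform Q (s, -r), polar Q (s, -r) (-q, p), qform Q (-q, p)) = (p * s - q * r)\<^sup>2 * discr Q"
    unfolding Q qform_simp polar_simp discr_simp by (simp_all add: power2_eq_square algebra_simps)
  show "(qform (qform Q (p, r), polar Q (p, r) (q, s), qform Q (q, s)) (s, -r),
      polar (qform Q (p, r), polar Q (p, r) (q, s), qform Q (q, s)) (s, -r) (-q, p),
      qform (qform Q (p, r), polar Q (p, r) (q, s), qform Q (q, s)) (-q, p)) = Q"
    unfolding i1 d by (simp add: Q)
  show "(qform (qform Q (s, -r), polar Q (s, -r) (-q, p), qform Q (-q, p)) (p, r),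
      polar (qform Q (s, -r), polar Q (s, -r) (-q, p), qform Q (-q, p)) (p, r) (q, s),
      qform (qform Q (s, -r), polar Q (s, -r) (-q, p), qform Q (-q, p)) (q, s)) = Q"
    unfolding i2 d by (simp add: Q)
  show "(qform Q (p, r), polar Q (p, r) (q, s), qform Q (q, s)) \<in> forms D (1, 0) (0, 1)"
    if "Q \<in> forms D (p, r) (q, s)"
    using that ds(1) d by (simp add: forms_def qform_simp)
  show "(qform Q (s, -r), polar Q (s, -r) (-q, p), qform Q (-q, p)) \<in> forms D (p, r) (q, s)"
    if "Q \<in> forms D (1, 0) (0, 1)"
    using that ds(2) i2(1,3) d unfolding forms_def by (simp add: Q qform_simp[of a b c 1 0] qform_simp[of a b c 0 1])
  show "w (qform (qform Q (p, r), polar Q (p, r) (q, s), qform Q (q, s)) (x, y)) =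
    w (qform Q (p * x + q * y, r * x + s * y))"
    by (simp only: odd_fourth)
qed

text \<open>
A form of discriminant \<open>l^2 * D\<close> that is integral, up to the factor \<open>l^2\<close>,
on the lattice generated by \<open>l Z^2\<close> and \<open>(1, i)\<close> comes from a form of
discriminant \<open>D\<close> by a substitution of determinant \<open>l\<close>. The sums over the
\<open>l + 1\<close> lattices of index \<open>l\<close> make up the Hecke operator at
\<open>l\<close>.
\<close>

lemma sum_superlattice:
  fixes l i :: int
  assumes l: "l > 0"
  shows "(\<Sum>Q | Q \<in> forms (l\<^sup>2 * D) (1, 0) (0, 1) \<and> l dvd polar Q (1, i) (0, 1) \<and> l\<^sup>2 dvd qform Q (1, i).
      w (qform Q (x, y))) = form_symbol w D (l, - i) (0, 1) (l * x, y - i * x)"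
  unfolding form_symbol_def
proof (rule sum.reindex_bij_witness[of _
      "\<lambda>(a, b, c). (a * l\<^sup>2 - 2 * b * l * i + c * i\<^sup>2, l * b - i * c, c)"
      "\<lambda>Q. (qform Q (1, i) div l\<^sup>2, polar Q (1, i) (0, 1) div l, qform Q (0, 1))"])
  fix Q assume "Q \<in> {Q. Q \<in> forms (l\<^sup>2 * D) (1, 0) (0, 1) \<and> l dvd polar Q (1, i) (0, 1) \<and> l\<^sup>2 dvd qform Q (1, i)}"
  then obtain a b c r s where Q: "Q = (a, b, c)" and d: "b\<^sup>2 - a * c = l\<^sup>2 * D" "a < 0" "0 < c"
    and r: "b + c * i = l * r" and s: "a + 2 * b * i + c * i\<^sup>2 = l\<^sup>2 * s"
    by (cases Q) (auto simp: forms_def discr_simp qform_simp polar_simp elim!: dvdE)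
  have b: "b = l * r - i * c" using r by (simp add: algebra_simps)
  have a: "a = s * l\<^sup>2 - 2 * r * l * i + c * i\<^sup>2"
    using s unfolding b by (simp add: algebra_simps power2_eq_square)
  have e: "(qform Q (1, i) div l\<^sup>2, polar Q (1, i) (0, 1) div l, qform Q (0, 1)) = (s, r, c)"
    using l r s by (simp add: Q qform_simp polar_simp)
  show "(case (qform Q (1, i) div l\<^sup>2, polar Q (1, i) (0, 1) div l, qform Q (0, 1)) of
      (a, b, c) \<Rightarrow> (a * l\<^sup>2 - 2 * b * l * i + c * i\<^sup>2, l * b - i * c, c)) = Q"
    unfolding e by (simp add: Q a b)
  have "l\<^sup>2 * (r\<^sup>2 - s * c) = l\<^sup>2 * D"
    unfolding d(1)[symmetric] a b by (simp add: algebra_simps power2_eq_square)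
  then have "r\<^sup>2 - s * c = D" using l by simp
  moreover have "qform (s, r, c) (l, - i) = a" unfolding a by (simp add: qform_simp)
  ultimately show "(qform Q (1, i) div l\<^sup>2, polar Q (1, i) (0, 1) div l, qform Q (0, 1)) \<in> forms D (l, - i) (0, 1)"
    unfolding e using d by (simp add: forms_def discr_simp qform_simp[of _ _ _ 0])
  show "w (qform (qform Q (1, i) div l\<^sup>2, polar Q (1, i) (0, 1) div l, qform Q (0, 1)) (l * x, y - i * x)) = w (qform Q (x, y))"
    unfolding e unfolding Q a b by (simp add: qform_simp algebra_simps power2_eq_square)
next
  fix Q assume Q': "Q \<in> forms D (l, - i) (0, 1)"
  obtain a b c where Q: "Q = (a, b, c)" by (cases Q)
  let ?R = "(a * l\<^sup>2 - 2 * b * l * i + c * i\<^sup>2, l * b - i * c, c)"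
  have d: "b\<^sup>2 - a * c = D" "a * l\<^sup>2 - 2 * b * l * i + c * i\<^sup>2 < 0" "0 < c"
    using Q' by (simp_all add: forms_def Q discr_simp qform_simp)
  have 1: "polar ?R (1, i) (0, 1) = l * b" "qform ?R (1, i) = l\<^sup>2 * a"
    by (simp_all add: polar_simp qform_simp algebra_simps power2_eq_square)
  show "(qform (case Q of (a, b, c) \<Rightarrow> (a * l\<^sup>2 - 2 * b * l * i + c * i\<^sup>2, l * b - i * c, c)) (1, i) div l\<^sup>2,
      polar (case Q of (a, b, c) \<Rightarrow> (a * l\<^sup>2 - 2 * b * l * i + c * i\<^sup>2, l * b - i * c, c)) (1, i) (0, 1) div l,
      qform (case Q of (a, b, c) \<Rightarrow> (a * l\<^sup>2 - 2 * b * l * i + c * i\<^sup>2, l * b - i * c, c)) (0, 1)) = Q"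
    unfolding Q prod.case 1 using l by (simp add: qform_simp)
  have "discr ?R = l\<^sup>2 * D"
    unfolding d(1)[symmetric] by (simp add: discr_simp algebra_simps power2_eq_square)
  then have "?R \<in> forms (l\<^sup>2 * D) (1, 0) (0, 1)"
    using d by (simp add: forms_def qform_simp)
  then show "(case Q of (a, b, c) \<Rightarrow> (a * l\<^sup>2 - 2 * b * l * i + c * i\<^sup>2, l * b - i * c, c)) \<in>
      {Q. Q \<in> forms (l\<^sup>2 * D) (1, 0) (0, 1) \<and> l dvd polar Q (1, i) (0, 1) \<and> l\<^sup>2 dvd qform Q (1, i)}"
    unfolding Q prod.case mem_Collect_eq 1 by simp
qed

lemma sum_superlattice_infinity:
  fixes l :: int
  assumes l: "l > 0"
  shows "(\<Sum>Q | Q \<in> forms (l\<^sup>2 * D) (1, 0) (0, 1) \<and> l dvd polar Q (1, 0) (0, 1) \<and> l\<^sup>2 dvd qform Q (0, 1).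
      w (qform Q (0, 1))) = (\<Sum>Q\<in>forms D (1, 0) (0, 1). w (l\<^sup>2 * qform Q (0, 1)))"
proof (rule sum.reindex_bij_witness[of _ "\<lambda>(a, b, c). (a, l * b, l\<^sup>2 * c)"
      "\<lambda>(a, b, c). (a, b div l, c div l\<^sup>2)"])
  fix Q assume "Q \<in> {Q. Q \<in> forms (l\<^sup>2 * D) (1, 0) (0, 1) \<and> l dvd polar Q (1, 0) (0, 1) \<and> l\<^sup>2 dvd qform Q (0, 1)}"
  then obtain a b c where Q: "Q = (a, l * b, l\<^sup>2 * c)" and d: "(l * b)\<^sup>2 - a * (l\<^sup>2 * c) = l\<^sup>2 * D" "a < 0" "0 < l\<^sup>2 * c"
    by (cases Q) (auto simp: forms_def discr_simp qform_simp polar_simp elim!: dvdE)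
  show "(case case Q of (a, b, c) \<Rightarrow> (a, b div l, c div l\<^sup>2) of (a, b, c) \<Rightarrow> (a, l * b, l\<^sup>2 * c)) = Q"
    using l by (simp add: Q)
  have "l\<^sup>2 * (b\<^sup>2 - a * c) = l\<^sup>2 * D"
    unfolding d(1)[symmetric] by (simp add: algebra_simps power2_eq_square)
  then have "b\<^sup>2 - a * c = D" using l by simp
  then show "(case Q of (a, b, c) \<Rightarrow> (a, b div l, c div l\<^sup>2)) \<in> forms D (1, 0) (0, 1)"
    using l d by (simp add: Q forms_def qform_simp discr_simp zero_less_mult_iff)
  show "w (l\<^sup>2 * qform (case Q of (a, b, c) \<Rightarrow> (a, b div l, c div l\<^sup>2)) (0, 1)) = w (qform Q (0, 1))"
    using l by (simp add: Q qform_simp)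
next
  fix Q assume Q': "Q \<in> forms D (1, 0) (0, 1)"
  obtain a b c where Q: "Q = (a, b, c)" by (cases Q)
  show "(case case Q of (a, b, c) \<Rightarrow> (a, l * b, l\<^sup>2 * c) of (a, b, c) \<Rightarrow> (a, b div l, c div l\<^sup>2)) = Q"
    using l by (simp add: Q)
  have d: "b\<^sup>2 - a * c = D" "a < 0" "0 < c"
    using Q' by (simp_all add: forms_def Q discr_simp qform_simp)
  have "(l * b)\<^sup>2 - a * (l\<^sup>2 * c) = l\<^sup>2 * D"
    unfolding d(1)[symmetric] by (simp add: algebra_simps power2_eq_square)
  then show "(case Q of (a, b, c) \<Rightarrow> (a, l * b, l\<^sup>2 * c)) \<in>
    {Q. Q \<in> forms (l\<^sup>2 * D) (1, 0) (0, 1) \<and> l dvd polar Q (1, 0) (0, 1) \<and> l\<^sup>2 dvd qform Q (0, 1)}"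
    using l d by (simp add: Q forms_def discr_simp qform_simp polar_simp)
qed

text \<open>
This lemma and the next two say that each form of discriminant \<open>l^2 * D\<close>, with
\<open>l\<close> exactly dividing \<open>D\<close>, belongs to exactly one lattice of index
\<open>l\<close>: modulo \<open>l\<close> the form is a multiple of the square of a linear form, and
the lattice is its kernel.
\<close>

lemma superlattice_unique:
  fixes l D a b c :: int
  assumes l: "prime l" "l dvd D" "\<not> l\<^sup>2 dvd D" and d: "b\<^sup>2 - a * c = l\<^sup>2 * D"
    and i: "l dvd b + c * i" "l\<^sup>2 dvd a + 2 * b * i + c * i\<^sup>2"
    and j: "l dvd b + c * j" "l\<^sup>2 dvd a + 2 * b * j + c * j\<^sup>2"
  shows "l dvd i - j"
proof (rule ccontr)
  assume n: "\<not> l dvd i - j"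
  have l0: "l \<noteq> 0" "l > 0" using l(1) prime_gt_0_int by auto
  have "l dvd (b + c * i) - (b + c * j)" using i(1) j(1) by (rule dvd_diff)
  then have "l dvd c * (i - j)" by (simp add: algebra_simps)
  then have lc: "l dvd c" using n l(1) prime_dvd_mult_iff by blast
  then have lb: "l dvd b" using i(1) by (simp add: dvd_add_left_iff)
  have "l dvd a + 2 * b * i + c * i\<^sup>2" using i(2) by (meson dvd_trans dvd_power pos2)
  then have la: "l dvd a"
    using lb lc by (metis dvd_add_left_iff dvd_mult dvd_mult2)
  obtain a' b' c' where e: "a = l * a'" "b = l * b'" "c = l * c'" using la lb lc by (elim dvdE)
  have "l\<^sup>2 * (b'\<^sup>2 - a' * c') = l\<^sup>2 * D" using d unfolding e by (simp add: algebra_simps power2_eq_square)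
  then have d': "D = b'\<^sup>2 - a' * c'" using l0 by simp
  have "l * l dvd l * (a' + 2 * b' * i + c' * i\<^sup>2)" "l * l dvd l * (a' + 2 * b' * j + c' * j\<^sup>2)"
    using i(2) j(2) unfolding e by (simp_all add: algebra_simps power2_eq_square)
  then have ij: "l dvd a' + 2 * b' * i + c' * i\<^sup>2" "l dvd a' + 2 * b' * j + c' * j\<^sup>2"
    using l0 by simp_all
  have sq: "l dvd b' + c' * k" if "l dvd a' + 2 * b' * k + c' * k\<^sup>2" for k
  proof -
    have "(b' + c' * k)\<^sup>2 = D + c' * (a' + 2 * b' * k + c' * k\<^sup>2)"
      unfolding d' by (simp add: algebra_simps power2_eq_square)
    then have "l dvd (b' + c' * k)\<^sup>2" using l(2) that by simp
    then show ?thesis using l(1) prime_dvd_power by blast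
  qed
  have "l dvd (b' + c' * i) - (b' + c' * j)" using sq ij by (blast intro: dvd_diff)
  then have "l dvd c' * (i - j)" by (simp add: algebra_simps)
  then have lc: "l dvd c'" using n l(1) prime_dvd_mult_iff by blast
  then have lb: "l dvd b'" using sq[OF ij(1)] by (simp add: dvd_add_left_iff)
  have la: "l dvd a'"
    using lb lc ij(1) by (metis dvd_add_left_iff dvd_mult dvd_mult2)
  have "l\<^sup>2 dvd D" unfolding d' using la lb lc by (simp add: power2_eq_square mult_dvd_mono)
  with l(3) show False by simp
qed

lemma superlattice_unique_infinity:
  fixes l D a b c :: int
  assumes l: "prime l" "l dvd D" "\<not> l\<^sup>2 dvd D" and d: "b\<^sup>2 - a * c = l\<^sup>2 * D"
    and i: "l\<^sup>2 dvd a + 2 * b * i + c * i\<^sup>2"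
    and j: "l dvd b" "l\<^sup>2 dvd c"
  shows False
proof -
  have l0: "l \<noteq> 0" "l > 0" using l(1) prime_gt_0_int by auto
  have "l\<^sup>2 dvd a + 2 * b * i" using i j(2) by (simp add: dvd_add_left_iff)
  moreover have "l dvd a + 2 * b * i" using calculation by (meson dvd_trans dvd_power pos2)
  then have la: "l dvd a" using j(1) by (metis dvd_add_left_iff dvd_mult dvd_mult2)
  obtain a' b' c' where e: "a = l * a'" "b = l * b'" "c = l\<^sup>2 * c'" using la j by (elim dvdE)
  ultimately have "l * l dvd l * (a' + 2 * b' * i)" by (simp add: algebra_simps power2_eq_square)
  then have i': "l dvd a' + 2 * b' * i" using l0 by simp
  have "l\<^sup>2 * (b'\<^sup>2 - a' * (l * c')) = l\<^sup>2 * D" using d unfolding e by (simp add: algebra_simps power2_eq_square)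
  then have d': "D = b'\<^sup>2 - a' * (l * c')" using l0 by simp
  then have "b'\<^sup>2 = D + l * (a' * c')" by (simp add: algebra_simps)
  then have "l dvd b'\<^sup>2" using l(2) by simp
  then have lb: "l dvd b'" using l(1) prime_dvd_power by blast
  then have "l dvd a'" using i' by (metis dvd_add_left_iff dvd_mult dvd_mult2)
  then have "l\<^sup>2 dvd D" unfolding d' using lb by (simp add: power2_eq_square mult_dvd_mono)
  with l(3) show False by simp
qed

lemma superlattice_exists:
  fixes l D a b c :: int
  assumes l: "prime l" "l dvd D" and d: "b\<^sup>2 - a * c = l\<^sup>2 * D"
  shows "(\<exists>i\<in>{0..<l}. l dvd b + c * i \<and> l\<^sup>2 dvd a + 2 * b * i + c * i\<^sup>2) \<or> (l dvd b \<and> l\<^sup>2 dvd c)"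
proof -
  have l0: "l \<noteq> 0" "l > 0" using l(1) prime_gt_0_int by auto
  have sol: "\<exists>i\<in>{0..<l}. l dvd B + C * i" if "\<not> l dvd C" for B C :: int
  proof -
    have "coprime C l" using l(1) that by (metis prime_imp_coprime coprime_commute)
    then obtain k where "[C * k = 1] (mod l)" using cong_solve_coprime_int by blast
    then have "[C * (k * - B) = - B] (mod l)"
      using cong_scalar_right[of "C * k" 1 l "- B"] by (simp add: mult.assoc)
    then have "[C * (k * - B mod l) = - B] (mod l)"
      by (simp add: cong_def mod_mult_right_eq)
    then have "l dvd B + C * (k * - B mod l)"
      by (simp add: cong_iff_dvd_diff add.commute)
    then show ?thesis using l0 by (intro bexI[of _ "k * - B mod l"]) auto
  qed
  show ?thesis
  proof (cases "l dvd c")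
    case False
    then obtain i where i: "i \<in> {0..<l}" "l dvd b + c * i" using sol by blast
    have "c * (a + 2 * b * i + c * i\<^sup>2) = (b + c * i)\<^sup>2 - l\<^sup>2 * D"
      unfolding d[symmetric] by (simp add: algebra_simps power2_eq_square)
    then have "l\<^sup>2 dvd c * (a + 2 * b * i + c * i\<^sup>2)" using i(2) by (simp add: dvd_diff)
    moreover have "coprime (l\<^sup>2) c" using False l(1) by (simp add: prime_imp_coprime)
    ultimately show ?thesis using i by (auto simp: coprime_dvd_mult_right_iff)
  next
    case True
    have "b\<^sup>2 = l\<^sup>2 * D + a * c" using d by simp
    then have "l dvd b\<^sup>2" using True by (simp add: power2_eq_square)
    then have lb: "l dvd b" using l(1) prime_dvd_power by blast
    show ?thesis
    proof (cases "l dvd a")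
      case False
      have "a * c = b\<^sup>2 - l\<^sup>2 * D" using d by simp
      then have "l\<^sup>2 dvd a * c" using lb by (simp add: dvd_diff)
      moreover have "coprime (l\<^sup>2) a" using False l(1) by (simp add: prime_imp_coprime)
      ultimately show ?thesis using lb by (auto simp: coprime_dvd_mult_right_iff)
    next
      case la: True
      obtain a' b' c' where e: "a = l * a'" "b = l * b'" "c = l * c'" using la lb True by (elim dvdE)
      have "l\<^sup>2 * (b'\<^sup>2 - a' * c') = l\<^sup>2 * D" using d unfolding e by (simp add: algebra_simps power2_eq_square)
      then have d': "D = b'\<^sup>2 - a' * c'" using l0 by simp
      show ?thesis
      proof (cases "l dvd c'")
        case True
        then show ?thesis using lb unfolding e by (simp add: power2_eq_square)
      next
        case False
        then obtain i where i: "i \<in> {0..<l}" "l dvd b' + c' * i" using sol by blast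
        have "c' * (a' + 2 * b' * i + c' * i\<^sup>2) = (b' + c' * i)\<^sup>2 - D"
          unfolding d' by (simp add: algebra_simps power2_eq_square)
        then have "l dvd c' * (a' + 2 * b' * i + c' * i\<^sup>2)" using i(2) l(2) by (simp add: dvd_diff power2_eq_square)
        then have "l dvd a' + 2 * b' * i + c' * i\<^sup>2" using False l(1) prime_dvd_mult_iff by blast
        then have "l * l dvd l * (a' + 2 * b' * i + c' * i\<^sup>2)" by simp
        then have "l\<^sup>2 dvd a + 2 * b * i + c * i\<^sup>2" unfolding e by (simp add: algebra_simps power2_eq_square)
        moreover have "l dvd b + c * i" unfolding e by simp
        ultimately show ?thesis using i by blast
      qed
    qed
  qed
qed

text \<open>
The summand of the Lambert series, extended to negative integers as an odd function, as the modular
symbol requires.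
\<close>

definition weight :: "nat \<Rightarrow> int \<Rightarrow> int" where
  "weight r m = (if even m then 0 else if m mod 4 = 1 then m ^ (2 * r) else - (m ^ (2 * r)))"

lemma weight_neg: "weight r (- m) = - weight r m"
proof -
  have "odd m \<Longrightarrow> (- m) mod 4 = 1 \<longleftrightarrow> m mod 4 \<noteq> 1" by presburger
  then show ?thesis by (auto simp: weight_def)
qed

lemma weight_even: "even m \<Longrightarrow> weight r m = 0"
  by (simp add: weight_def)

lemma weight_sq_mult:
  assumes "odd k" shows "weight r (k\<^sup>2 * m) = k ^ (4 * r) * weight r m"
proof -
  obtain j where j: "k = 2 * j + 1" using assms by (rule oddE)
  have "k\<^sup>2 = 1 + 4 * (j\<^sup>2 + j)" unfolding j by (simp add: power2_eq_square algebra_simps)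
  then have "k\<^sup>2 mod 4 = 1" by (simp only: mod_mult_self2) simp
  then have "(k\<^sup>2 * m) mod 4 = m mod 4" by (metis mod_mult_left_eq mult_1)
  moreover have "(k\<^sup>2 * m) ^ (2 * r) = k ^ (4 * r) * m ^ (2 * r)"
    by (simp add: power_mult_distrib flip: power_mult)
  ultimately show ?thesis using assms by (simp add: weight_def)
qed

lemma weight_cong:
  assumes "[m = m'] (mod 2 ^ M)" "M \<ge> 2" shows "[weight r m = weight r m'] (mod 2 ^ M)"
proof -
  have "(4::int) dvd 2 ^ M" using assms(2) le_imp_power_dvd[of 2 M "2::int"] by simp
  then have "[m = m'] (mod 4)" using assms(1) cong_dvd_modulus by blast
  then have "m mod 4 = m' mod 4" by (simp add: cong_def)
  moreover then have "even m = even m'" by presburger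
  ultimately show ?thesis using assms(1) by (auto simp: weight_def cong_minus_minus_iff intro: cong_pow)
qed

definition symb :: "nat \<Rightarrow> int \<Rightarrow> int \<Rightarrow> int \<Rightarrow> int" where
  "symb r D x y = form_symbol (weight r) D (1, 0) (0, 1) (x, y)"

lemma symb_cong:
  assumes "[x = x'] (mod 2 ^ M)" "[y = y'] (mod 2 ^ M)" "M \<ge> 2"
  shows "[symb r D x y = symb r D x' y'] (mod 2 ^ M)"
  unfolding symb_def form_symbol_def
proof (intro cong_sum weight_cong assms(3))
  fix Q :: "int \<times> int \<times> int" obtain a b c where Q: "Q = (a, b, c)" by (cases Q)
  show "[qform Q (x, y) = qform Q (x', y')] (mod 2 ^ M)"
    unfolding Q qform_simp using assms by (intro cong_add cong_mult cong_pow cong_refl)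
qed

lemma symb_even: assumes "even x" "even y" shows "symb r D x y = 0"
  unfolding symb_def form_symbol_def
proof (intro sum.neutral ballI weight_even)
  fix Q :: "int \<times> int \<times> int" obtain a b c where Q: "Q = (a, b, c)" by (cases Q)
  show "even (qform Q (x, y))" unfolding Q qform_simp using assms by simp
qed

lemma symb_minus: "symb r D (- x) y = symb r D x y"
  unfolding symb_def form_symbol_def
  by (rule sum.reindex_bij_witness[of _ "\<lambda>(a, b, c). (a, -b, c)" "\<lambda>(a, b, c). (a, -b, c)"])
    (auto simp: forms_def discr_simp qform_simp)

lemma symb_swap: "symb r D y x = - symb r D x y"
  unfolding symb_def form_symbol_def sum_negf[symmetric]
  by (rule sum.reindex_bij_witness[of _ "\<lambda>(a, b, c). (-c, -b, -a)" "\<lambda>(a, b, c). (-c, -b, -a)"])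
    (auto simp: forms_def discr_simp qform_simp algebra_simps simp flip: weight_neg)

lemma symb_scale: assumes "odd k" shows "symb r D (k * x) (k * y) = k ^ (4 * r) * symb r D x y"
  unfolding symb_def form_symbol_def sum_distrib_left
proof (rule sum.cong[OF refl])
  fix Q :: "int \<times> int \<times> int" obtain a b c where Q: "Q = (a, b, c)" by (cases Q)
  have "qform Q (k * x, k * y) = k\<^sup>2 * qform Q (x, y)"
    unfolding Q qform_simp by (simp add: algebra_simps power2_eq_square)
  then show "weight r (qform Q (k * x, k * y)) = k ^ (4 * r) * weight r (qform Q (x, y))"
    using weight_sq_mult[OF assms] by simp
qed

text \<open>
The three-term relation of the modular symbol, for the cusps 0, 1 and infinity.
\<close>

lemma symb_three:
  assumes "nonsquare D" shows "symb r D x y = symb r D (x - y) y + symb r D x (y - x)"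
proof -
  have "form_symbol (weight r) D (1, 0) (1, 1) (x, y) = symb r D (x - y) y"
    using form_symbol_basis[of 1 1 1 0 "weight r" D "x - y" y] by (simp add: symb_def)
  moreover have "form_symbol (weight r) D (1, 1) (0, 1) (x, y) = symb r D x (y - x)"
    using form_symbol_basis[of 1 1 0 1 "weight r" D x "y - x"] by (simp add: symb_def)
  ultimately show ?thesis
    using form_symbol_add[where w = "weight r", OF assms weight_neg, where ?u1.0 = 1 and ?u2.0 = 0 and ?v1.0 = 1 and ?v2.0 = 1 and ?t1.0 = 0 and ?t2.0 = 1 and x = "(x, y)"]
    by (simp add: symb_def)
qed

text \<open>
For even \<open>z\<close> only the forms with odd last coefficient have a nonzero weight at
\<open>(z, 1)\<close>. Each of them belongs to exactly one of the two lattices of index 2 with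
finite parameter, according to the parity of its middle coefficient.
\<close>

lemma symb_level2:
  assumes D: "nonsquare D" and z: "even z"
  shows "symb r (4 * D) z 1 = symb r D (2 * z) 1 - symb r D 2 (1 - z) + symb r D (2 * z) (1 - z)"
proof -
  let ?S = "forms (4 * D) (1, 0) (0, 1)"
  let ?f = "\<lambda>Q. weight r (qform Q (z, 1))"
  define T where "T = (\<lambda>i :: int. {Q. Q \<in> ?S \<and> 2 dvd polar Q (1, i) (0, 1) \<and> (2::int)\<^sup>2 dvd qform Q (1, i)})"
  define E where "E = {Q. odd (qform Q (0, 1))}"
  have fin: "finite ?S" by (rule finite_forms) simp
  have T: "T i \<subseteq> ?S" for i by (auto simp: T_def)
  have finT: "finite (T i)" for i using T fin finite_subset by blast
  have f0: "?f Q = 0" if "Q \<notin> E" for Q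
  proof (cases Q)
    case (fields a b c)
    show ?thesis using that z by (intro weight_even) (simp add: fields E_def qform_simp)
  qed
  have TE: "sum ?f (T i) = sum ?f (T i \<inter> E)" for i
    by (rule sum.mono_neutral_right) (use f0 finT in auto)
  have "?S \<inter> E = (T 0 \<inter> E) \<union> (T 1 \<inter> E)"
  proof (intro equalityI subsetI)
    fix Q assume Q': "Q \<in> ?S \<inter> E"
    obtain a b c where Q: "Q = (a, b, c)" by (cases Q)
    have d: "b\<^sup>2 - a * c = 4 * D" and c: "odd c"
      using Q' by (simp_all add: Q forms_def discr_simp E_def qform_simp)
    have cop: "coprime 4 c" using c by (metis coprime_power_left_iff coprime_left_2_iff_odd numeral_Bit0 numeral_2_eq_2 power2_eq_square mult_2 numeral_times_numeral num.simps semiring_norm(13) semiring_norm(12) semiring_norm(11))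
    show "Q \<in> (T 0 \<inter> E) \<union> (T 1 \<inter> E)"
    proof (cases "even b")
      case True
      then have "4 dvd b\<^sup>2" by (auto elim!: evenE simp: power2_eq_square)
      then have "4 dvd c * a" using d by (metis dvd_triv_left dvd_diff_right_iff mult.commute diff_diff_eq2 dvd_diff add_diff_cancel_left')
      then have "4 dvd a" using cop by (simp add: coprime_dvd_mult_right_iff)
      then show ?thesis using True Q' by (simp add: Q T_def polar_simp qform_simp)
    next
      case False
      then have "even (b + c)" using c by simp
      then have "4 dvd (b + c)\<^sup>2" by (metis dvd_power_same numeral_Bit0 mult_2 power2_eq_square numeral_times_numeral semiring_norm(11) semiring_norm(12) semiring_norm(13))
      moreover have "c * (a + 2 * b + c) = (b + c)\<^sup>2 - 4 * D"
        unfolding d[symmetric] by (simp add: algebra_simps power2_eq_square)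
      ultimately have "4 dvd c * (a + 2 * b + c)" by simp
      then have "4 dvd a + 2 * b + c" using cop by (simp add: coprime_dvd_mult_right_iff)
      then show ?thesis using False c Q' by (simp add: Q T_def polar_simp qform_simp)
    qed
  qed (use T in auto)
  moreover have "(T 0 \<inter> E) \<inter> (T 1 \<inter> E) = {}"
    by (auto simp: T_def E_def polar_simp qform_simp)
  moreover have "sum ?f ?S = sum ?f (?S \<inter> E)"
    by (rule sum.mono_neutral_right) (use f0 fin in auto)
  ultimately have "sum ?f ?S = sum ?f (T 0) + sum ?f (T 1)"
    unfolding TE using finT by (simp add: sum.union_disjoint)
  also have "sum ?f (T 0) = form_symbol (weight r) D (2, 0) (0, 1) (2 * z, 1)"
    using sum_superlattice[where l = 2 and D = D and i = 0 and w = "weight r" and x = z and y = 1] by (simp add: T_def)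
  also have "\<dots> = symb r D (2 * z) 1"
    by (simp add: form_symbol_def symb_def forms_def qform_def case_prod_beta)
  also have "sum ?f (T 1) = form_symbol (weight r) D (2, -1) (0, 1) (2 * z, 1 - z)"
    using sum_superlattice[where l = 2 and D = D and i = 1 and w = "weight r" and x = z and y = 1] by (simp add: T_def)
  also have "\<dots> = form_symbol (weight r) D (2, -1) (1, 0) (2 * z, 1 - z) + form_symbol (weight r) D (1, 0) (0, 1) (2 * z, 1 - z)"
    by (rule form_symbol_add[where w = "weight r", OF D weight_neg, symmetric]) simp_all
  also have "form_symbol (weight r) D (2, -1) (1, 0) (2 * z, 1 - z) = symb r D (- (1 - z)) 2"
    using form_symbol_basis[of 2 0 1 "-1" "weight r" D "z - 1" 2] by (simp add: symb_def)
  also have "\<dots> = - symb r D 2 (1 - z)" by (simp only: symb_minus symb_swap[of r D "1 - z" 2])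
  finally show ?thesis by (simp add: symb_def[of r "4 * D"] symb_def[of r D "2 * z" "1 - z"] form_symbol_def[of _ "4 * D"])
qed

lemma symb_level2_cong:
  assumes D: "nonsquare D" and z: "even z" and M: "M \<ge> 2" and k: "[(1 - z) * k = 1] (mod 2 ^ M)"
  shows "[symb r (4 * D) z 1 = symb r D (2 * z) 1 +
    (1 - z) ^ (4 * r) * (symb r D (2 * z * k) 1 - symb r D (2 * k) 1)] (mod 2 ^ M)"
proof -
  have o: "odd (1 - z)" using z by simp
  have *: "[t = (1 - z) * (t * k)] (mod 2 ^ M)" for t
    using cong_scalar_left[OF cong_sym[OF k], of t] by (simp add: algebra_simps)
  have **: "[symb r D t (1 - z) = (1 - z) ^ (4 * r) * symb r D (t * k) 1] (mod 2 ^ M)" for t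
    using symb_cong[where r = r and D = D, OF *[of t] cong_refl[of "1 - z"] M]
      symb_scale[OF o, of r D "t * k" 1] by simp
  have "[symb r D (2 * z) 1 - symb r D 2 (1 - z) + symb r D (2 * z) (1 - z) = symb r D (2 * z) 1 -
      (1 - z) ^ (4 * r) * symb r D (2 * k) 1 + (1 - z) ^ (4 * r) * symb r D (2 * z * k) 1] (mod 2 ^ M)"
    by (intro cong_add cong_diff cong_refl **)
  then show ?thesis
    unfolding symb_level2[OF D z] by (simp add: algebra_simps)
qed

lemma odd_inverse_mod: assumes "odd (x::int)" shows "\<exists>k. [x * k = 1] (mod 2 ^ M)"
  using assms cong_solve_coprime_int[of x "2 ^ M"] by auto

text \<open>
A quantitative form of continuity: constancy on the even residues modulo \<open>2^m\<close>, and
modulo \<open>2^(m+1)\<close> dependence on the residue modulo \<open>2^i\<close> only. Multiplying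
the discriminant by 4 lowers \<open>i\<close> by one.
\<close>

definition near_const :: "nat \<Rightarrow> int \<Rightarrow> nat \<Rightarrow> nat \<Rightarrow> bool" where
  "near_const r D m i \<longleftrightarrow> (\<forall>z. even z \<longrightarrow> [symb r D z 1 = symb r D 0 1] (mod 2 ^ m)) \<and>
    (\<forall>z z'. even z \<longrightarrow> even z' \<longrightarrow> [z = z'] (mod 2 ^ i) \<longrightarrow> [symb r D z 1 = symb r D z' 1] (mod 2 ^ Suc m))"

lemma cong_pow2_mono: "[x = y] (mod 2 ^ M) \<Longrightarrow> m \<le> M \<Longrightarrow> [x = y] (mod (2::int) ^ m)"
  using cong_dvd_modulus le_imp_power_dvd by blast

text \<open>
By the level 2 relation the value at \<open>z\<close> for \<open>4 * D\<close> is the value at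
\<open>2 z\<close> for \<open>D\<close> plus a correction which is itself a difference of two values
at arguments divisible by 2; doubling the argument gains one power of 2 in the argument.
\<close>

lemma near_const_step:
  assumes D: "nonsquare D" and h: "near_const r D m (Suc i)"
  shows "near_const r (4 * D) m i"
proof -
  define M where "M = m + i + 2"
  have M: "M \<ge> 2" "m \<le> M" "Suc m \<le> M" "Suc i \<le> M" by (simp_all add: M_def)
  define g where "g z = symb r D z 1" for z
  define d where "d z k = g (2 * z * k) - g (2 * k)" for z k
  have c1: "[g z = g 0] (mod 2 ^ m)" if "even z" for z
    using h that by (simp add: near_const_def g_def)
  have c2: "[g z = g z'] (mod 2 ^ Suc m)" if "even z" "even z'" "[z = z'] (mod 2 ^ Suc i)" for z z'
    using h that unfolding near_const_def g_def by blast
  have lev: "[symb r (4 * D) z 1 = g (2 * z) + (1 - z) ^ (4 * r) * d z k] (mod 2 ^ M)"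
    if "even z" "[(1 - z) * k = 1] (mod 2 ^ M)" for z k
    using symb_level2_cong[OF D that(1) M(1) that(2), of r] by (simp add: g_def d_def)
  have d0: "[d z k = 0] (mod 2 ^ m)" for z k
    using cong_diff[OF c1[of "2 * z * k"] c1[of "2 * k"]] by (simp add: d_def)
  have e1: "[symb r (4 * D) z 1 = g 0] (mod 2 ^ m)" if z: "even z" for z
  proof -
    obtain k where k: "[(1 - z) * k = 1] (mod 2 ^ M)" using odd_inverse_mod[of "1 - z" M] z by auto
    have "[symb r (4 * D) z 1 = g (2 * z) + (1 - z) ^ (4 * r) * d z k] (mod 2 ^ m)"
      using lev[OF z k] M(2) by (rule cong_pow2_mono)
    also have "[g (2 * z) + (1 - z) ^ (4 * r) * d z k = g 0 + (1 - z) ^ (4 * r) * 0] (mod 2 ^ m)"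
      by (intro cong_add cong_mult cong_refl c1 d0) simp
    finally show ?thesis by simp
  qed
  have e2: "[symb r (4 * D) z 1 = symb r (4 * D) z' 1] (mod 2 ^ Suc m)"
    if z: "even z" "even z'" "[z = z'] (mod 2 ^ i)" for z z'
  proof -
    have red: "[(1 - x) ^ (4 * r) * d x k = d x k] (mod 2 ^ Suc m)" if "even x" for x k
    proof -
      have "2 dvd (1 - x) ^ (4 * r) - 1" using that by simp
      moreover have "2 ^ m dvd d x k" using d0 by (simp add: cong_0_iff)
      ultimately have "2 * 2 ^ m dvd ((1 - x) ^ (4 * r) - 1) * d x k" by (rule mult_dvd_mono)
      then show ?thesis by (simp add: cong_iff_dvd_diff left_diff_distrib)
    qed
    obtain k where k: "[(1 - z) * k = 1] (mod 2 ^ M)" using odd_inverse_mod[of "1 - z" M] z by auto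
    obtain k' where k': "[(1 - z') * k' = 1] (mod 2 ^ M)" using odd_inverse_mod[of "1 - z'" M] z by auto
    have i: "i \<le> M" by (simp add: M_def)
    have "[k = k * ((1 - z') * k')] (mod 2 ^ i)"
      using cong_scalar_left[OF cong_pow2_mono[OF cong_sym[OF k'] i], of k] by simp
    also have "[k * ((1 - z') * k') = k * ((1 - z) * k')] (mod 2 ^ i)"
      by (intro cong_mult cong_diff cong_refl cong_sym[OF z(3)])
    also have "k * ((1 - z) * k') = ((1 - z) * k) * k'" by simp
    also have "[((1 - z) * k) * k' = 1 * k'] (mod 2 ^ i)"
      by (intro cong_mult cong_refl cong_pow2_mono[OF k i])
    finally have kk: "[k = k'] (mod 2 ^ i)" by simp
    have dbl: "[2 * x = 2 * y] (mod 2 ^ Suc i)" if "[x = y] (mod 2 ^ i)" for x y :: int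
    proof -
      have "2 * 2 ^ i dvd 2 * (x - y)" using that unfolding cong_iff_dvd_diff by (rule mult_dvd_mono[OF dvd_refl])
      then show ?thesis by (simp only: cong_iff_dvd_diff right_diff_distrib power_Suc)
    qed
    have "[symb r (4 * D) z 1 = g (2 * z) + (1 - z) ^ (4 * r) * d z k] (mod 2 ^ Suc m)"
      using lev[OF z(1) k] M(3) by (rule cong_pow2_mono)
    also have "[g (2 * z) + (1 - z) ^ (4 * r) * d z k = g (2 * z) + d z k] (mod 2 ^ Suc m)"
      by (intro cong_add cong_refl red z)
    also have "[g (2 * z) + d z k = g (2 * z') + d z' k'] (mod 2 ^ Suc m)"
      unfolding d_def
    proof (intro cong_add cong_diff)
      show "[g (2 * z) = g (2 * z')] (mod 2 ^ Suc m)" by (rule c2[OF _ _ dbl[OF z(3)]]) simp_all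
      show "[g (2 * k) = g (2 * k')] (mod 2 ^ Suc m)" by (rule c2[OF _ _ dbl[OF kk]]) simp_all
      have "[z * k = z' * k'] (mod 2 ^ i)" using z(3) kk by (rule cong_mult)
      from dbl[OF this] show "[g (2 * z * k) = g (2 * z' * k')] (mod 2 ^ Suc m)"
        by (intro c2) (simp_all add: mult.assoc)
    qed
    also have "[g (2 * z') + d z' k' = g (2 * z') + (1 - z') ^ (4 * r) * d z' k'] (mod 2 ^ Suc m)"
      by (intro cong_add cong_refl cong_sym[OF red] z)
    also have "[g (2 * z') + (1 - z') ^ (4 * r) * d z' k' = symb r (4 * D) z' 1] (mod 2 ^ Suc m)"
      by (rule cong_sym, rule cong_pow2_mono[OF lev[OF z(2) k'] M(3)])
    finally show ?thesis .
  qed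
  have "[symb r (4 * D) z 1 = symb r (4 * D) 0 1] (mod 2 ^ m)" if "even z" for z
    using e1[OF that] e1[of 0] by (meson cong_sym cong_trans even_zero)
  then show ?thesis using e2 unfolding near_const_def by blast
qed

lemma nonsquare_mult_4: "nonsquare D \<Longrightarrow> nonsquare (4 * D)"
proof (unfold nonsquare_def, intro allI notI)
  fix m assume D: "\<forall>m. D \<noteq> m\<^sup>2" and e: "4 * D = m\<^sup>2"
  then have "even (m\<^sup>2)" by (metis dvd_mult2 even_numeral)
  then obtain k where "m = 2 * k" by auto
  with e have "D = k\<^sup>2" by (simp add: power2_eq_square)
  with D show False by blast
qed

lemma nonsquare_pow4: "nonsquare D \<Longrightarrow> nonsquare (4 ^ j * D)"
  by (induction j) (simp_all add: mult.assoc nonsquare_mult_4)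

lemma near_const_steps:
  assumes D: "nonsquare D" shows "near_const r D m (i + j) \<Longrightarrow> near_const r (4 ^ j * D) m i"
proof (induction j arbitrary: i)
  case (Suc j)
  have "near_const r (4 ^ j * D) m (Suc i)" using Suc.IH[of "Suc i"] Suc.prems by simp
  from near_const_step[OF nonsquare_pow4[OF D] this] show ?case by (simp add: mult.assoc)
qed simp

definition even_const :: "nat \<Rightarrow> int \<Rightarrow> nat \<Rightarrow> bool" where
  "even_const r D m \<longleftrightarrow> (\<forall>z. even z \<longrightarrow> [symb r D z 1 = symb r D 0 1] (mod 2 ^ m))"

lemma near_const_start:
  assumes "even_const r D m" shows "near_const r D m (Suc (Suc m))"
  unfolding near_const_def
proof (intro conjI allI impI)
  fix z z' :: int assume "[z = z'] (mod 2 ^ Suc (Suc m))"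
  then have "[symb r D z 1 = symb r D z' 1] (mod 2 ^ Suc (Suc m))"
    by (intro symb_cong) simp_all
  then show "[symb r D z 1 = symb r D z' 1] (mod 2 ^ Suc m)" by (rule cong_pow2_mono) simp
qed (use assms in \<open>simp add: even_const_def\<close>)

lemma even_const_raise:
  assumes D: "nonsquare D" and h: "even_const r D m"
  shows "even_const r (4 ^ Suc m * D) (Suc m)"
proof -
  have "near_const r D m (1 + Suc m)"
    using near_const_start[OF h] by simp
  then have n: "near_const r (4 ^ Suc m * D) m 1" by (rule near_const_steps[OF D])
  have "[z = 0] (mod 2 ^ 1)" if "even z" for z :: int using that by (simp add: cong_0_iff)
  then have "[symb r (4 ^ Suc m * D) z 1 = symb r (4 ^ Suc m * D) 0 1] (mod 2 ^ Suc m)" if "even z" for z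
    using n[unfolded near_const_def, THEN conjunct2, rule_format, of z 0] that by blast
  then show ?thesis unfolding even_const_def by blast
qed

lemma even_const_mult4:
  assumes D: "nonsquare D" and h: "even_const r D m"
  shows "even_const r (4 * D) m"
proof -
  have "near_const r D m (Suc (Suc m))"
    using near_const_start[OF h] by simp
  then have "near_const r (4 * D) m (Suc m)" by (rule near_const_step[OF D])
  then show ?thesis unfolding near_const_def even_const_def by (rule conjunct1)
qed

text \<open>
Each further power of 2 in the modulus costs finitely many factors 4 in the discriminant. So
induction on the exponent of the modulus works, from the trivial modulus 1.
\<close>

lemma even_const_eventually:
  assumes D: "nonsquare D"
  shows "\<exists>j0. \<forall>j\<ge>j0. even_const r (4 ^ j * D) m"
proof -
  have up: "even_const r (4 ^ (j + i) * D) m" if "even_const r (4 ^ j * D) m" for j i m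
    using that
  proof (induction i)
    case (Suc i)
    then show ?case using even_const_mult4[OF nonsquare_pow4[OF D], of r "j + i" m] by (simp add: mult.assoc)
  qed simp
  have "\<exists>j. even_const r (4 ^ j * D) m"
  proof (induction m)
    case 0 show ?case by (auto simp: even_const_def)
  next
    case (Suc m)
    then obtain j where "even_const r (4 ^ j * D) m" by blast
    then have "even_const r (4 ^ Suc m * (4 ^ j * D)) (Suc m)"
      by (rule even_const_raise[OF nonsquare_pow4[OF D]])
    moreover have "4 ^ Suc m * (4 ^ j * D) = 4 ^ (Suc m + j) * D" by (simp only: power_add mult.assoc)
    ultimately have "even_const r (4 ^ (Suc m + j) * D) (Suc m)" by (simp only:)
    then show ?case by blast
  qed
  then obtain j where "even_const r (4 ^ j * D) m" by blast
  then have "even_const r (4 ^ i * D) m" if "i \<ge> j" for i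
    using up[of j m "i - j"] that by simp
  then show ?thesis by blast
qed

definition odd_fourth :: "nat \<Rightarrow> int \<Rightarrow> int" where
  "odd_fourth r x = (if odd x then x ^ (4 * r) else 0)"

text \<open>
The three-term relation, with parity, determines the symbol from its value at \<open>(0, 1)\<close>
as soon as that value is taken at every even first argument: it is the coboundary of the function
\<open>odd_fourth r\<close>.
\<close>

lemma symb_eisenstein:
  assumes D: "nonsquare D" and M: "M \<ge> 2" and h: "even_const r D M"
  shows "[symb r D x y = symb r D 0 1 * (odd_fourth r y - odd_fourth r x)] (mod 2 ^ M)"
proof -
  have eo: "[symb r D x y = symb r D 0 1 * y ^ (4 * r)] (mod 2 ^ M)" if xy: "even x" "odd y" for x y
  proof -
    obtain k where k: "[y * k = 1] (mod 2 ^ M)" using odd_inverse_mod[OF xy(2), of M] by blast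
    have "[x = y * (x * k)] (mod 2 ^ M)"
      using cong_scalar_left[OF cong_sym[OF k], of x] by (simp add: algebra_simps)
    then have "[symb r D x y = symb r D (y * (x * k)) (y * 1)] (mod 2 ^ M)"
      by (intro symb_cong M) simp_all
    also have "symb r D (y * (x * k)) (y * 1) = y ^ (4 * r) * symb r D (x * k) 1"
      by (rule symb_scale[OF xy(2)])
    also have "[y ^ (4 * r) * symb r D (x * k) 1 = y ^ (4 * r) * symb r D 0 1] (mod 2 ^ M)"
      using h xy(1) unfolding even_const_def by (intro cong_mult cong_refl) simp
    finally show ?thesis by (simp add: mult.commute)
  qed
  show ?thesis
  proof (cases "even x"; cases "even y")
    assume "even x" "even y" then show ?thesis using symb_even by (simp add: odd_fourth_def)
  next
    assume "even x" "odd y" then show ?thesis using eo by (simp add: odd_fourth_def)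
  next
    assume "odd x" "even y"
    then show ?thesis using eo[of y x] symb_swap[of r D x y]
      by (simp add: odd_fourth_def cong_minus_minus_iff)
  next
    assume o: "odd x" "odd y"
    have "[symb r D (x - y) y - symb r D (y - x) x = symb r D 0 1 * y ^ (4 * r) - symb r D 0 1 * x ^ (4 * r)] (mod 2 ^ M)"
      using o by (intro cong_diff eo) simp_all
    then show ?thesis unfolding symb_three[OF D, of r x y] symb_swap[of r D x "y - x"] using o
      by (simp add: odd_fourth_def algebra_simps)
  qed
qed

text \<open>
Extends the congruence to arbitrary cusps along the Euclidean algorithm, in the form of an induction
on the first coordinate of the cusp.
\<close>

lemma form_symbol_eisenstein:
  assumes D: "nonsquare D" and M: "M \<ge> 2" and h: "even_const r D M"
  shows "u1 > 0 \<Longrightarrow> coprime u1 u2 \<Longrightarrow>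
    [form_symbol (weight r) D (u1, u2) (0, 1) (x, y) = symb r D 0 1 * (odd_fourth r (u1 * y - u2 * x) - odd_fourth r x)] (mod 2 ^ M)"
proof (induction "nat u1" arbitrary: u1 u2 rule: less_induct)
  case less
  show ?case
  proof (cases "u1 = 1")
    case True
    have "form_symbol (weight r) D (u1, u2) (0, 1) (x, y) = symb r D x (y - u2 * x)"
      using form_symbol_basis[of 1 1 0 u2 "weight r" D x "y - u2 * x"] by (simp add: True symb_def)
    then show ?thesis using symb_eisenstein[OF D M h] by (simp add: True)
  next
    case False
    then have u1: "u1 > 1" using less.prems by simp
    have "coprime u2 u1" using less.prems by (simp add: coprime_commute)
    then obtain t where "[u2 * t = 1] (mod u1)" using cong_solve_coprime_int by blast
    then have t: "[u2 * (- t mod u1) = - 1] (mod u1)"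
    proof -
      have "[u2 * (- t) = - 1] (mod u1)"
        using cong_minus_minus_iff[THEN iffD2, OF \<open>[u2 * t = 1] (mod u1)\<close>] by simp
      then show ?thesis by (simp add: cong_def mod_mult_right_eq)
    qed
    define p where "p = - t mod u1"
    have p: "0 \<le> p" "p < u1" using u1 by (simp_all add: p_def)
    have "[u2 * p = - 1] (mod u1)" using t unfolding p_def .
    obtain q where q: "u2 * p = -1 + u1 * q"
    proof -
      have "u1 dvd u2 * p - - 1" using \<open>[u2 * p = - 1] (mod u1)\<close> by (simp only: cong_iff_dvd_diff)
      then obtain q where "u2 * p - - 1 = u1 * q" by blast
      then show ?thesis using that[of q] by simp
    qed
    have p0: "p \<noteq> 0"
    proof
      assume "p = 0" then have "u1 * q = 1" using q by simp
      then have "u1 dvd 1" by (metis dvd_triv_left)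
      then show False using u1 by simp
    qed
    have det: "u1 * q - p * u2 = 1" using q by (simp add: algebra_simps)
    have cop: "coprime p q"
    proof (rule coprimeI)
      fix d assume "d dvd p" "d dvd q"
      then have "d dvd u1 * q - p * u2" by (intro dvd_diff) simp_all
      then show "is_unit d" unfolding det .
    qed
    have IH: "[form_symbol (weight r) D (p, q) (0, 1) (x, y) = symb r D 0 1 * (odd_fourth r (p * y - q * x) - odd_fourth r x)] (mod 2 ^ M)"
      using less.hyps[of p q] p p0 cop by simp
    define s where "s = q * x - p * y"
    define t where "t = u1 * y - u2 * x"
    have "u1 * s + p * t = (u1 * q - p * u2) * x" "u2 * s + q * t = (u1 * q - p * u2) * y"
      by (simp_all add: s_def t_def algebra_simps)
    then have st: "u1 * s + p * t = x" "u2 * s + q * t = y" by (simp_all add: det)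
    have "form_symbol (weight r) D (u1, u2) (p, q) (x, y) = symb r D s t"
      using form_symbol_basis[OF det, of "weight r" D s t] by (simp add: st symb_def)
    then have A: "[form_symbol (weight r) D (u1, u2) (p, q) (x, y) = symb r D 0 1 * (odd_fourth r t - odd_fourth r s)] (mod 2 ^ M)"
      using symb_eisenstein[OF D M h] by simp
    have evs: "odd_fourth r (p * y - q * x) = odd_fourth r s"
    proof -
      have "p * y - q * x = - s" by (simp add: s_def)
      then show ?thesis by (simp add: odd_fourth_def)
    qed
    have "form_symbol (weight r) D (u1, u2) (0, 1) (x, y) =
      form_symbol (weight r) D (u1, u2) (p, q) (x, y) + form_symbol (weight r) D (p, q) (0, 1) (x, y)"
      by (rule form_symbol_add[where w = "weight r", OF D weight_neg, symmetric]) (use p0 u1 det in \<open>simp_all add: mult.commute\<close>)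
    then show ?thesis using cong_add[OF A IH] unfolding evs by (simp add: t_def algebra_simps)
  qed
qed

text \<open>
The \<open>l + 1\<close> lattices of index \<open>l\<close> give the symbol at \<open>l^2 *
D\<close>: the lattices with finite parameter contribute the Eisenstein value along the cusp
\<open>(l, -i)\<close>, the remaining one contributes \<open>l^(4 r)\<close> times the value at
\<open>D\<close>. As \<open>l = -1\<close>, the sum of the coefficients is \<open>1 + (l - 1) + 1 =
l + 1 = 0\<close> modulo \<open>2^M\<close>.
\<close>

lemma hecke_vanish:
  assumes l: "prime l" "odd l" "l dvd D" "\<not> l\<^sup>2 dvd D"
    and M: "M \<ge> 2" and h: "even_const r D M" and l1: "[l = -1] (mod 2 ^ M)"
  shows "[symb r (l\<^sup>2 * D) 0 1 = 0] (mod (2::int) ^ M)"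
proof -
  have l0: "l > 0" using l(1) prime_gt_0_int by auto
  have D: "nonsquare D"
    unfolding nonsquare_def
  proof (intro allI notI)
    fix m assume "D = m\<^sup>2"
    then have "l dvd m" using l(1,3) prime_dvd_power by blast
    then show False using l(4) \<open>D = m\<^sup>2\<close> by simp
  qed
  let ?S = "forms (l\<^sup>2 * D) (1, 0) (0, 1)"
  let ?f = "\<lambda>Q. weight r (qform Q (0, 1))"
  define T where "T = (\<lambda>i :: int. {Q. Q \<in> ?S \<and> l dvd polar Q (1, i) (0, 1) \<and> l\<^sup>2 dvd qform Q (1, i)})"
  define U where "U = {Q. Q \<in> ?S \<and> l dvd polar Q (1, 0) (0, 1) \<and> l\<^sup>2 dvd qform Q (0, 1)}"
  define c where "c = symb r D 0 1"
  have fin: "finite ?S" by (rule finite_forms) simp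
  have finT: "finite (T i)" for i by (rule finite_subset[OF _ fin]) (auto simp: T_def)
  have finU: "finite U" by (rule finite_subset[OF _ fin]) (auto simp: U_def)
  have T_iff: "(a, b, c) \<in> T i \<longleftrightarrow> (a, b, c) \<in> ?S \<and> l dvd b + c * i \<and> l\<^sup>2 dvd a + 2 * b * i + c * i\<^sup>2"
    for a b c i by (simp add: T_def polar_simp qform_simp)
  have U_iff: "(a, b, c) \<in> U \<longleftrightarrow> (a, b, c) \<in> ?S \<and> l dvd b \<and> l\<^sup>2 dvd c"
    for a b c by (simp add: U_def polar_simp qform_simp)
  have S_disc: "b\<^sup>2 - a * c = l\<^sup>2 * D" if "(a, b, c) \<in> ?S" for a b c
    using that by (simp add: forms_def discr_simp)
  have cover: "?S = (\<Union>i\<in>{0..<l}. T i) \<union> U"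
  proof (intro equalityI subsetI)
    fix Q assume Q': "Q \<in> ?S"
    obtain a b c where Q: "Q = (a, b, c)" by (cases Q)
    show "Q \<in> (\<Union>i\<in>{0..<l}. T i) \<union> U"
      using superlattice_exists[OF l(1,3) S_disc[OF Q'[unfolded Q]]] Q'
      unfolding Q by (auto simp: T_iff U_iff)
  qed (auto simp: T_def U_def)
  have disj1: "T i \<inter> T j = {}" if "i \<in> {0..<l}" "j \<in> {0..<l}" "i \<noteq> j" for i j
  proof (rule ccontr)
    assume "T i \<inter> T j \<noteq> {}"
    then obtain a b c where Q: "(a, b, c) \<in> T i" "(a, b, c) \<in> T j" by auto
    have "l dvd i - j"
      using superlattice_unique[OF l(1,3,4) S_disc] Q unfolding T_iff by blast
    then have "i mod l = j mod l" by (simp add: mod_eq_dvd_iff)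
    then show False using that by simp
  qed
  have disj2: "(\<Union>i\<in>{0..<l}. T i) \<inter> U = {}"
  proof (rule ccontr)
    assume "(\<Union>i\<in>{0..<l}. T i) \<inter> U \<noteq> {}"
    then obtain a b c i where Q: "(a, b, c) \<in> T i" "(a, b, c) \<in> U" by auto
    show False
      using superlattice_unique_infinity[OF l(1,3,4) S_disc] Q unfolding T_iff U_iff by blast
  qed
  have "symb r (l\<^sup>2 * D) 0 1 = sum ?f ?S" by (simp add: symb_def form_symbol_def)
  also have "\<dots> = (\<Sum>i\<in>{0..<l}. sum ?f (T i)) + sum ?f U"
    unfolding cover using finT finU disj2 disj1
    by (subst sum.union_disjoint) (auto simp: sum.UNION_disjoint)
  also have "sum ?f U = l ^ (4 * r) * c"
    using sum_superlattice_infinity[OF l0, where D = D and w = "weight r"] weight_sq_mult[OF l(2)]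
    by (simp add: U_def c_def symb_def form_symbol_def sum_distrib_left)
  also have "(\<Sum>i\<in>{0..<l}. sum ?f (T i)) = (\<Sum>i\<in>{0..<l}. form_symbol (weight r) D (l, - i) (0, 1) (0, 1))"
    using sum_superlattice[OF l0, where D = D and w = "weight r" and x = 0 and y = 1]
    by (simp add: T_def)
  also have "{0..<l} = insert 0 {1..<l}" using l0 by auto
  also have "(\<Sum>i\<in>insert 0 {1..<l}. form_symbol (weight r) D (l, - i) (0, 1) (0, 1)) =
      form_symbol (weight r) D (l, 0) (0, 1) (0, 1) + (\<Sum>i\<in>{1..<l}. form_symbol (weight r) D (l, - i) (0, 1) (0, 1))"
    by simp
  also have "form_symbol (weight r) D (l, 0) (0, 1) (0, 1) = c"
    using l0 by (simp add: c_def symb_def form_symbol_def forms_def qform_def case_prod_beta mult_less_0_iff)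
  finally have 1: "symb r (l\<^sup>2 * D) 0 1 =
    c + (\<Sum>i\<in>{1..<l}. form_symbol (weight r) D (l, - i) (0, 1) (0, 1)) + l ^ (4 * r) * c" .
  have "[form_symbol (weight r) D (l, - i) (0, 1) (0, 1) = c * l ^ (4 * r)] (mod 2 ^ M)" if "i \<in> {1..<l}" for i
  proof -
    have "\<not> l dvd i" using that zdvd_imp_le by fastforce
    then have "coprime l (- i)" using l(1) by (simp add: prime_imp_coprime)
    then show ?thesis
      using form_symbol_eisenstein[OF D M h l0, of "- i" 0 1] l(2) by (simp add: odd_fourth_def c_def)
  qed
  then have "[(\<Sum>i\<in>{1..<l}. form_symbol (weight r) D (l, - i) (0, 1) (0, 1)) = (\<Sum>i\<in>{1..<l}. c * l ^ (4 * r))] (mod 2 ^ M)"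
    by (rule cong_sum)
  also have "(\<Sum>i\<in>{1..<l}. c * l ^ (4 * r)) = (l - 1) * (c * l ^ (4 * r))" using l0 by simp
  finally have 2: "[symb r (l\<^sup>2 * D) 0 1 = c + (l - 1) * (c * l ^ (4 * r)) + l ^ (4 * r) * c] (mod 2 ^ M)"
    unfolding 1 by (intro cong_add cong_refl)
  have "c + (l - 1) * (c * l ^ (4 * r)) + l ^ (4 * r) * c = c * (1 + l ^ (4 * r + 1))"
    by (simp add: algebra_simps)
  also have "[c * (1 + l ^ (4 * r + 1)) = c * (1 + (- 1) ^ (4 * r + 1))] (mod 2 ^ M)"
    by (intro cong_mult cong_add cong_refl cong_pow l1)
  finally have "[c + (l - 1) * (c * l ^ (4 * r)) + l ^ (4 * r) * c = 0] (mod 2 ^ M)" by simp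
  with 2 show ?thesis by (rule cong_trans)
qed

text \<open>
A form \<open>(a, b, c)\<close> with \<open>a < 0 < c\<close> and \<open>b^2 - a c = N\<close> is a
number \<open>b\<close> with \<open>b^2 < N\<close> and a factorisation of \<open>N - b^2\<close>.
\<close>

lemma symb_divisor_sum:
  "symb r (int N) 0 1 = (\<Sum>b | b\<^sup>2 < int N. \<Sum>d | d dvd nat (int N - b\<^sup>2). weight r (int d))"
proof -
  have fin: "finite {b :: int. b\<^sup>2 < int N}"
  proof (rule finite_subset)
    show "{b :: int. b\<^sup>2 < int N} \<subseteq> {- int N..int N}"
    proof
      fix b :: int assume "b \<in> {b. b\<^sup>2 < int N}"
      moreover have "\<bar>b\<bar> \<le> b\<^sup>2"
      proof (cases "b = 0")
        case False
        then have "\<bar>b\<bar> * 1 \<le> \<bar>b\<bar> * \<bar>b\<bar>" by (intro mult_left_mono) auto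
        then show ?thesis by (simp add: power2_eq_square)
      qed simp
      ultimately show "b \<in> {- int N..int N}" by auto
    qed
  qed simp
  have "(\<Sum>b | b\<^sup>2 < int N. \<Sum>d | d dvd nat (int N - b\<^sup>2). weight r (int d)) =
    (\<Sum>(b, d)\<in>(SIGMA b:{b. b\<^sup>2 < int N}. {d. d dvd nat (int N - b\<^sup>2)}). weight r (int d))"
    using fin by (intro sum.Sigma) auto
  also have "\<dots> = symb r (int N) 0 1"
    unfolding symb_def form_symbol_def
  proof (rule sum.reindex_bij_witness[of _ "\<lambda>(a, b, c). (b, nat c)"
        "\<lambda>(b, d). (- ((int N - b\<^sup>2) div int d), b, int d)"])
    fix p assume "p \<in> (SIGMA b:{b. b\<^sup>2 < int N}. {d. d dvd nat (int N - b\<^sup>2)})"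
    then obtain b d where p: "p = (b, d)" "b\<^sup>2 < int N" "d dvd nat (int N - b\<^sup>2)" by auto
    have "int d dvd int N - b\<^sup>2" using p by (metis int_dvd_int_iff less_imp_le diff_ge_0_iff_ge nat_0_le)
    then obtain e where e: "int N - b\<^sup>2 = int d * e" by blast
    have "int d * e > 0" using p(2) unfolding e[symmetric] by simp
    then have de: "int d > 0" "e > 0" by (simp_all add: zero_less_mult_iff)
    show "(case case p of (b, d) \<Rightarrow> (- ((int N - b\<^sup>2) div int d), b, int d) of (a, b, c) \<Rightarrow> (b, nat c)) = p"
      by (simp add: p)
    show "(case p of (b, d) \<Rightarrow> (- ((int N - b\<^sup>2) div int d), b, int d)) \<in> forms (int N) (1, 0) (0, 1)"
      using de e by (simp add: p(1) forms_def discr_simp qform_simp algebra_simps)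
    show "weight r (qform (case p of (b, d) \<Rightarrow> (- ((int N - b\<^sup>2) div int d), b, int d)) (0, 1)) = (case p of (b, d) \<Rightarrow> weight r (int d))"
      by (simp add: p(1) qform_simp)
  next
    fix Q assume Q': "Q \<in> forms (int N) (1, 0) (0, 1)"
    obtain a b c where Q: "Q = (a, b, c)" by (cases Q)
    have d: "int N = b\<^sup>2 - a * c" "a < 0" "c > 0"
      using Q' by (simp_all add: Q forms_def discr_simp qform_simp)
    have e: "int N - b\<^sup>2 = c * (- a)" using d by simp
    have ed: "(int N - b\<^sup>2) div c = - a" unfolding e using d(3) by (intro nonzero_mult_div_cancel_left) simp
    show "(case case Q of (a, b, c) \<Rightarrow> (b, nat c) of (b, d) \<Rightarrow> (- ((int N - b\<^sup>2) div int d), b, int d)) = Q"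
      using d ed by (simp add: Q)
    have "nat (int N - b\<^sup>2) = nat c * nat (- a)" unfolding e using d(3) by (intro nat_mult_distrib) simp
    moreover have "b\<^sup>2 < int N" using d by (simp add: mult_neg_pos)
    ultimately show "(case Q of (a, b, c) \<Rightarrow> (b, nat c)) \<in> (SIGMA b:{b. b\<^sup>2 < int N}. {d. d dvd nat (int N - b\<^sup>2)})"
      by (simp add: Q)
  qed
  finally show ?thesis by simp
qed

text \<open>
Apply the Hecke relation to \<open>D = 4^j * l * n\<close>; it is exactly divisible by
\<open>l\<close>, hence no square.
\<close>

theorem divisor_sum_vanish:
  fixes l n :: nat
  assumes l: "prime l" "odd l" "[int l = - 1] (mod 2 ^ M)" and M: "M \<ge> 2" and n: "\<not> l dvd n"
  shows "\<exists>j0. \<forall>j\<ge>j0. (2::int) ^ M dvd (\<Sum>b | b\<^sup>2 < int (4 ^ j * l ^ 3 * n).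
      \<Sum>d | d dvd nat (int (4 ^ j * l ^ 3 * n) - b\<^sup>2). weight r (int d))"
proof -
  define D where "D = int (l * n)"
  have pl: "prime (int l)" using l(1) by simp
  have nl: "\<not> (int l)\<^sup>2 dvd 4 ^ j * D" for j
  proof
    assume "(int l)\<^sup>2 dvd 4 ^ j * D"
    then have "int l * int l dvd int l * (4 ^ j * int n)" by (simp add: D_def power2_eq_square algebra_simps)
    then have "int l dvd 4 ^ j * int n" using pl by simp
    moreover have "\<not> int l dvd 4 ^ j"
    proof
      assume "int l dvd 4 ^ j"
      then have "int l dvd 2 ^ (2 * j)" by (simp add: power_mult)
      then have "int l dvd 2" using pl prime_dvd_power by blast
      then have "int l \<le> 2" by (rule zdvd_imp_le) simp
      moreover have "int l \<ge> 2" using prime_ge_2_int[OF pl] .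
      ultimately show False using l(2) by simp
    qed
    ultimately have "int l dvd int n" using pl prime_dvd_mult_iff by blast
    then show False using n by simp
  qed
  have D: "nonsquare D"
    unfolding nonsquare_def
  proof (intro allI notI)
    fix m assume "D = m\<^sup>2"
    moreover have "int l dvd D" by (simp add: D_def)
    ultimately have "int l dvd m" using pl prime_dvd_power by blast
    then have "(int l)\<^sup>2 dvd D" using \<open>D = m\<^sup>2\<close> by simp
    then show False using nl[of 0] by simp
  qed
  obtain j0 where j0: "\<forall>j\<ge>j0. even_const r (4 ^ j * D) M" using even_const_eventually[OF D] by blast
  show ?thesis
  proof (intro exI allI impI)
    fix j assume j: "j0 \<le> j"
    have "[symb r ((int l)\<^sup>2 * (4 ^ j * D)) 0 1 = 0] (mod 2 ^ M)"
      by (rule hecke_vanish) (use pl l nl j0 j M in \<open>simp_all add: D_def\<close>)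
    moreover have "(int l)\<^sup>2 * (4 ^ j * D) = int (4 ^ j * l ^ 3 * n)"
      by (simp add: D_def power2_eq_square power3_eq_cube)
    ultimately have "[symb r (int (4 ^ j * l ^ 3 * n)) 0 1 = 0] (mod 2 ^ M)" by simp
    then show "2 ^ M dvd (\<Sum>b | b\<^sup>2 < int (4 ^ j * l ^ 3 * n).
      \<Sum>d | d dvd nat (int (4 ^ j * l ^ 3 * n) - b\<^sup>2). weight r (int d))"
      unfolding symb_divisor_sum by (simp add: cong_0_iff)
  qed
qed

section \<open>Theta series and their dissections\<close>

definition dilate :: "nat \<Rightarrow> 'a::idom fps \<Rightarrow> 'a fps" where
  "dilate m f = f oo fps_X ^ m"

definition neg_arg :: "'a::idom fps \<Rightarrow> 'a fps" where
  "neg_arg f = f oo (fps_const (- 1) * fps_X)"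

lemma dil_nth: assumes "m > 0" shows "dilate m f $ n = (if m dvd n then f $ (n div m) else 0)"
proof -
  have "dilate m f $ n = (\<Sum>i=0..n. if n = m * i then f $ i else 0)"
    unfolding dilate_def fps_compose_nth by (intro sum.cong) (simp_all flip: power_mult)
  also have "\<dots> = (if m dvd n then f $ (n div m) else 0)"
  proof (cases "m dvd n")
    case True
    then have "\<And>i. (n = m * i) = (i = n div m)" using assms by auto
    then show ?thesis using True by simp
  next
    case False
    then have "\<And>i. n \<noteq> m * i" by auto
    then show ?thesis using False by simp
  qed
  finally show ?thesis .
qed

lemma neg_nth: "neg_arg f $ n = (- 1) ^ n * f $ n"
  by (simp add: neg_arg_def)

lemma dil_mult: "m > 0 \<Longrightarrow> dilate m (f * g) = dilate m f * dilate m g"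
  unfolding dilate_def by (rule fps_compose_mult_distrib) simp

lemma dil_power: "m > 0 \<Longrightarrow> dilate m (f ^ k) = dilate m f ^ k"
  unfolding dilate_def by (rule fps_compose_power[symmetric]) simp

lemma dil_add: "dilate m (f + g) = dilate m f + dilate m g"
  unfolding dilate_def by (rule fps_compose_add_distrib)

lemma dil_diff: "dilate m (f - g) = dilate m f - dilate m g"
  unfolding dilate_def by (rule fps_compose_sub_distrib)

lemma dil_1 [simp]: "dilate m 1 = 1"
  by (simp add: dilate_def)

lemma dil_numeral [simp]: "dilate m (numeral k) = numeral k"
  by (simp add: dilate_def)

lemma dil_dil: "m > 0 \<Longrightarrow> k > 0 \<Longrightarrow> dilate m (dilate k f) = dilate (m * k) f"
  by (rule fps_ext) (auto simp: dil_nth div_mult2_eq dvd_mult_imp_div mult.commute elim!: dvdE)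

lemma neg_mult: "neg_arg (f * g) = neg_arg f * neg_arg g"
  unfolding neg_arg_def by (rule fps_compose_mult_distrib) simp

lemma neg_power: "neg_arg (f ^ k) = neg_arg f ^ k"
  unfolding neg_arg_def by (rule fps_compose_power[symmetric]) simp

lemma neg_add: "neg_arg (f + g) = neg_arg f + neg_arg g"
  unfolding neg_arg_def by (rule fps_compose_add_distrib)

lemma neg_1 [simp]: "neg_arg 1 = 1"
  by (simp add: neg_arg_def)

lemma neg_numeral [simp]: "neg_arg (numeral k) = numeral k"
  by (simp add: neg_arg_def)

lemma neg_neg [simp]: "neg_arg (neg_arg f) = f"
  by (rule fps_ext) (simp add: neg_nth flip: power_add mult.assoc)

lemma neg_dil_even: "m > 0 \<Longrightarrow> even m \<Longrightarrow> neg_arg (dilate m f) = dilate m f"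
  by (rule fps_ext) (auto simp: dil_nth neg_nth elim!: dvdE)

definition phi :: "int fps" where
  "phi = Abs_fps (\<lambda>n. int (card {x :: int. x\<^sup>2 = int n}))"

definition osq :: "int fps" where
  "osq = Abs_fps (\<lambda>n. if \<exists>x. odd x \<and> n = x\<^sup>2 then 1 else 0)"

lemma abs_le_sq: "\<bar>b\<bar> \<le> (b::int)\<^sup>2"
proof (cases "b = 0")
  case False
  then have "\<bar>b\<bar> * 1 \<le> \<bar>b\<bar> * \<bar>b\<bar>" by (intro mult_left_mono) auto
  then show ?thesis by (simp add: power2_eq_square)
qed simp

lemma finite_sq_le: "finite {b :: int. b\<^sup>2 \<le> N}"
proof (rule finite_subset)
  show "{b :: int. b\<^sup>2 \<le> N} \<subseteq> {- N..N}"
  proof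
    fix b :: int assume "b \<in> {b. b\<^sup>2 \<le> N}"
    then have "\<bar>b\<bar> \<le> N" using abs_le_sq[of b] by simp
    then show "b \<in> {- N..N}" by auto
  qed
qed simp

lemma phi_mult_nth: "(phi * g) $ n = (\<Sum>b | b\<^sup>2 \<le> int n. g $ nat (int n - b\<^sup>2))"
proof -
  let ?B = "\<lambda>k. {b :: int. b\<^sup>2 = int k}"
  have fin: "finite (?B k)" for k by (rule finite_subset[OF _ finite_sq_le[of "int k"]]) auto
  have "(phi * g) $ n = (\<Sum>k=0..n. \<Sum>b\<in>?B k. g $ nat (int n - b\<^sup>2))"
    unfolding fps_mult_nth
  proof (rule sum.cong[OF refl])
    fix k assume k: "k \<in> {0..n}"
    have "(\<Sum>b\<in>?B k. g $ nat (int n - b\<^sup>2)) = (\<Sum>b\<in>?B k. g $ (n - k))"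
    proof (rule sum.cong[OF refl])
      fix b assume "b \<in> ?B k"
      then have "nat (int n - b\<^sup>2) = n - k" using k by auto
      then show "g $ nat (int n - b\<^sup>2) = g $ (n - k)" by simp
    qed
    then show "phi $ k * g $ (n - k) = (\<Sum>b\<in>?B k. g $ nat (int n - b\<^sup>2))"
      by (simp only: sum_constant) (simp add: phi_def)
  qed
  also have "\<dots> = (\<Sum>b\<in>(\<Union>k\<in>{0..n}. ?B k). g $ nat (int n - b\<^sup>2))"
    using fin by (intro sum.UNION_disjoint[symmetric]) auto
  also have "(\<Union>k\<in>{0..n}. ?B k) = {b. b\<^sup>2 \<le> int n}"
  proof (intro equalityI subsetI)
    fix b :: int assume "b \<in> {b. b\<^sup>2 \<le> int n}"
    then have "b\<^sup>2 = int (nat (b\<^sup>2))" "nat (b\<^sup>2) \<le> n" by auto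
    then show "b \<in> (\<Union>k\<in>{0..n}. ?B k)" by (intro UN_I[of "nat (b\<^sup>2)"]) auto
  qed auto
  finally show ?thesis .
qed

lemma phi_0 [simp]: "phi $ 0 = 1"
proof -
  have "{x :: int. x\<^sup>2 = int 0} = {0}" by auto
  then show ?thesis by (simp add: phi_def)
qed

lemma phi_sq_nth: "(phi ^ 2) $ n = int (card {(x :: int, y :: int). x\<^sup>2 + y\<^sup>2 = int n})"
proof -
  let ?B = "{b :: int. b\<^sup>2 \<le> int n}"
  have "(phi ^ 2) $ n = (\<Sum>b\<in>?B. int (card {y :: int. y\<^sup>2 = int n - b\<^sup>2}))"
    unfolding power2_eq_square[of phi] phi_mult_nth by (intro sum.cong) (simp_all add: phi_def)
  also have "\<dots> = int (card (SIGMA b:?B. {y :: int. y\<^sup>2 = int n - b\<^sup>2}))"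
  proof -
    have "finite {y :: int. y\<^sup>2 = int n - b\<^sup>2}" for b
      by (rule finite_subset[OF _ finite_sq_le[of "int n - b\<^sup>2"]]) auto
    then show ?thesis by (subst card_SigmaI) (simp_all add: finite_sq_le)
  qed
  also have "(SIGMA b:?B. {y :: int. y\<^sup>2 = int n - b\<^sup>2}) = {(x, y). x\<^sup>2 + y\<^sup>2 = int n}"
  proof -
    have "x\<^sup>2 \<le> int n" if "x\<^sup>2 + y\<^sup>2 = int n" for x y :: int
      using zero_le_power2[of y] that by linarith
    then show ?thesis by (auto simp: algebra_simps)
  qed
  finally show ?thesis .
qed

text \<open>
The map \<open>(x, y) \<mapsto> (x + y, x - y)\<close> is a bijection between the representations of
\<open>n\<close> and of \<open>2 n\<close>.
\<close>

lemma phi_sq_double: "(phi ^ 2) $ (2 * n) = (phi ^ 2) $ n"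
proof -
  have "bij_betw (\<lambda>(x, y). (x + y, x - y)) {(x :: int, y :: int). x\<^sup>2 + y\<^sup>2 = int n}
    {(x :: int, y :: int). x\<^sup>2 + y\<^sup>2 = int (2 * n)}"
  proof (rule bij_betwI[where g = "\<lambda>(x, y). ((x + y) div 2, (x - y) div 2)"])
    show "(\<lambda>(x, y). ((x + y) div 2, (x - y) div 2)) \<in>
      {(x :: int, y :: int). x\<^sup>2 + y\<^sup>2 = int (2 * n)} \<rightarrow> {(x, y). x\<^sup>2 + y\<^sup>2 = int n}"
    proof (clarsimp)
      fix x y :: int assume e: "x\<^sup>2 + y\<^sup>2 = 2 * int n"
      then have "even (x\<^sup>2 + y\<^sup>2)" by simp
      then have ev: "even (x + y)" by simp
      obtain u where u: "x + y = 2 * u" using ev by (rule evenE)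
      have uy: "x - y = 2 * (u - y)" using u by simp
      have x: "x = 2 * u - y" using u by simp
      have "2 * (u\<^sup>2 + (u - y)\<^sup>2) = 2 * int n"
        using e unfolding x by (simp add: power2_eq_square algebra_simps)
      then show "((x + y) div 2)\<^sup>2 + ((x - y) div 2)\<^sup>2 = int n" unfolding u uy by simp
    qed
    fix p :: "int \<times> int" assume p: "p \<in> {(x, y). x\<^sup>2 + y\<^sup>2 = int (2 * n)}"
    obtain x y where xy: "p = (x, y)" by (cases p)
    have "even (x\<^sup>2 + y\<^sup>2)" using p xy by simp
    then have "even (x + y)" by simp
    then obtain u where u: "x + y = 2 * u" by (rule evenE)
    have u2: "x - y = 2 * (u - y)" using u by simp
    have x: "x = 2 * u - y" using u by simp
    show "(case case p of (x, y) \<Rightarrow> ((x + y) div 2, (x - y) div 2) of (x, y) \<Rightarrow> (x + y, x - y)) = p"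
      unfolding xy prod.case u2 u by (simp add: x)
  qed (auto simp: power2_eq_square algebra_simps)
  then show ?thesis unfolding phi_sq_nth by (simp add: bij_betw_same_card)
qed

lemma phi_nth: "phi $ n = (if n = 0 then 1 else if \<exists>x. n = x\<^sup>2 then 2 else 0)"
proof (cases "\<exists>x. n = x\<^sup>2")
  case True
  then obtain x where x: "n = x\<^sup>2" by blast
  have "{y :: int. y\<^sup>2 = int n} = {int x, - int x}" unfolding x by (auto simp: power2_eq_iff)
  then show ?thesis using x by (auto simp: phi_def)
next
  case False
  have "{y :: int. y\<^sup>2 = int n} = {}"
  proof (rule ccontr)
    assume "{y :: int. y\<^sup>2 = int n} \<noteq> {}"
    then obtain y :: int where "y\<^sup>2 = int n" by auto
    then have "int ((nat \<bar>y\<bar>)\<^sup>2) = int n" by simp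
    then show False using False by (metis of_nat_eq_iff)
  qed
  moreover have "n \<noteq> 0" using False by (metis zero_power2)
  ultimately show ?thesis using False by (simp add: phi_def)
qed

lemma num_mult_nth: "(numeral k * f) $ n = numeral k * (f :: 'a::idom fps) $ n"
  by (simp add: numeral_fps_const)

text \<open>
Even squares and odd squares.
\<close>

lemma phi_split: "phi = dilate 4 phi + 2 * osq"
proof (rule fps_ext)
  fix n :: nat
  have *: "(\<exists>x. n = x\<^sup>2) \<longleftrightarrow> (4 dvd n \<and> (\<exists>x. n div 4 = x\<^sup>2)) \<or> (\<exists>x. odd x \<and> n = x\<^sup>2)"
  proof
    assume "\<exists>x. n = x\<^sup>2"
    then obtain x where x: "n = x\<^sup>2" by blast
    show "(4 dvd n \<and> (\<exists>x. n div 4 = x\<^sup>2)) \<or> (\<exists>x. odd x \<and> n = x\<^sup>2)"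
    proof (cases "even x")
      case True then show ?thesis unfolding x by (auto elim!: evenE simp: power_mult_distrib)
    qed (use x in auto)
  next
    assume "(4 dvd n \<and> (\<exists>x. n div 4 = x\<^sup>2)) \<or> (\<exists>x. odd x \<and> n = x\<^sup>2)"
    then show "\<exists>x. n = x\<^sup>2"
    proof
      assume "4 dvd n \<and> (\<exists>x. n div 4 = x\<^sup>2)"
      then obtain x where "n = 4 * x\<^sup>2" by auto
      then have "n = (2 * x)\<^sup>2" by (simp add: power_mult_distrib)
      then show ?thesis by blast
    qed blast
  qed
  have "odd x \<Longrightarrow> \<not> 4 dvd x\<^sup>2" for x :: nat
    by (meson dvd_trans even_numeral even_power)
  then have **: "\<not> (4 dvd n \<and> (\<exists>x. odd x \<and> n = x\<^sup>2))" by auto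
  have o: "osq $ n = (if \<exists>x. odd x \<and> n = x\<^sup>2 then 1 else 0)" by (simp add: osq_def)
  have d: "dilate 4 phi $ n = (if 4 dvd n then if n = 0 then 1 else if \<exists>x. n div 4 = x\<^sup>2 then 2 else 0 else 0)"
    by (auto simp: dil_nth phi_nth)
  show "phi $ n = (dilate 4 phi + 2 * osq) $ n"
    unfolding fps_add_nth num_mult_nth o d phi_nth using * ** by auto
qed

lemma osq_neg: "neg_arg osq = - osq"
  by (rule fps_ext) (auto simp: neg_nth osq_def)

lemma neg_phi: "neg_arg phi = dilate 4 phi - 2 * osq"
  by (subst phi_split) (simp add: neg_add neg_mult osq_neg neg_dil_even)

lemma dil_2_sq: "dilate 2 phi ^ 2 = dilate 4 phi ^ 2 + 4 * osq ^ 2"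
proof -
  have "2 * dilate 2 (phi ^ 2) = phi ^ 2 + neg_arg (phi ^ 2)"
  proof (rule fps_ext)
    fix n
    show "(2 * dilate 2 (phi ^ 2)) $ n = (phi ^ 2 + neg_arg (phi ^ 2)) $ n"
      unfolding num_mult_nth
      by (cases "even n") (auto simp: dil_nth neg_nth phi_sq_double elim!: evenE)
  qed
  also have "neg_arg (phi ^ 2) = (dilate 4 phi - 2 * osq) ^ 2" by (simp add: neg_power neg_phi)
  also have "phi ^ 2 + (dilate 4 phi - 2 * osq) ^ 2 = (dilate 4 phi + 2 * osq) ^ 2 + (dilate 4 phi - 2 * osq) ^ 2"
    using phi_split by simp
  also have "\<dots> = 2 * (dilate 4 phi ^ 2 + 4 * osq ^ 2)"
    by (simp add: power2_eq_square algebra_simps)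
  finally have "dilate 2 (phi ^ 2) = dilate 4 phi ^ 2 + 4 * osq ^ 2"
    by (subst (asm) mult_cancel_left) simp
  then show ?thesis by (simp add: dil_power)
qed

lemma phi_neg_phi': "phi * neg_arg phi = dilate 4 phi ^ 2 - 4 * osq ^ 2"
proof -
  have "phi * neg_arg phi = (dilate 4 phi + 2 * osq) * (dilate 4 phi - 2 * osq)"
    unfolding neg_phi using phi_split by simp
  then show ?thesis by (simp add: power2_eq_square algebra_simps)
qed

text \<open>
The product rule of the arithmetic-geometric mean, here obtained from the dissection into even and
odd squares together with the doubling rule for sums of two squares.
\<close>

lemma phi_neg_phi: "phi * neg_arg phi = dilate 2 (neg_arg phi) ^ 2"
proof -
  have "phi * neg_arg phi = 2 * dilate 4 phi ^ 2 - dilate 2 phi ^ 2" unfolding dil_2_sq phi_neg_phi' by simp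
  also have "dilate 4 phi = dilate 2 (dilate 2 phi)" by (simp add: dil_dil)
  also have "2 * dilate 2 (dilate 2 phi) ^ 2 - dilate 2 phi ^ 2 = dilate 2 (2 * dilate 2 phi ^ 2 - phi ^ 2)"
    by (simp add: dil_diff dil_mult dil_power)
  also have "2 * dilate 2 phi ^ 2 - phi ^ 2 = 2 * (dilate 4 phi ^ 2 + 4 * osq ^ 2) - (dilate 4 phi + 2 * osq) ^ 2"
    unfolding dil_2_sq using phi_split by simp
  also have "\<dots> = neg_arg phi ^ 2"
    unfolding neg_phi by (simp add: power2_eq_square algebra_simps)
  finally show ?thesis by (simp add: dil_power)
qed

lemma dil_4_neg_phi: "dilate 4 (neg_arg phi) ^ 4 = dilate 4 phi ^ 4 - 16 * osq ^ 4"
proof -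
  have "dilate 4 (neg_arg phi) ^ 4 = dilate 2 (dilate 2 (neg_arg phi) ^ 2) ^ 2"
    by (simp add: dil_dil dil_power flip: power_mult)
  also have "\<dots> = (dilate 2 phi * dilate 2 (neg_arg phi)) ^ 2" by (simp add: phi_neg_phi[symmetric] dil_mult)
  also have "\<dots> = dilate 2 phi ^ 2 * (phi * neg_arg phi)" by (simp add: phi_neg_phi power_mult_distrib)
  finally show ?thesis unfolding dil_2_sq phi_neg_phi'
    by (simp add: algebra_simps power2_eq_square power4_eq_xxxx)
qed

text \<open>
A sixteenth of \<open>phi^4 - phi(-q)^4\<close>; the factorised form makes it visible that the
coefficients are integers.
\<close>

definition F_ser :: "int fps" where
  "F_ser = dilate 4 phi * osq * (dilate 4 phi ^ 2 + 4 * osq ^ 2)"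

lemma F_ser_eq: "16 * F_ser = phi ^ 4 - neg_arg phi ^ 4"
proof -
  have "phi ^ 4 - neg_arg phi ^ 4 = (dilate 4 phi + 2 * osq) ^ 4 - (dilate 4 phi - 2 * osq) ^ 4"
    unfolding neg_phi using phi_split by simp
  then show ?thesis unfolding F_ser_def by (simp add: algebra_simps power2_eq_square power4_eq_xxxx)
qed

text \<open>
The key degeneration that makes the contraction by 4 explicit: replacing \<open>q\<close> by
\<open>q^4\<close> turns the series into a fourth power.
\<close>

lemma dil_4_F_ser: "dilate 4 F_ser = osq ^ 4"
proof -
  have "16 * dilate 4 F_ser = dilate 4 (16 * F_ser)" by (simp add: dil_mult)
  also have "\<dots> = 16 * osq ^ 4"
    unfolding F_ser_eq by (simp add: dil_diff dil_power neg_power dil_4_neg_phi)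
  finally show ?thesis by simp
qed

section \<open>The generating function of overpartitions\<close>

definition bounded_overpartitions :: "nat \<Rightarrow> nat \<Rightarrow> (nat multiset \<times> nat set) set" where
  "bounded_overpartitions n k = {(P, S). set_mset P \<subseteq> {1..n} \<and> \<Sum>\<^sub># P = k \<and> S \<subseteq> set_mset P}"

lemma bounded_subset: "bounded_overpartitions n k \<subseteq> overpartitions k"
  by (auto simp: bounded_overpartitions_def overpartitions_def)

lemma finite_bounded: "finite (bounded_overpartitions n k)"
  by (rule finite_subset[OF bounded_subset finite_overpartitions])

lemma bounded_eq: assumes "k \<le> n" shows "bounded_overpartitions n k = overpartitions k"
proof (intro equalityI bounded_subset subsetI)
  fix p assume "p \<in> overpartitions k"
  then obtain P S where p: "p = (P, S)" "0 \<notin># P" "\<Sum>\<^sub># P = k" "S \<subseteq> set_mset P"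
    by (auto simp: overpartitions_def)
  have "x \<in> {1..n}" if "x \<in># P" for x
  proof -
    have "x \<le> \<Sum>\<^sub># P" using multi_member_split[OF that] by auto
    moreover have "x \<noteq> 0" using that p(2) by (intro notI) simp
    ultimately show ?thesis using p(3) assms by simp
  qed
  then show "p \<in> bounded_overpartitions n k" using p by (auto simp: bounded_overpartitions_def)
qed

text \<open>
This is the product of \<open>(1 + q^k) / (1 - q^k)\<close> over \<open>k \<le> n\<close>.
\<close>

definition bounded_ser :: "nat \<Rightarrow> int fps" where
  "bounded_ser n = Abs_fps (\<lambda>k. int (card (bounded_overpartitions n k)))"

lemma bounded_ser_0: "bounded_ser 0 = 1"
proof (rule fps_ext)
  fix k
  have "bounded_overpartitions 0 k = (if k = 0 then {({#}, {})} else {})"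
    by (auto simp: bounded_overpartitions_def)
  then show "bounded_ser 0 $ k = 1 $ k" by (simp add: bounded_ser_def)
qed

text \<open>
Either the part \<open>N\<close> does not occur, or one copy of it can be removed. Removing the last
copy leaves an overpartition with smaller parts, and that copy may or may not have been overlined;
this accounts for the second summand.
\<close>

lemma bounded_Suc:
  fixes n k defines "N \<equiv> Suc n"
  shows "int (card (bounded_overpartitions N k)) = int (card (bounded_overpartitions n k)) +
    (if N \<le> k then int (card (bounded_overpartitions N (k - N))) + int (card (bounded_overpartitions n (k - N))) else 0)"
proof -
  let ?X = "{(P, S). (P, S) \<in> bounded_overpartitions N k \<and> N \<in># P}"
  let ?f = "\<lambda>(P, S). (add_mset N P, S)" and ?g = "\<lambda>(P, S). (add_mset N P, insert N S)"
  have finX: "finite ?X" by (rule finite_subset[OF _ finite_bounded[of N k]]) auto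
  have un: "bounded_overpartitions N k = bounded_overpartitions n k \<union> ?X"
    by (auto simp: bounded_overpartitions_def N_def atLeastAtMostSuc_conv)
  have dj: "bounded_overpartitions n k \<inter> ?X = {}"
    by (auto simp: bounded_overpartitions_def N_def)
  have c: "card (bounded_overpartitions N k) = card (bounded_overpartitions n k) + card ?X"
    by (subst un, rule card_Un_disjoint[OF finite_bounded finX dj])
  show ?thesis
  proof (cases "N \<le> k")
    case False
    have "?X = {}"
    proof -
      have "N \<le> \<Sum>\<^sub># P" if "N \<in># P" for P :: "nat multiset"
        using multi_member_split[OF that] by auto
      then show ?thesis using False by (auto simp: bounded_overpartitions_def)
    qed
    then have "card ?X = 0" by (simp only: card.empty)
    then show ?thesis using c False by simp
  next
    case True
    have X: "?X = ?f ` bounded_overpartitions N (k - N) \<union> ?g ` bounded_overpartitions n (k - N)"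
    proof (intro equalityI subsetI)
      fix p assume "p \<in> ?X"
      then obtain P S where p: "p = (P, S)" "set_mset P \<subseteq> {1..N}" "\<Sum>\<^sub># P = k" "S \<subseteq> set_mset P" "N \<in># P"
        by (auto simp: bounded_overpartitions_def)
      obtain M where M: "P = add_mset N M" using multi_member_split[OF p(5)] by blast
      show "p \<in> ?f ` bounded_overpartitions N (k - N) \<union> ?g ` bounded_overpartitions n (k - N)"
      proof (cases "N \<in># M \<or> N \<notin> S")
        case True
        then have "(M, S) \<in> bounded_overpartitions N (k - N)"
          using p M by (auto simp: bounded_overpartitions_def)
        then show ?thesis unfolding p(1) M by force
      next
        case False
        then have "set_mset M \<subseteq> {1..n}" using p(2) M by (auto simp: N_def le_Suc_eq)
        then have "(M, S - {N}) \<in> bounded_overpartitions n (k - N)"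
          using p M False by (auto simp: bounded_overpartitions_def)
        moreover have "p = ?g (M, S - {N})" using False p(1) M by auto
        ultimately show ?thesis by blast
      qed
    next
      fix p assume "p \<in> ?f ` bounded_overpartitions N (k - N) \<union> ?g ` bounded_overpartitions n (k - N)"
      then show "p \<in> ?X" using True by (fastforce simp: bounded_overpartitions_def N_def)
    qed
    have "?f ` bounded_overpartitions N (k - N) \<inter> ?g ` bounded_overpartitions n (k - N) = {}"
      by (auto simp: bounded_overpartitions_def N_def)
    moreover have "inj_on ?f (bounded_overpartitions N (k - N))" by (auto simp: inj_on_def)
    moreover have "inj_on ?g (bounded_overpartitions n (k - N))"
    proof (rule inj_onI, clarsimp)
      fix P S S' assume "(P, S) \<in> bounded_overpartitions n (k - N)" "(P, S') \<in> bounded_overpartitions n (k - N)"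
        and e: "insert N S = insert N S'"
      then have "N \<notin> S" "N \<notin> S'" by (auto simp: bounded_overpartitions_def N_def)
      then show "S = S'" using e by (metis insert_ident)
    qed
    ultimately have "card ?X = card (bounded_overpartitions N (k - N)) + card (bounded_overpartitions n (k - N))"
      unfolding X by (subst card_Un_disjoint) (simp_all add: finite_bounded card_image)
    then show ?thesis using c True by simp
  qed
qed

lemma bounded_ser_Suc: "(1 - fps_X ^ Suc n) * bounded_ser (Suc n) = (1 + fps_X ^ Suc n) * bounded_ser n"
proof (rule fps_ext)
  fix k
  show "((1 - fps_X ^ Suc n) * bounded_ser (Suc n)) $ k = ((1 + fps_X ^ Suc n) * bounded_ser n) $ k"
    using bounded_Suc[of n k]
    by (simp add: left_diff_distrib distrib_right fps_X_power_mult_nth bounded_ser_def del: power_Suc)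
qed

definition trunc_phi :: "nat \<Rightarrow> int fps" where
  "trunc_phi n = 1 + 2 * (\<Sum>s=1..n. (- 1) ^ s * fps_X ^ s\<^sup>2)"

lemma gauss_telescope:
  fixes Y :: "int fps"
  shows "(1 - Y) * (\<Sum>s=1..m. (- 1) ^ s * Y ^ s * (bounded_ser s - bounded_ser (s - 1))) -
    (1 + Y) * (\<Sum>s=1..m. (- 1) ^ s * Y ^ s * (bounded_ser s + bounded_ser (s - 1))) =
    2 * Y - 2 * (- 1) ^ m * Y ^ Suc m * bounded_ser m"
proof (induction m)
  case 0
  show ?case by (simp add: bounded_ser_0)
next
  case (Suc m)
  define A where "A = (\<Sum>s=1..m. (- 1) ^ s * Y ^ s * (bounded_ser s - bounded_ser (s - 1)))"
  define B where "B = (\<Sum>s=1..m. (- 1) ^ s * Y ^ s * (bounded_ser s + bounded_ser (s - 1)))"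
  define t where "t = (- 1) ^ m * Y ^ Suc m"
  define g where "g = bounded_ser m"
  define g' where "g' = bounded_ser (Suc m)"
  have IH: "(1 - Y) * A - (1 + Y) * B = 2 * Y - 2 * t * g"
    using Suc.IH unfolding A_def B_def t_def g_def by (simp only: mult.assoc)
  have 1: "(\<Sum>s=1..Suc m. (- 1) ^ s * Y ^ s * (bounded_ser s - bounded_ser (s - 1))) = A - t * (g' - g)"
    "(\<Sum>s=1..Suc m. (- 1) ^ s * Y ^ s * (bounded_ser s + bounded_ser (s - 1))) = B - t * (g' + g)"
    by (simp_all add: A_def B_def t_def g_def g'_def)
  have 2: "2 * (- 1) ^ Suc m * Y ^ Suc (Suc m) * bounded_ser (Suc m) = - 2 * t * Y * g'"
    by (simp add: t_def g'_def)
  have "(1 - Y) * (A - t * (g' - g)) - (1 + Y) * (B - t * (g' + g)) =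
    ((1 - Y) * A - (1 + Y) * B) + 2 * t * g + 2 * t * Y * g'"
    by (simp add: ring_distribs)
  then show ?case unfolding 1 2 IH by simp
qed

text \<open>
A finite form, in the style of Shanks, of Gauss' identity for the alternating theta series. The
difference of consecutive partial products in the correction has order \<open>s\<close>, so the
whole correction has order greater than \<open>n\<close>.
\<close>

lemma gauss_finite:
  "bounded_ser n * trunc_phi n = 1 + (\<Sum>s=1..n. (- 1) ^ s * fps_X ^ (s * n) * (bounded_ser s - bounded_ser (s - 1)))"
proof (induction n)
  case 0
  show ?case by (simp add: bounded_ser_0 trunc_phi_def)
next
  case (Suc n)
  define Y :: "int fps" where "Y = fps_X ^ Suc n"
  define e :: "int fps" where "e = (- 1) ^ n"
  define A where "A = (\<Sum>s=1..n. (- 1) ^ s * Y ^ s * (bounded_ser s - bounded_ser (s - 1)))"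
  define B where "B = (\<Sum>s=1..n. (- 1) ^ s * Y ^ s * (bounded_ser s + bounded_ser (s - 1)))"
  have GS: "(1 - Y) * bounded_ser (Suc n) = (1 + Y) * bounded_ser n" unfolding Y_def by (rule bounded_ser_Suc)
  have GS': "bounded_ser s - bounded_ser (s - 1) = fps_X ^ s * (bounded_ser s + bounded_ser (s - 1))" if "s \<ge> 1" for s
  proof -
    have "Suc (s - 1) = s" using that by simp
    then show ?thesis using bounded_ser_Suc[of "s - 1"] by (simp add: algebra_simps del: power_Suc)
  qed
  have IH: "bounded_ser n * trunc_phi n = 1 + B"
  proof -
    have "(- 1) ^ s * fps_X ^ (s * n) * (bounded_ser s - bounded_ser (s - 1)) = (- 1) ^ s * Y ^ s * (bounded_ser s + bounded_ser (s - 1))" if "s \<in> {1..n}" for s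
    proof -
      have "Y ^ s = fps_X ^ (s * n) * fps_X ^ s"
      proof -
        have "Suc n * s = s * n + s" by simp
        then show ?thesis unfolding Y_def power_mult[symmetric] by (simp only: power_add)
      qed
      moreover have "bounded_ser s - bounded_ser (s - 1) = fps_X ^ s * (bounded_ser s + bounded_ser (s - 1))" using GS' that by simp
      ultimately show ?thesis by (simp only: mult.assoc)
    qed
    then show ?thesis unfolding Suc.IH B_def by (intro arg_cong2[of _ _ _ _ "(+)"] sum.cong refl)
  qed
  have tr: "trunc_phi (Suc n) = trunc_phi n - 2 * e * Y ^ Suc n"
    unfolding trunc_phi_def e_def Y_def power_mult[symmetric] by (simp add: power2_eq_square algebra_simps)
  have tel: "(1 - Y) * A - (1 + Y) * B = 2 * Y - 2 * e * Y ^ Suc n * bounded_ser n"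
    unfolding A_def B_def e_def by (rule gauss_telescope)
  have goal: "1 + (\<Sum>s=1..Suc n. (- 1) ^ s * fps_X ^ (s * Suc n) * (bounded_ser s - bounded_ser (s - 1))) =
      1 + A - e * Y ^ Suc n * (bounded_ser (Suc n) - bounded_ser n)"
  proof -
    have "fps_X ^ (s * Suc n) = Y ^ s" for s unfolding Y_def by (simp only: mult.commute[of s] power_mult)
    then show ?thesis unfolding A_def e_def by (simp del: mult_Suc_right)
  qed
  define g where "g = bounded_ser n"
  define g' where "g' = bounded_ser (Suc n)"
  define y where "y = Y ^ Suc n"
  have GS1: "g' = g + Y * g + Y * g'" using GS by (simp add: g_def g'_def algebra_simps)
  have "(1 - Y) * (g' * trunc_phi (Suc n)) = ((1 - Y) * g') * trunc_phi n - 2 * e * y * ((1 - Y) * g')"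
    unfolding tr y_def[symmetric] by (simp add: algebra_simps)
  also have "\<dots> = (1 + Y) * (g * trunc_phi n) - 2 * e * y * ((1 + Y) * g)"
    unfolding GS[folded g_def g'_def] by (simp add: algebra_simps)
  also have "\<dots> = (1 + Y) + (1 + Y) * B - 2 * e * y * ((1 + Y) * g)"
    unfolding IH[folded g_def] by (simp add: algebra_simps)
  also have "(1 + Y) * B = (1 - Y) * A - 2 * Y + 2 * e * y * g"
    using tel by (simp add: algebra_simps g_def y_def)
  also have "(1 + Y) + ((1 - Y) * A - 2 * Y + 2 * e * y * g) - 2 * e * y * ((1 + Y) * g) =
    (1 - Y) + (1 - Y) * A - e * y * ((1 + Y) * g) + e * y * (1 - Y) * g"
    by (simp add: algebra_simps)
  also have "\<dots> = (1 - Y) * (1 + A - e * y * (g' - g))"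
    unfolding GS[folded g_def g'_def, symmetric] by (simp add: algebra_simps)
  finally have "(1 - Y) * (bounded_ser (Suc n) * trunc_phi (Suc n)) = (1 - Y) * (1 + A - e * Y ^ Suc n * (bounded_ser (Suc n) - bounded_ser n))"
    unfolding g_def g'_def y_def .
  moreover have "1 - Y \<noteq> 0"
  proof
    assume "1 - Y = 0" then have "(1 - Y) $ 0 = 0" by simp
    then show False by (simp add: Y_def)
  qed
  ultimately show ?case unfolding goal by simp
qed

definition overp_ser :: "int fps" where
  "overp_ser = Abs_fps (\<lambda>n. int (overpartition_number n))"

lemma neg_one_power_mult_nth: "((- 1) ^ s * f) $ n = (- 1) ^ s * (f :: int fps) $ n"
  by (cases "even s") auto

lemma bounded_ser_nth_0: "bounded_ser s $ 0 = 1"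
proof -
  have "bounded_overpartitions s 0 = overpartitions 0" by (rule bounded_eq) simp
  also have "overpartitions 0 = {({#}, {})}"     by (auto simp: overpartitions_def) (metis multiset_nonemptyE)
  finally show ?thesis by (simp add: bounded_ser_def)
qed

lemma trunc_phi_nth: assumes "k \<le> n" shows "trunc_phi n $ k = neg_arg phi $ k"
proof -
  have "trunc_phi n $ k = (if k = 0 then 1 else 0) + 2 * (\<Sum>s=1..n. if k = s\<^sup>2 then (- 1) ^ s else 0)"
  proof -
    have "(\<Sum>s=1..n. (- 1) ^ s * (fps_X ^ s\<^sup>2 :: int fps) $ k) = (\<Sum>s=1..n. if k = s\<^sup>2 then (- 1) ^ s else 0)"
      by (rule sum.cong) auto
    then show ?thesis
      unfolding trunc_phi_def fps_add_nth num_mult_nth fps_sum_nth neg_one_power_mult_nth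
      by (simp only: fps_one_nth)
  qed
  also have "\<dots> = neg_arg phi $ k"
  proof (cases "\<exists>s. k = s\<^sup>2")
    case True
    then obtain s where s: "k = s\<^sup>2" by blast
    have sn: "s \<le> n" using assms s power2_nat_le_imp_le by simp
    have eq: "(k = i\<^sup>2) = (i = s)" for i unfolding s by (auto simp: power2_eq_iff)
    have sgn: "(- 1) ^ k = ((- 1) ^ s :: int)" unfolding s by (cases "even s") simp_all
    have ph: "phi $ k = (if s = 0 then 1 else 2)"
      unfolding phi_nth using True by (simp add: s)
    show ?thesis
      unfolding neg_nth ph sgn eq using sn by (cases "s = 0") (simp_all add: s)
  next
    case False
    then have "k \<noteq> 0" by (metis zero_power2)
    have "(\<Sum>s=1..n. if k = s\<^sup>2 then (- 1) ^ s else 0) = (\<Sum>s=1..n. 0 :: int)"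
      by (rule sum.cong) (use False in auto)
    then show ?thesis using False \<open>k \<noteq> 0\<close> by (simp add: neg_nth phi_nth)
  qed
  finally show ?thesis .
qed

text \<open>
The limit of the finite identity.
\<close>

lemma overp_ser_neg_phi: "overp_ser * neg_arg phi = 1"
proof (rule fps_ext)
  fix n
  have a: "overp_ser $ k = bounded_ser n $ k" if "k \<le> n" for k
    using bounded_eq[OF that] by (simp add: overp_ser_def bounded_ser_def overpartition_number_def)
  have "(overp_ser * neg_arg phi) $ n = (bounded_ser n * trunc_phi n) $ n"
    unfolding fps_mult_nth using a trunc_phi_nth by (intro sum.cong) simp_all
  also have "\<dots> = 1 $ n"
  proof -
    have "((- 1) ^ s * fps_X ^ (s * n) * (bounded_ser s - bounded_ser (s - 1))) $ n = 0" if s: "s \<in> {1..n}" for s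
    proof -
      have "(fps_X ^ (s * n) * (bounded_ser s - bounded_ser (s - 1))) $ n = 0"
      proof (cases "s = 1")
        case False
        then have "n < s * n" using s by simp
        then show ?thesis by (simp add: fps_X_power_mult_nth)
      qed (simp add: fps_X_power_mult_nth bounded_ser_nth_0)
      then show ?thesis by (simp only: mult.assoc neg_one_power_mult_nth)
    qed
    then show ?thesis unfolding gauss_finite by (simp add: fps_sum_nth)
  qed
  finally show "(overp_ser * neg_arg phi) $ n = 1 $ n" .
qed

section \<open>The contraction by 4 and its 2-adic behaviour\<close>

definition inv_phi :: "int fps" where "inv_phi = neg_arg overp_ser"

lemma phi_inv_phi: "phi * inv_phi = 1"
proof -
  have "neg_arg (overp_ser * neg_arg phi) = neg_arg 1" by (simp only: overp_ser_neg_phi)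
  then show ?thesis by (simp add: inv_phi_def neg_mult mult.commute)
qed

lemma inv_phi_nth: "inv_phi $ n = (- 1) ^ n * int (overpartition_number n)"
  by (simp add: inv_phi_def neg_nth overp_ser_def)

definition phi_q4 :: "int fps" where "phi_q4 = dilate 4 phi"
definition inv_phi_q4 :: "int fps" where "inv_phi_q4 = dilate 4 inv_phi"

text \<open>
With \<open>phi = phi_q4 * (1 + 2 * w_ser)\<close> all series of interest become rational functions
of \<open>w_ser\<close> times a power series in \<open>q^4\<close>, and \<open>w_ser\<close> is
supported on one residue class modulo 4.
\<close>

definition w_ser :: "int fps" where "w_ser = osq * inv_phi_q4"

text \<open>
A Hauptmodul: the coordinate in which the contraction by 4 acts on power series.
\<close>

definition t_ser :: "int fps" where "t_ser = F_ser * inv_phi ^ 4"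

lemma phi_q4_inverse: "phi_q4 * inv_phi_q4 = 1"
proof -
  have "phi_q4 * inv_phi_q4 = dilate 4 (phi * inv_phi)" by (simp add: phi_q4_def inv_phi_q4_def dil_mult)
  then show ?thesis by (simp add: phi_inv_phi)
qed

lemma osq_0: "osq $ 0 = 0" by (auto simp: osq_def)
lemma w_ser_0 [simp]: "w_ser $ 0 = 0" by (simp add: w_ser_def osq_0)
lemma F_ser_0: "F_ser $ 0 = 0" by (simp add: F_ser_def osq_0)
lemma t_ser_0 [simp]: "t_ser $ 0 = 0" by (simp add: t_ser_def F_ser_0)

lemma osq_w_ser: "osq = phi_q4 * w_ser"
  using phi_q4_inverse by (simp add: w_ser_def mult.left_commute)

lemma phi_w_ser: "phi = phi_q4 * (1 + 2 * w_ser)"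
proof -
  have "phi = phi_q4 + 2 * osq" using phi_split by (simp add: phi_q4_def)
  also have "\<dots> = phi_q4 + 2 * (phi_q4 * w_ser)" by (simp only: osq_w_ser[symmetric])
  also have "\<dots> = phi_q4 * (1 + 2 * w_ser)" by (simp add: distrib_left mult.left_commute)
  finally show ?thesis .
qed

lemma dil_4_t_ser: "dilate 4 t_ser = w_ser ^ 4"
  by (simp add: t_ser_def w_ser_def dil_mult dil_4_F_ser dil_power inv_phi_q4_def power_mult_distrib)

definition geom2 :: "int fps" where "geom2 = Abs_fps (\<lambda>n. (- 2) ^ n)"

lemma geom2: "(1 + 2 * fps_X) * geom2 = 1"
proof (rule fps_ext)
  fix n show "((1 + 2 * fps_X) * geom2) $ n = 1 $ n"
    by (cases n) (simp_all add: distrib_right geom2_def num_mult_nth mult.assoc)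
qed

text \<open>
Expresses \<open>t_ser\<close> through \<open>w_ser\<close>, while \<open>t_ser(q^4)\<close> is
\<open>w_ser^4\<close>; together these form a modular equation of degree 4.
\<close>

definition tau :: "int fps" where "tau = fps_X * (1 + 4 * fps_X ^ 2) * geom2 ^ 4"

lemma tau_0 [simp]: "tau $ 0 = 0" by (simp add: tau_def)

lemma compose_1_2X: assumes "c $ 0 = (0 :: int)" shows "(1 + 2 * fps_X) oo c = 1 + 2 * c"
  using assms by (simp add: fps_compose_add_distrib fps_compose_mult_distrib)

lemma geom2_compose: assumes "c $ 0 = 0" shows "(1 + 2 * c) * (geom2 oo c) = 1"
proof -
  have "((1 + 2 * fps_X) * geom2) oo c = 1" by (simp only: geom2 fps_compose_1)
  then show ?thesis using assms by (simp only: fps_compose_mult_distrib compose_1_2X)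
qed

lemma inv_phi_w: "inv_phi = inv_phi_q4 * (geom2 oo w_ser)"
proof -
  have "inv_phi = inv_phi * ((phi_q4 * inv_phi_q4) * ((1 + 2 * w_ser) * (geom2 oo w_ser)))" by (simp only: phi_q4_inverse geom2_compose w_ser_0 mult_1_right)
  also have "\<dots> = (phi * inv_phi) * (inv_phi_q4 * (geom2 oo w_ser))" unfolding phi_w_ser by (simp only: ac_simps)
  finally show ?thesis by (simp only: phi_inv_phi mult_1_left)
qed

lemma t_ser_tau: "t_ser = tau oo w_ser"
proof -
  have "tau oo w_ser = w_ser * (1 + 4 * w_ser ^ 2) * (geom2 oo w_ser) ^ 4"
    unfolding tau_def by (simp add: fps_compose_mult_distrib fps_compose_add_distrib flip: fps_compose_power)
  moreover have "F_ser = phi_q4 ^ 4 * (w_ser * (1 + 4 * w_ser ^ 2))"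
  proof -
    have "F_ser = phi_q4 * osq * (phi_q4 ^ 2 + 4 * osq ^ 2)" by (simp add: F_ser_def phi_q4_def)
    also have "\<dots> = phi_q4 * (phi_q4 * w_ser) * (phi_q4 ^ 2 + 4 * (phi_q4 * w_ser) ^ 2)" by (simp only: osq_w_ser[symmetric])
    also have "\<dots> = phi_q4 ^ 4 * (w_ser * (1 + 4 * w_ser ^ 2))"
      by (simp add: power2_eq_square power4_eq_xxxx algebra_simps)
    finally show ?thesis .
  qed
  moreover have "t_ser = F_ser * (inv_phi_q4 * (geom2 oo w_ser)) ^ 4" by (simp only: t_ser_def inv_phi_w[symmetric])
  ultimately have "t_ser = (phi_q4 ^ 4 * (w_ser * (1 + 4 * w_ser ^ 2))) * (inv_phi_q4 * (geom2 oo w_ser)) ^ 4" by (simp only:)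
  also have "\<dots> = (phi_q4 * inv_phi_q4) ^ 4 * (w_ser * (1 + 4 * w_ser ^ 2) * (geom2 oo w_ser) ^ 4)"
    by (simp only: power_mult_distrib ac_simps)
  finally show ?thesis using \<open>tau oo w_ser = _\<close> by (simp only: phi_q4_inverse power_one mult_1_left)
qed

lemma compose_t_ser: "f oo t_ser = (f oo tau) oo w_ser"
  unfolding t_ser_tau by (rule fps_compose_assoc) simp_all

lemma inv_phi_compose_t_ser: "inv_phi * (f oo t_ser) = inv_phi_q4 * ((geom2 * (f oo tau)) oo w_ser)"
  by (simp add: inv_phi_w compose_t_ser fps_compose_mult_distrib mult.assoc)

definition supp :: "nat \<Rightarrow> nat \<Rightarrow> int fps \<Rightarrow> bool" where
  "supp m r f \<longleftrightarrow> (\<forall>n. f $ n \<noteq> 0 \<longrightarrow> [n = r] (mod m))"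

lemma supp_mult: assumes "supp m r f" "supp m s g" shows "supp m (r + s) (f * g)"
  unfolding supp_def
proof (intro allI impI)
  fix n assume "(f * g) $ n \<noteq> 0"
  then have "\<exists>k\<in>{0..n}. f $ k * g $ (n - k) \<noteq> 0"
    unfolding fps_mult_nth using sum.not_neutral_contains_not_neutral by blast
  then obtain k where k: "k \<le> n" "f $ k \<noteq> 0" "g $ (n - k) \<noteq> 0" by auto
  then have "[k + (n - k) = r + s] (mod m)" using assms unfolding supp_def by (intro cong_add) blast+
  then show "[n = r + s] (mod m)" using k by simp
qed

lemma supp_1: "supp m 0 1"
  by (simp add: supp_def)

lemma supp_power: "supp m r f \<Longrightarrow> supp m (k * r) (f ^ k)"
  by (induction k) (auto simp: supp_1 intro: supp_mult)

lemma supp_dil: "m > 0 \<Longrightarrow> supp m 0 (dilate m f)"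
  by (auto simp: supp_def dil_nth cong_0_iff split: if_splits)

lemma supp_weaken: "supp m r f \<Longrightarrow> k dvd m \<Longrightarrow> supp k r f"
  unfolding supp_def by (meson cong_dvd_modulus_nat)

lemma supp_dil_mult: "k > 0 \<Longrightarrow> supp m r f \<Longrightarrow> supp (k * m) (k * r) (dilate k f)"
  unfolding supp_def dil_nth
proof (intro allI impI)
  fix n assume k: "k > 0" and h: "\<forall>n. f $ n \<noteq> 0 \<longrightarrow> [n = r] (mod m)"
    and n: "(if k dvd n then f $ (n div k) else 0) \<noteq> 0"
  have d: "k dvd n" and f: "f $ (n div k) \<noteq> 0" using n by (simp_all split: if_splits)
  have "[k * (n div k) = k * r] (mod k * m)"
    using h f by (intro cong_cmult_leftI) blast
  then show "[n = k * r] (mod k * m)" using d by simp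
qed

lemma supp_osq: "supp 8 1 osq"
  unfolding supp_def
proof (intro allI impI)
  fix n assume "osq $ n \<noteq> 0"
  then obtain x where x: "odd x" "n = x\<^sup>2" by (auto simp: osq_def split: if_splits)
  obtain j where j: "x = 2 * j + 1" using x(1) by (rule oddE)
  have "even (j * (j + 1))" by simp
  then obtain i where i: "j * (j + 1) = 2 * i" by (rule evenE)
  have "n = 4 * (j * (j + 1)) + 1" unfolding x(2) j by (simp add: power2_eq_square algebra_simps)
  then have "n = 1 + 8 * i" unfolding i by simp
  then show "[n = 1] (mod 8)" by (simp add: cong_def)
qed

text \<open>
If \<open>x\<close> is supported on one residue class, its powers separate the coefficients of
\<open>b oo x\<close> by residue classes.
\<close>

lemma component:
  assumes g: "supp m r g" and x: "supp m s x"
  shows "(g * (b oo x)) $ n = (g * (Abs_fps (\<lambda>i. if [n = r + i * s] (mod m) then b $ i else 0) oo x)) $ n"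
  unfolding fps_mult_nth
proof (rule sum.cong[OF refl])
  fix k assume k: "k \<in> {0..n}"
  show "g $ k * (b oo x) $ (n - k) =
    g $ k * (Abs_fps (\<lambda>i. if [n = r + i * s] (mod m) then b $ i else 0) oo x) $ (n - k)"
  proof (cases "g $ k = 0")
    case False
    then have kr: "[k = r] (mod m)" using g by (simp add: supp_def)
    have "(b oo x) $ (n - k) = (Abs_fps (\<lambda>i. if [n = r + i * s] (mod m) then b $ i else 0) oo x) $ (n - k)"
      unfolding fps_compose_nth
    proof (rule sum.cong[OF refl])
      fix i
      show "b $ i * x ^ i $ (n - k) =
        Abs_fps (\<lambda>i. if [n = r + i * s] (mod m) then b $ i else 0) $ i * x ^ i $ (n - k)"
      proof (cases "x ^ i $ (n - k) = 0")
        case False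
        then have "[n - k = i * s] (mod m)" using supp_power[OF x, of i] by (simp add: supp_def)
        then have "[k + (n - k) = r + i * s] (mod m)" using kr by (rule cong_add[rotated])
        then show ?thesis using k by simp
      qed simp
    qed
    then show ?thesis by simp
  qed simp
qed

definition U4 :: "int fps \<Rightarrow> int fps" where "U4 f = Abs_fps (\<lambda>n. f $ (4 * n))"

lemma X_power_compose: assumes "c $ 0 = (0 :: int)" shows "fps_X ^ k oo c = c ^ k"
  using assms by (simp flip: fps_compose_power)

lemma dil_as_compose: "f oo (c ^ k) = (f oo fps_X ^ k) oo c" if "c $ 0 = 0" "k > 0" for f :: "int fps"
proof -
  have "(f oo fps_X ^ k) oo c = f oo (fps_X ^ k oo c)" using that by (intro fps_compose_assoc[symmetric]) simp_all
  also have "fps_X ^ k oo c = c ^ k" using that by (simp flip: fps_compose_power)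
  finally show ?thesis by simp
qed

lemma dil_compose: "m > 0 \<Longrightarrow> c $ 0 = 0 \<Longrightarrow> dilate m (f oo c) = f oo dilate m (c :: int fps)"
  unfolding dilate_def by (rule fps_compose_assoc[symmetric]) simp_all

lemma supp_w_ser: "supp 4 1 w_ser"
proof -
  have "supp 4 (1 + 0) w_ser"
    unfolding w_ser_def by (intro supp_mult supp_weaken[OF supp_osq]) (simp_all add: inv_phi_q4_def supp_dil)
  then show ?thesis by simp
qed

lemma w_ser_component:
  assumes "[n = r] (mod 4)" "r < 4"
  shows "(inv_phi_q4 * (b oo w_ser)) $ n = (inv_phi_q4 * w_ser ^ r * dilate 4 (Abs_fps (\<lambda>i. b $ (r + 4 * i)) oo t_ser)) $ n"
proof -
  let ?S = "Abs_fps (\<lambda>i. b $ (r + 4 * i))"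
  have "supp 4 0 inv_phi_q4" by (simp add: inv_phi_q4_def supp_dil)
  from component[OF this supp_w_ser, of b n]
  have "(inv_phi_q4 * (b oo w_ser)) $ n = (inv_phi_q4 * (Abs_fps (\<lambda>i. if [n = i] (mod 4) then b $ i else 0) oo w_ser)) $ n"
    by simp
  also have "Abs_fps (\<lambda>i. if [n = i] (mod 4) then b $ i else 0) = fps_X ^ r * dilate 4 ?S"
  proof (rule fps_ext)
    fix i
    have "n mod 4 = r" using assms by (simp add: cong_def)
    have *: "[n = i] (mod 4) \<longleftrightarrow> r \<le> i \<and> 4 dvd i - r"
    proof
      assume "[n = i] (mod 4)"
      then have "r = i mod 4" using \<open>n mod 4 = r\<close> by (simp add: cong_def)
      then show "r \<le> i \<and> 4 dvd i - r" by (simp add: dvd_minus_mod)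
    next
      assume h: "r \<le> i \<and> 4 dvd i - r"
      then obtain k where "i - r = 4 * k" by blast
      then have "i = r + 4 * k" using h by simp
      then show "[n = i] (mod 4)" using \<open>n mod 4 = r\<close> assms(2) by (simp add: cong_def)
    qed
    show "Abs_fps (\<lambda>i. if [n = i] (mod 4) then b $ i else 0) $ i = (fps_X ^ r * dilate 4 ?S) $ i"
      using * by (auto simp: fps_X_power_mult_nth dil_nth not_less)
  qed
  also have "(fps_X ^ r * dilate 4 ?S) oo w_ser = w_ser ^ r * ((?S oo fps_X ^ 4) oo w_ser)"
    unfolding fps_compose_mult_distrib[OF w_ser_0] dilate_def by (simp only: X_power_compose[OF w_ser_0])
  also have "(?S oo fps_X ^ 4) oo w_ser = ?S oo dilate 4 t_ser"
    unfolding dil_4_t_ser by (rule dil_as_compose[symmetric]) simp_all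
  also have "?S oo dilate 4 t_ser = dilate 4 (?S oo t_ser)" by (simp add: dil_compose)
  finally show ?thesis by (simp add: mult.assoc)
qed

definition contr :: "int fps \<Rightarrow> int fps" where "contr f = U4 (geom2 * (f oo tau))"

text \<open>
In terms of \<open>w_ser\<close>, the part supported on multiples of 4 consists of the fourth powers
of \<open>w_ser\<close>, and these are \<open>t_ser(q^4)\<close>; hence the choice of the operator
\<open>contr\<close>.
\<close>

lemma U4_step: "U4 (inv_phi * (f oo t_ser)) = inv_phi * (contr f oo t_ser)"
proof (rule fps_ext)
  fix n
  have "U4 (inv_phi * (f oo t_ser)) $ n = (inv_phi_q4 * ((geom2 * (f oo tau)) oo w_ser)) $ (4 * n)"
    by (simp add: U4_def inv_phi_compose_t_ser)
  also have "\<dots> = (inv_phi_q4 * dilate 4 (contr f oo t_ser)) $ (4 * n)"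
    using w_ser_component[of "4 * n" 0] by (simp add: cong_0_iff contr_def U4_def)
  also have "inv_phi_q4 * dilate 4 (contr f oo t_ser) = dilate 4 (inv_phi * (contr f oo t_ser))" by (simp add: inv_phi_q4_def dil_mult)
  also have "\<dots> $ (4 * n) = (inv_phi * (contr f oo t_ser)) $ n" by (simp add: dil_nth)
  finally show "U4 (inv_phi * (f oo t_ser)) $ n = (inv_phi * (contr f oo t_ser)) $ n" .
qed

lemma U4_steps: "(inv_phi * (f oo t_ser)) $ (4 ^ k * n) = (inv_phi * ((contr ^^ k) f oo t_ser)) $ n"
proof (induction k arbitrary: n)
  case (Suc k)
  have "(inv_phi * (f oo t_ser)) $ (4 ^ Suc k * n) = (inv_phi * ((contr ^^ k) f oo t_ser)) $ (4 * n)"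
    using Suc.IH[of "4 * n"] by (simp add: ac_simps)
  also have "\<dots> = U4 (inv_phi * ((contr ^^ k) f oo t_ser)) $ n" by (simp add: U4_def)
  also have "\<dots> = (inv_phi * ((contr ^^ Suc k) f oo t_ser)) $ n" by (simp only: U4_step funpow.simps comp_apply)
  finally show ?case .
qed simp

lemma overpartition_contr:
  assumes "k > 0" shows "int (overpartition_number (4 ^ k * n)) = (inv_phi * ((contr ^^ k) 1 oo t_ser)) $ n"
  using U4_steps[of 1 k n] assms by (simp add: inv_phi_nth)

definition scaled :: "int fps \<Rightarrow> bool" where "scaled f \<longleftrightarrow> (\<forall>n. 2 ^ n dvd f $ n)"

lemma scaled_mult: assumes "scaled f" "scaled g" shows "scaled (f * g)"
  unfolding scaled_def fps_mult_nth
proof (intro allI dvd_sum)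
  fix n i :: nat assume "i \<in> {0..n}"
  then have "(2::int) ^ n = 2 ^ i * 2 ^ (n - i)" by (simp flip: power_add)
  then show "2 ^ n dvd f $ i * g $ (n - i)" using assms by (simp add: scaled_def mult_dvd_mono)
qed

lemma scaled_1: "scaled 1" by (simp add: scaled_def)

lemma scaled_power: "scaled f \<Longrightarrow> scaled (f ^ k)"
  by (induction k) (auto intro: scaled_1 scaled_mult)

lemma scaled_geom2: "scaled geom2"
  unfolding scaled_def geom2_def by (simp add: power_minus[of 2])

lemma scaled_1_4X2: "scaled (1 + 4 * fps_X ^ 2)"
  by (auto simp: scaled_def num_mult_nth fps_X_power_nth)

text \<open>
Apart from the factor \<open>X\<close> in \<open>tau\<close>, everything is a power series in
\<open>2 X\<close>.
\<close>

lemma geom2_tau_dvd: "2 ^ (m - j) dvd (geom2 ^ Suc k * tau ^ j) $ m"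
proof -
  have "geom2 ^ Suc k * tau ^ j = fps_X ^ j * (geom2 ^ Suc k * ((1 + 4 * fps_X ^ 2) ^ j * (geom2 ^ 4) ^ j))"
    by (simp add: tau_def power_mult_distrib ac_simps)
  then have e: "(geom2 ^ Suc k * tau ^ j) $ m =
      (fps_X ^ j * (geom2 ^ Suc k * ((1 + 4 * fps_X ^ 2) ^ j * (geom2 ^ 4) ^ j))) $ m" by (simp only:)
  have "scaled (geom2 ^ Suc k * ((1 + 4 * fps_X ^ 2) ^ j * (geom2 ^ 4) ^ j))"
    by (intro scaled_mult scaled_power scaled_geom2 scaled_1_4X2)
  then show ?thesis unfolding e by (simp add: scaled_def fps_X_power_mult_nth del: power_Suc)
qed

lemma mult_compose_nth: fixes c :: "int fps" assumes "c $ 0 = 0"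
  shows "(g * (f oo c)) $ m = (\<Sum>j=0..m. f $ j * (g * c ^ j) $ m)"
proof -
  have "(g * (f oo c)) $ m = (\<Sum>i=0..m. g $ i * (\<Sum>j=0..m - i. f $ j * (c ^ j $ (m - i))))"
    by (simp add: fps_mult_nth fps_compose_nth)
  also have "\<dots> = (\<Sum>i=0..m. g $ i * (\<Sum>j=0..m. f $ j * (c ^ j $ (m - i))))"
  proof (rule sum.cong[OF refl])
    fix i assume "i \<in> {0..m}"
    have "(\<Sum>j=0..m - i. f $ j * (c ^ j $ (m - i))) = (\<Sum>j=0..m. f $ j * (c ^ j $ (m - i)))"
      by (rule sum.mono_neutral_left) (use startsby_zero_power_prefix[OF assms] in auto)
    then show "g $ i * (\<Sum>j=0..m - i. f $ j * (c ^ j $ (m - i))) = g $ i * (\<Sum>j=0..m. f $ j * (c ^ j $ (m - i)))"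
      by (simp only:)
  qed
  also have "\<dots> = (\<Sum>j=0..m. f $ j * (g * c ^ j) $ m)"
    unfolding fps_mult_nth sum_distrib_left by (subst sum.swap) (simp add: ac_simps)
  finally show ?thesis .
qed

lemma contr_nth: "contr f $ i = (\<Sum>j=0..4 * i. f $ j * (geom2 * tau ^ j) $ (4 * i))"
  by (simp add: contr_def U4_def mult_compose_nth)

definition coeffs_dvd :: "int \<Rightarrow> int fps \<Rightarrow> bool" where "coeffs_dvd d f \<longleftrightarrow> (\<forall>n. d dvd f $ n)"

lemma coeffs_dvd_mult: "coeffs_dvd d g \<Longrightarrow> coeffs_dvd d (f * g)"
  unfolding coeffs_dvd_def fps_mult_nth by (auto intro!: dvd_sum)

lemma coeffs_dvd_compose: "coeffs_dvd d f \<Longrightarrow> coeffs_dvd d (f oo x)"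
  unfolding coeffs_dvd_def fps_compose_nth by (auto intro!: dvd_sum)

lemma coeffs_dvd_add: "coeffs_dvd d f \<Longrightarrow> coeffs_dvd d g \<Longrightarrow> coeffs_dvd d (f + g)"
  by (simp add: coeffs_dvd_def)

lemma contr_minus: "contr (f - g) = contr f - contr g"
  by (rule fps_ext) (simp add: contr_def U4_def fps_compose_sub_distrib right_diff_distrib)

lemma contr_add: "contr (f + g) = contr f + contr g"
  by (rule fps_ext) (simp add: contr_def U4_def fps_compose_add_distrib distrib_left)

lemma contr_const_mult: "contr (fps_const c * f) = fps_const c * contr f"
  by (rule fps_ext) (simp add: contr_nth sum_distrib_left mult.assoc)

lemma geom2_tau_dvd1: "2 ^ (m - j) dvd (geom2 * tau ^ j) $ m"
  using geom2_tau_dvd[of m j 0] by simp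

lemma contr_dvd:
  assumes "f $ 0 = 0" "\<And>j. j \<ge> 1 \<Longrightarrow> 2 ^ c j dvd f $ j"
    and "\<And>j. 1 \<le> j \<Longrightarrow> j \<le> 4 * i \<Longrightarrow> e \<le> c j + (4 * i - j)"
  shows "2 ^ e dvd contr f $ i"
  unfolding contr_nth
proof (rule dvd_sum)
  fix j assume j: "j \<in> {0..4 * i}"
  show "2 ^ e dvd f $ j * (geom2 * tau ^ j) $ (4 * i)"
  proof (cases "j = 0")
    case False
    then have "2 ^ e dvd (2::int) ^ (c j + (4 * i - j))" using assms(3) j by (intro le_imp_power_dvd) simp
    also have "\<dots> dvd f $ j * (geom2 * tau ^ j) $ (4 * i)"
      unfolding power_add using False by (intro mult_dvd_mono assms(2) geom2_tau_dvd1) simp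
    finally show ?thesis .
  qed (simp add: assms(1))
qed

lemma contr_0: "f $ 0 = 0 \<Longrightarrow> contr f $ 0 = 0"
  by (simp add: contr_nth)

text \<open>
Series without constant term that become divisible by \<open>2^c\<close> after the substitution of
\<open>X / 2^s\<close>.
\<close>

definition dyadic :: "nat \<Rightarrow> nat \<Rightarrow> int fps \<Rightarrow> bool" where
  "dyadic s c f \<longleftrightarrow> f $ 0 = 0 \<and> (\<forall>i\<ge>1. 2 ^ (c + s * i) dvd f $ i)"

text \<open>
The coefficient of \<open>X^j\<close> contributes to that of \<open>X^i\<close> with a factor
\<open>2^(4 i - j)\<close>, and only for \<open>j \<le> 4 i\<close>. The gain is smallest for
\<open>i = j = 1\<close>, where it is \<open>2^3\<close>.
\<close>

lemma contr_dyadic_2: assumes "dyadic 2 c f" shows "dyadic 2 (c + 3) (contr f)"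
  unfolding dyadic_def
proof (intro conjI allI impI)
  show "contr f $ 0 = 0" using assms by (simp add: dyadic_def contr_0)
  fix i :: nat assume i: "i \<ge> 1"
  show "2 ^ (c + 3 + 2 * i) dvd contr f $ i"
  proof (rule contr_dvd[where c = "\<lambda>j. c + 2 * j"])
    fix j show "c + 3 + 2 * i \<le> c + 2 * j + (4 * i - j)" if "1 \<le> j" "j \<le> 4 * i"
      using that i by linarith
  qed (use assms in \<open>simp_all add: dyadic_def\<close>)
qed

lemma contr_dyadic_4: assumes "dyadic 4 c f" shows "dyadic 4 (c + 3) (contr f)"
  unfolding dyadic_def
proof (intro conjI allI impI)
  show "contr f $ 0 = 0" using assms by (simp add: dyadic_def contr_0)
  fix i :: nat assume i: "i \<ge> 1"
  show "2 ^ (c + 3 + 4 * i) dvd contr f $ i"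
  proof (rule contr_dvd[where c = "\<lambda>j. c + 4 * j"])
    fix j show "c + 3 + 4 * i \<le> c + 4 * j + (4 * i - j)" if "1 \<le> j" "j \<le> 4 * i"
      using that i by linarith
  qed (use assms in \<open>simp_all add: dyadic_def\<close>)
qed

lemma contr_iter_dyadic: "dyadic 2 c f \<Longrightarrow> dyadic 2 (c + 3 * k) ((contr ^^ k) f)"
proof (induction k)
  case (Suc k)
  from contr_dyadic_2[OF Suc.IH[OF Suc.prems]] show ?case by (simp add: add.commute add.left_commute)
qed simp

lemma dyadic_coeffs_dvd: assumes "dyadic s c f" shows "coeffs_dvd (2 ^ (c + s)) f"
  unfolding coeffs_dvd_def
proof
  fix i
  show "2 ^ (c + s) dvd f $ i"
  proof (cases "i = 0")
    case False
    then have "c + s \<le> c + s * i" by simp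
    then have "(2::int) ^ (c + s) dvd 2 ^ (c + s * i)" by (rule le_imp_power_dvd)
    also have "(2::int) ^ (c + s * i) dvd f $ i" using assms False by (simp add: dyadic_def)
    finally show ?thesis .
  qed (use assms in \<open>simp add: dyadic_def\<close>)
qed

definition contr_one :: "nat \<Rightarrow> int fps" where "contr_one k = (contr ^^ k) 1"

lemma contr_one_Suc: "contr_one (Suc k) = contr (contr_one k)" by (simp add: contr_one_def)

text \<open>
The contraction of 1 is \<open>1 / (1 - 16 X)\<close>.
\<close>

lemma contr_one_1_nth: "contr_one 1 $ i = 16 ^ i"
proof -
  have "contr 1 $ i = geom2 $ (4 * i)" by (simp add: contr_def U4_def)
  also have "\<dots> = 16 ^ i" by (simp add: geom2_def power_mult)
  finally show ?thesis by (simp add: contr_one_def)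
qed

definition contr_diff :: "nat \<Rightarrow> int fps" where "contr_diff k = contr_one (Suc k) - contr_one k"

lemma contr_diff_Suc: "contr_diff (Suc k) = contr (contr_diff k)"
  by (simp add: contr_diff_def contr_one_Suc contr_minus)

lemma contr_diff_dyadic_4: "dyadic 4 (3 * k) (contr_diff k)"
proof (induction k)
  case 0
  have "contr_diff 0 $ i = (if i = 0 then 0 else 16 ^ i)" for i
    using contr_one_1_nth[of i] by (simp add: contr_diff_def) (simp add: contr_one_def)
  moreover have "(2::int) ^ (4 * i) = 16 ^ i" for i by (simp add: power_mult)
  ultimately show ?case by (simp add: dyadic_def)
next
  case (Suc k)
  from contr_dyadic_4[OF Suc.IH] show ?case by (simp add: contr_diff_Suc add.commute)
qed

definition coeff_list :: "nat \<Rightarrow> int fps \<Rightarrow> int list" where "coeff_list N f = map (\<lambda>n. f $ n) [0..<N]"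

text \<open>
The list functions compute truncated products by \<open>1 / (1 + 2 X)\<close>, by \<open>1 + 4
X^2\<close>, and by \<open>tau\<close>, so that composition with \<open>tau\<close> can be carried
out by Horner's scheme. The extra arguments hold the preceding coefficients.
\<close>

fun div_list :: "int \<Rightarrow> int list \<Rightarrow> int list" where
  "div_list p [] = []"
| "div_list p (x # xs) = (x - 2 * p) # div_list (x - 2 * p) xs"

fun mul_list :: "int \<Rightarrow> int \<Rightarrow> int list \<Rightarrow> int list" where
  "mul_list p q [] = []"
| "mul_list p q (x # xs) = (x + 4 * p) # mul_list q x xs"

fun add_list :: "int \<Rightarrow> int list \<Rightarrow> int list \<Rightarrow> int list" where
  "add_list c (x # xs) (y # ys) = (x + c * y) # add_list c xs ys"
| "add_list c xs ys = []"

lemma geom2_0 [simp]: "geom2 $ 0 = 1" by (simp add: geom2_def)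

lemma geom2_mult_rec: "(geom2 * f) $ 0 = f $ 0" "(geom2 * f) $ Suc n = f $ Suc n - 2 * (geom2 * f) $ n"
proof -
  have "geom2 * f + 2 * (fps_X * (geom2 * f)) = ((1 + 2 * fps_X) * geom2) * f"
    by (simp only: distrib_right mult_1_left mult.assoc)
  then have contr_one: "geom2 * f + 2 * (fps_X * (geom2 * f)) = f" by (simp only: geom2 mult_1_left)
  have "(geom2 * f + 2 * (fps_X * (geom2 * f))) $ Suc n = (geom2 * f) $ Suc n + 2 * (geom2 * f) $ n"
    by (simp only: fps_add_nth num_mult_nth fps_X_mult_nth) simp
  then show "(geom2 * f) $ Suc n = f $ Suc n - 2 * (geom2 * f) $ n" unfolding contr_one by simp
  show "(geom2 * f) $ 0 = f $ 0" by (simp add: geom2_def)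
qed

lemma divl_map: "div_list ((geom2 * f) $ k) (map (\<lambda>n. f $ n) [Suc k..<N]) = map (\<lambda>n. (geom2 * f) $ n) [Suc k..<N]"
proof (induction "N - k" arbitrary: k)
  case (Suc m)
  show ?case
  proof (cases "Suc k < N")
    case True
    have r: "[Suc k..<N] = Suc k # [Suc (Suc k)..<N]" using True by (rule upt_conv_Cons)
    show ?thesis unfolding r list.map div_list.simps geom2_mult_rec(2)[symmetric]
      using Suc.hyps(1)[of "Suc k"] Suc.hyps(2) by simp
  qed simp
qed simp

lemma coeff_list_geom2: "coeff_list N (geom2 * f) = div_list 0 (coeff_list N f)"
proof (cases N)
  case (Suc M)
  have r: "[0..<N] = 0 # [Suc 0..<N]" using Suc by (simp add: upt_conv_Cons)
  show ?thesis unfolding coeff_list_def r list.map div_list.simps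
    using divl_map[of f 0 N] by (simp add: geom2_mult_rec(1))
qed (simp add: coeff_list_def)

lemma X2_mult_nth: "((1 + 4 * fps_X ^ 2) * f) $ n = f $ n + (if n < 2 then 0 else 4 * f $ (n - 2))" for f :: "int fps"
  by (simp add: distrib_right mult.assoc num_mult_nth fps_X_power_mult_nth)

lemma mul4_map: "mul_list (f $ k) (f $ Suc k) (map (\<lambda>n. f $ n) [Suc (Suc k)..<N]) =
  map (\<lambda>n. ((1 + 4 * fps_X ^ 2) * f) $ n) [Suc (Suc k)..<N]" for f :: "int fps"
proof (induction "N - k" arbitrary: k)
  case (Suc m)
  show ?case
  proof (cases "Suc (Suc k) < N")
    case True
    have r: "[Suc (Suc k)..<N] = Suc (Suc k) # [Suc (Suc (Suc k))..<N]" using True by (rule upt_conv_Cons)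
    show ?thesis unfolding r list.map mul_list.simps
      using Suc.hyps(1)[of "Suc k"] Suc.hyps(2) by (simp add: X2_mult_nth)
  qed simp
qed simp

lemma coeff_list_X2: "coeff_list (Suc (Suc N)) ((1 + 4 * fps_X ^ 2) * f) = mul_list 0 0 (coeff_list (Suc (Suc N)) f)"
proof -
  have r: "[0..<Suc (Suc N)] = 0 # Suc 0 # [Suc (Suc 0)..<Suc (Suc N)]" by (simp add: upt_conv_Cons)
  show ?thesis unfolding coeff_list_def r list.map mul_list.simps
    using mul4_map[of f 0 "Suc (Suc N)"] by (simp add: X2_mult_nth)
qed

lemma coeff_list_X: "coeff_list (Suc N) (fps_X * f) = 0 # butlast (coeff_list (Suc N) f)"
proof -
  have r: "[0..<Suc N] = 0 # map Suc [0..<N]" by (simp add: upt_conv_Cons map_Suc_upt)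
  have "butlast (coeff_list (Suc N) f) = map (\<lambda>n. f $ n) [0..<N]" by (simp add: coeff_list_def)
  moreover have "coeff_list (Suc N) (fps_X * f) = 0 # map (\<lambda>n. f $ n) [0..<N]"
    unfolding coeff_list_def r by (simp add: comp_def)
  ultimately show ?thesis by simp
qed

definition tau_list :: "int list \<Rightarrow> int list" where
  "tau_list xs = 0 # butlast (mul_list 0 0 (div_list 0 (div_list 0 (div_list 0 (div_list 0 xs)))))"

lemma coeff_list_tau: "coeff_list (Suc (Suc N)) (tau * f) = tau_list (coeff_list (Suc (Suc N)) f)"
proof -
  have "tau * f = fps_X * ((1 + 4 * fps_X ^ 2) * (geom2 * (geom2 * (geom2 * (geom2 * f)))))"
    by (simp add: tau_def power4_eq_xxxx ac_simps)
  then show ?thesis by (simp only: coeff_list_X coeff_list_X2 coeff_list_geom2 tau_list_def)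
qed

lemma coeff_list_add: "coeff_list N (f + fps_const c * g) = add_list c (coeff_list N f) (coeff_list N g)"
proof -
  have "add_list c (map f' xs) (map g' xs) = map (\<lambda>n. f' n + c * g' n) xs" for f' g' :: "nat \<Rightarrow> int" and xs
    by (induction xs) auto
  then show ?thesis by (simp add: coeff_list_def)
qed

fun horner_list :: "int list \<Rightarrow> int list \<Rightarrow> int list" where
  "horner_list gl [] = map (\<lambda>_. 0) gl"
| "horner_list gl (c # cs) = add_list c (tau_list (horner_list gl cs)) gl"

definition poly_ser :: "int list \<Rightarrow> int fps" where
  "poly_ser cs = Abs_fps (\<lambda>n. if n < length cs then cs ! n else 0)"

lemma polyf_Cons: "poly_ser (c # cs) = fps_X * poly_ser cs + fps_const c"
  by (rule fps_ext) (auto simp: poly_ser_def nth_Cons split: nat.splits)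

lemma horner_list: "coeff_list (Suc (Suc N)) (g * (poly_ser cs oo tau)) = horner_list (coeff_list (Suc (Suc N)) g) cs"
proof (induction cs)
  case Nil
  have "poly_ser [] = 0" by (rule fps_ext) (simp add: poly_ser_def)
  then show ?case by (simp add: coeff_list_def map_replicate_const)
next
  case (Cons c cs)
  have "g * (poly_ser (c # cs) oo tau) = tau * (g * (poly_ser cs oo tau)) + fps_const c * g"
    unfolding polyf_Cons fps_compose_add_distrib fps_compose_mult_distrib[OF tau_0]
    by (simp add: distrib_left ac_simps)
  then show ?case by (simp only: coeff_list_add coeff_list_tau Cons.IH horner_list.simps)
qed

lemma coeffs_dvd_contr: assumes "coeffs_dvd q f" shows "coeffs_dvd q (contr f)"
  using coeffs_dvd_mult[OF coeffs_dvd_compose[OF assms], of geom2 tau] by (simp add: coeffs_dvd_def contr_def U4_def)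

definition geom2_list :: "int list" where
  "geom2_list = [1, -2, 4, -8, 16, -32, 64, -128, 256, -512, 1024, -2048, 4096, -8192, 16384, -32768, 65536]"

lemma coeff_list_geom2_list: "coeff_list 17 geom2 = geom2_list"
proof -
  have "coeff_list 17 geom2 = map (\<lambda>n. (- 2) ^ n) [0..<17]" by (simp add: coeff_list_def geom2_def)
  also have "\<dots> = geom2_list" by (simp add: geom2_list_def upt_rec)
  finally show ?thesis .
qed

text \<open>
The coefficients of \<open>(f oo tau) / (1 + 2 X)\<close> up to \<open>X^16\<close> for the
polynomial \<open>f\<close> with coefficient list \<open>E\<close>. The contraction uses those with
index divisible by 4.
\<close>

definition geom2_tau_list :: "int list \<Rightarrow> int list" where "geom2_tau_list E = horner_list geom2_list E"

lemma coeff_list_nth: "n < N \<Longrightarrow> coeff_list N f ! n = f $ n"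
  by (simp add: coeff_list_def)

lemma geom2_tau_list: assumes "n < 17" shows "geom2_tau_list E ! n = (geom2 * (poly_ser E oo tau)) $ n"
proof -
  have "coeff_list 17 (geom2 * (poly_ser E oo tau)) = geom2_tau_list E"
    using horner_list[of 15 geom2 E] coeff_list_geom2_list by (simp add: geom2_tau_list_def)
  then show ?thesis using coeff_list_nth[OF assms] by metis
qed

lemma contr_polyf: "i \<le> 4 \<Longrightarrow> contr (poly_ser E) $ i = geom2_tau_list E ! (4 * i)"
  by (simp add: geom2_tau_list contr_def U4_def)

text \<open>
The first and second iterate of the contraction at 1, modulo \<open>2^20\<close>; the coefficients
from \<open>X^5\<close> on vanish modulo \<open>2^20\<close>.
\<close>

abbreviation "contr_list1 \<equiv> [1, 16, 256, 4096, 65536 :: int]"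
abbreviation "contr_list2 \<equiv> [1, 2064, 213248, 266240, 65536 :: int]"

lemma coeffs_dvd_polyf:
  assumes "length E = 5" "\<And>i. i < 5 \<Longrightarrow> q dvd f $ i - E ! i" "\<And>i. i \<ge> 5 \<Longrightarrow> q dvd f $ i"
  shows "coeffs_dvd q (f - poly_ser E)"
  unfolding coeffs_dvd_def using assms by (auto simp: poly_ser_def not_less)

lemma less_5: "(i :: nat) < 5 \<Longrightarrow> i = 0 \<or> i = 1 \<or> i = 2 \<or> i = 3 \<or> i = 4"
  by linarith

lemma contr_one_minus_1: "dyadic 4 0 (contr_one k - 1)"
proof (induction k)
  case 0 show ?case by (simp add: contr_one_def dyadic_def)
next
  case (Suc k)
  have "contr_one (Suc k) - 1 = contr_diff k + (contr_one k - 1)" by (simp add: contr_diff_def)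
  moreover have "2 ^ (4 * i) dvd contr_diff k $ i" if "i \<ge> 1" for i
  proof -
    have "(2::int) ^ (4 * i) dvd 2 ^ (3 * k + 4 * i)" by (rule le_imp_power_dvd) simp
    also have "\<dots> dvd contr_diff k $ i" using contr_diff_dyadic_4[of k] that by (simp add: dyadic_def)
    finally show ?thesis .
  qed
  moreover have "contr_diff k $ 0 = 0" using contr_diff_dyadic_4[of k] by (simp add: dyadic_def)
  ultimately show ?case using Suc by (simp add: dyadic_def)
qed

lemma contr_one_dvd: "2 ^ (4 * i) dvd contr_one k $ i"
  using contr_one_minus_1[of k] by (cases "i = 0") (auto simp: dyadic_def)

lemma contr_one_high: assumes "i \<ge> 5" shows "2 ^ 20 dvd contr_one k $ i"
proof -
  have "(2::int) ^ 20 dvd 2 ^ (4 * i)" using assms by (intro le_imp_power_dvd) simp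
  then show ?thesis using contr_one_dvd dvd_trans by blast
qed

lemma contr_one_1_approx: "coeffs_dvd (2 ^ 20) (contr_one 1 - poly_ser contr_list1)"
proof (rule coeffs_dvd_polyf)
  fix i :: nat assume "i < 5"
  then show "2 ^ 20 dvd contr_one 1 $ i - contr_list1 ! i"
    unfolding contr_one_1_nth by (elim less_5[THEN disjE] disjE) simp_all
qed (use contr_one_high in auto)

lemma blist_contr_list1: "geom2_tau_list contr_list1 ! 0 = 1 \<and> geom2_tau_list contr_list1 ! 4 = 2064 \<and> [geom2_tau_list contr_list1 ! 8 = 213248] (mod 2 ^ 20) \<and>
    [geom2_tau_list contr_list1 ! 12 = 266240] (mod 2 ^ 20) \<and> [geom2_tau_list contr_list1 ! 16 = 65536] (mod 2 ^ 20)"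
  unfolding geom2_tau_list_def geom2_list_def cong_def by code_simp

lemma contr_one_2_approx: "coeffs_dvd (2 ^ 20) (contr_one 2 - poly_ser contr_list2)"
proof (rule coeffs_dvd_polyf)
  have e2: "contr_one 2 = contr (contr_one 1)" using contr_one_Suc[of 1] by (simp add: numeral_2_eq_2)
  fix i :: nat
  assume i: "i < 5"
  have "coeffs_dvd (2 ^ 20) (contr (contr_one 1 - poly_ser contr_list1))" by (rule coeffs_dvd_contr[OF contr_one_1_approx])
  then have "2 ^ 20 dvd contr_one 2 $ i - contr (poly_ser contr_list1) $ i" by (simp add: coeffs_dvd_def contr_minus e2)
  moreover have "2 ^ 20 dvd contr (poly_ser contr_list1) $ i - contr_list2 ! i"
    using less_5[OF i] blist_contr_list1 contr_polyf[of i contr_list1] unfolding cong_iff_dvd_diff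
    by (elim disjE) simp_all
  ultimately have "2 ^ 20 dvd (contr_one 2 $ i - contr (poly_ser contr_list1) $ i) + (contr (poly_ser contr_list1) $ i - contr_list2 ! i)" by (rule dvd_add)
  then show "2 ^ 20 dvd contr_one 2 $ i - contr_list2 ! i" by simp
qed (use contr_one_high in auto)

lemma blist_contr_list2: "2 ^ 16 dvd geom2_tau_list contr_list2 ! 4 - 2064 \<and> 2 ^ 18 dvd geom2_tau_list contr_list2 ! 8 - 213248 \<and> 2 ^ 20 dvd geom2_tau_list contr_list2 ! 12 - 266240"
  unfolding geom2_tau_list_def geom2_list_def by code_simp

text \<open>
The general estimate gives only \<open>dyadic 4 6\<close>. From \<open>X^4\<close> on that is
enough; the first three coefficients turn out to be divisible by \<open>2^16\<close>,
\<open>2^18\<close> and \<open>2^20\<close>.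
\<close>

lemma contr_diff_2_dyadic: "dyadic 2 14 (contr_diff 2)"
  unfolding dyadic_def
proof (intro conjI allI impI)
  show "contr_diff 2 $ 0 = 0" using contr_diff_dyadic_4[of 2] by (simp add: dyadic_def)
  fix i :: nat assume i: "i \<ge> 1"
  show "2 ^ (14 + 2 * i) dvd contr_diff 2 $ i"
  proof (cases "i \<ge> 4")
    case True
    then have "(2::int) ^ (14 + 2 * i) dvd 2 ^ (3 * 2 + 4 * i)" by (intro le_imp_power_dvd) simp
    then show ?thesis using contr_diff_dyadic_4[of 2] i dvd_trans unfolding dyadic_def by blast
  next
    case False
    have phi_q4: "coeffs_dvd (2 ^ 20) (contr (contr_one 2 - poly_ser contr_list2))" by (rule coeffs_dvd_contr[OF contr_one_2_approx])
    have contr_one: "contr_diff 2 $ i = contr (contr_one 2 - poly_ser contr_list2) $ i - (contr_one 2 - poly_ser contr_list2) $ i + (contr (poly_ser contr_list2) $ i - poly_ser contr_list2 $ i)"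
      by (simp add: contr_diff_def contr_minus flip: contr_one_Suc)
    have le: "14 + 2 * i \<le> 20" using False by simp
    have "(2::int) ^ (14 + 2 * i) dvd 2 ^ 20" using le by (rule le_imp_power_dvd)
    then have "2 ^ (14 + 2 * i) dvd contr (contr_one 2 - poly_ser contr_list2) $ i - (contr_one 2 - poly_ser contr_list2) $ i"
      using phi_q4 contr_one_2_approx unfolding coeffs_dvd_def by (meson dvd_diff dvd_trans)
    moreover have "2 ^ (14 + 2 * i) dvd contr (poly_ser contr_list2) $ i - poly_ser contr_list2 $ i"
    proof -
      have "i = 1 \<or> i = 2 \<or> i = 3" using False i by linarith
      moreover have "poly_ser contr_list2 $ 1 = 2064" "poly_ser contr_list2 $ 2 = 213248" "poly_ser contr_list2 $ 3 = 266240"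
        by (simp_all add: poly_ser_def)
      moreover have "contr (poly_ser contr_list2) $ 1 = geom2_tau_list contr_list2 ! 4" "contr (poly_ser contr_list2) $ 2 = geom2_tau_list contr_list2 ! 8" "contr (poly_ser contr_list2) $ 3 = geom2_tau_list contr_list2 ! 12"
        using contr_polyf[of 1 contr_list2] contr_polyf[of 2 contr_list2] contr_polyf[of 3 contr_list2] by simp_all
      ultimately show ?thesis using blist_contr_list2 by (elim disjE) simp_all
    qed
    ultimately show ?thesis unfolding contr_one by (rule dvd_add)
  qed
qed

lemma contr_diff_dyadic: "dyadic 2 (14 + 3 * m) (contr_diff (2 + m))"
proof (induction m)
  case (Suc m)
  from contr_dyadic_2[OF this] show ?case by (simp add: contr_diff_Suc[symmetric] ac_simps del: contr_diff_Suc)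
qed (simp add: contr_diff_2_dyadic)

lemma contr_one_stable: "coeffs_dvd (2 ^ (16 + 3 * m)) (contr_one (2 + m + j) - contr_one (2 + m))"
proof (induction j)
  case 0 show ?case by (simp add: coeffs_dvd_def)
next
  case (Suc j)
  have "coeffs_dvd (2 ^ (14 + 3 * (m + j) + 2)) (contr_diff (2 + (m + j)))" by (rule dyadic_coeffs_dvd[OF contr_diff_dyadic])
  moreover have "(2::int) ^ (16 + 3 * m) dvd 2 ^ (14 + 3 * (m + j) + 2)" by (rule le_imp_power_dvd) simp
  ultimately have "coeffs_dvd (2 ^ (16 + 3 * m)) (contr_diff (2 + (m + j)))" unfolding coeffs_dvd_def by (meson dvd_trans)
  from coeffs_dvd_add[OF this Suc] show ?case by (simp add: contr_diff_def add.assoc)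
qed

lemma coeff_dvd:
  assumes "coeffs_dvd q (f - g)"
  shows "q dvd (h * (f oo x)) $ n - (h * (g oo x)) $ n"
proof -
  have "coeffs_dvd q (h * ((f - g) oo x))" by (intro coeffs_dvd_mult coeffs_dvd_compose assms)
  then have "q dvd (h * ((f - g) oo x)) $ n" by (simp add: coeffs_dvd_def)
  then show ?thesis by (simp add: fps_compose_sub_distrib right_diff_distrib)
qed

abbreviation pb :: "nat \<Rightarrow> int" where "pb n \<equiv> int (overpartition_number n)"

lemma overpartition_contr_one: "k > 0 \<Longrightarrow> pb (4 ^ k * n) = (inv_phi * (contr_one k oo t_ser)) $ n"
  by (simp add: contr_one_def overpartition_contr)

definition cong2_ser :: "int fps \<Rightarrow> int fps \<Rightarrow> bool" where "cong2_ser f g \<longleftrightarrow> coeffs_dvd 2 (f - g)"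

lemma cong2_refl: "cong2_ser f f" by (simp add: cong2_ser_def coeffs_dvd_def)
lemma cong2_trans: "cong2_ser f g \<Longrightarrow> cong2_ser g h \<Longrightarrow> cong2_ser f h"
  unfolding cong2_ser_def using coeffs_dvd_add[of 2 "f - g" "g - h"] by simp
lemma cong2_mult: assumes "cong2_ser f f'" "cong2_ser g g'" shows "cong2_ser (f * g) (f' * g')"
proof -
  have "f * g - f' * g' = g * (f - f') + f' * (g - g')" by (simp add: algebra_simps)
  moreover have "coeffs_dvd 2 (g * (f - f') + f' * (g - g'))"
    using assms unfolding cong2_ser_def by (intro coeffs_dvd_add coeffs_dvd_mult)
  ultimately show ?thesis by (simp only: cong2_ser_def)
qed
lemma cong2_power: "cong2_ser f g \<Longrightarrow> cong2_ser (f ^ k) (g ^ k)"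
  by (induction k) (auto intro: cong2_refl cong2_mult)
lemma cong2_dil: "m > 0 \<Longrightarrow> cong2_ser f g \<Longrightarrow> cong2_ser (dilate m f) (dilate m g)"
  unfolding cong2_ser_def coeffs_dvd_def by (simp add: dil_nth)
lemma cong2_nth: "cong2_ser f g \<Longrightarrow> even (f $ n) \<longleftrightarrow> even (g $ n)"
  unfolding cong2_ser_def coeffs_dvd_def by simp

lemma cong2_phi: "cong2_ser phi 1"
  by (simp add: cong2_ser_def coeffs_dvd_def phi_nth)

lemma cong2_inv_phi: "cong2_ser inv_phi 1"
proof -
  have "cong2_ser (inv_phi * 1) (inv_phi * phi)" using cong2_phi by (intro cong2_mult cong2_refl) (simp add: cong2_ser_def coeffs_dvd_def)
  then show ?thesis by (simp add: mult.commute[of inv_phi phi] phi_inv_phi)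
qed

lemma cong2_w_ser: "cong2_ser w_ser osq"
proof -
  have "cong2_ser (osq * dilate 4 inv_phi) (osq * dilate 4 1)" by (intro cong2_mult cong2_dil cong2_inv_phi cong2_refl) simp
  then show ?thesis by (simp add: w_ser_def inv_phi_q4_def)
qed

lemma cong2_F_ser: "cong2_ser F_ser osq"
proof -
  have "cong2_ser (phi_q4 ^ 2 + 4 * osq ^ 2) (phi_q4 ^ 2)" by (simp add: cong2_ser_def coeffs_dvd_def num_mult_nth)
  moreover have phi_q4: "cong2_ser phi_q4 1" using cong2_dil[OF _ cong2_phi, of 4] by (simp add: phi_q4_def)
  ultimately have "cong2_ser (phi_q4 ^ 2 + 4 * osq ^ 2) (1 ^ 2)" using cong2_trans cong2_power by blast
  with phi_q4 have "cong2_ser (phi_q4 * osq * (phi_q4 ^ 2 + 4 * osq ^ 2)) (1 * osq * 1 ^ 2)" by (intro cong2_mult cong2_refl)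
  then show ?thesis by (simp add: F_ser_def phi_q4_def)
qed

lemma inv_phi_t_ser_even: assumes "even n" shows "even ((inv_phi * t_ser) $ n)"
proof -
  have "cong2_ser (inv_phi * (F_ser * inv_phi ^ 4)) (1 * (osq * 1 ^ 4))" by (intro cong2_mult cong2_power cong2_inv_phi cong2_F_ser)
  then have "cong2_ser (inv_phi * t_ser) osq" by (simp add: t_ser_def)
  moreover have "osq $ n = 0" using assms by (auto simp: osq_def)
  ultimately show ?thesis using cong2_nth by fastforce
qed

text \<open>
Consecutive iterates of the contraction at 1 differ by a series in the lattice of the preceding
lemmas, and the differences add up.
\<close>

theorem overpartition_stable:
  "2 ^ (16 + 3 * m) dvd pb (4 ^ (2 + m + j) * n) - pb (4 ^ (2 + m) * n)"
  using coeff_dvd[OF contr_one_stable[of m j], of inv_phi t_ser n] by (simp only: overpartition_contr_one)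

text \<open>
At even arguments one more power of 2 is gained: modulo \<open>2^17\<close> the difference is a
multiple of \<open>2^16 * t_ser\<close>, and \<open>inv_phi * t_ser\<close> is congruent modulo 2 to
the series of the odd squares.
\<close>

theorem overpartition_stable_even:
  assumes n: "even n"
  shows "2 ^ 17 dvd pb (4 ^ (2 + j) * n) - pb (4 ^ 2 * n)"
proof (cases j)
  case (Suc i)
  have "2 ^ 17 dvd (inv_phi * (contr_diff 2 oo t_ser)) $ n"
  proof -
    obtain a where a: "contr_diff 2 $ 1 = 2 ^ 16 * a"
    proof -
      have "2 ^ (14 + 2 * 1) dvd contr_diff 2 $ 1" using contr_diff_2_dyadic unfolding dyadic_def by blast
      then show ?thesis using that by (auto elim!: dvdE)
    qed
    have "coeffs_dvd (2 ^ 17) (contr_diff 2 - fps_const (2 ^ 16 * a) * fps_X)"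
      unfolding coeffs_dvd_def
    proof
      fix i
      have "2 ^ 17 dvd contr_diff 2 $ i" if "i \<ge> 2"
      proof -
        have "(2::int) ^ 17 dvd 2 ^ (14 + 2 * i)" using that by (intro le_imp_power_dvd) simp
        also have "(2::int) ^ (14 + 2 * i) dvd contr_diff 2 $ i" using contr_diff_2_dyadic that by (simp add: dyadic_def)
        finally show ?thesis .
      qed
      moreover have "contr_diff 2 $ 0 = 0" using contr_diff_2_dyadic by (simp add: dyadic_def)
      moreover have "i = 0 \<or> i = 1 \<or> i \<ge> 2" by linarith
      ultimately show "2 ^ 17 dvd (contr_diff 2 - fps_const (2 ^ 16 * a) * fps_X) $ i"
        using a by (auto simp: fps_X_def)
    qed
    from coeff_dvd[OF this, of inv_phi t_ser n]
    have "2 ^ 17 dvd (inv_phi * (contr_diff 2 oo t_ser)) $ n - (inv_phi * ((fps_const (2 ^ 16 * a) * fps_X) oo t_ser)) $ n" .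
    moreover have "(inv_phi * ((fps_const (2 ^ 16 * a) * fps_X) oo t_ser)) $ n = 2 ^ 16 * a * (inv_phi * t_ser) $ n"
      by (simp add: fps_compose_mult_distrib mult.left_commute[of inv_phi])
    moreover have "2 ^ 17 dvd 2 ^ 16 * a * (inv_phi * t_ser) $ n"
      using inv_phi_t_ser_even[OF n] by (auto elim!: evenE)
    ultimately show ?thesis by (simp add: dvd_diff_left_iff)
  qed
  moreover have "(inv_phi * (contr_diff 2 oo t_ser)) $ n = pb (4 ^ 3 * n) - pb (4 ^ 2 * n)"
  proof -
    have "contr_diff 2 = contr_one 3 - contr_one 2" by (simp add: contr_diff_def)
    moreover have "pb (4 ^ 3 * n) = (inv_phi * (contr_one 3 oo t_ser)) $ n" "pb (4 ^ 2 * n) = (inv_phi * (contr_one 2 oo t_ser)) $ n"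
      by (rule overpartition_contr_one; simp)+
    ultimately show ?thesis by (simp add: fps_compose_sub_distrib right_diff_distrib)
  qed
  moreover have "2 ^ 17 dvd pb (4 ^ (2 + j) * n) - pb (4 ^ 3 * n)"
  proof -
    have "2 ^ (16 + 3 * 1) dvd pb (4 ^ (2 + 1 + i) * n) - pb (4 ^ (2 + 1) * n)" by (rule overpartition_stable)
    moreover have "(2::int) ^ 17 dvd 2 ^ (16 + 3 * 1)" by (rule le_imp_power_dvd) simp
    ultimately have "2 ^ 17 dvd pb (4 ^ (2 + 1 + i) * n) - pb (4 ^ (2 + 1) * n)" by (rule dvd_trans[rotated])
    moreover have "2 + 1 + i = 2 + j" "2 + 1 = (3 :: nat)" using Suc by simp_all
    ultimately show ?thesis by (simp only:)
  qed
  ultimately have "2 ^ 17 dvd (pb (4 ^ (2 + j) * n) - pb (4 ^ 3 * n)) + (pb (4 ^ 3 * n) - pb (4 ^ 2 * n))"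
    by (intro dvd_add) simp_all
  then show ?thesis by simp
qed simp

text \<open>
A second dissection, finer than the one by \<open>w_ser\<close>. On the residue class of
\<open>r\<close> modulo 4 a series \<open>inv_phi * (f oo t_ser)\<close> agrees with a prefactor
times a power series in \<open>nu_ser\<close>, which is supported on 4 modulo 8. Thus the parity of
the exponent of \<open>nu_ser\<close> separates the classes modulo 8.
\<close>

definition nu_ser :: "int fps" where "nu_ser = dilate 4 w_ser"
definition grade_ser :: "nat \<Rightarrow> int fps" where "grade_ser r = osq ^ r * dilate 16 inv_phi ^ Suc r"
definition section4 :: "nat \<Rightarrow> int fps \<Rightarrow> int fps" where "section4 r b = Abs_fps (\<lambda>i. b $ (r + 4 * i))"
definition refine :: "nat \<Rightarrow> int fps \<Rightarrow> int fps" where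
  "refine r f = geom2 ^ Suc r * (section4 r (geom2 * (f oo tau)) oo tau)"

lemma nu_ser_0 [simp]: "nu_ser $ 0 = 0" by (simp add: nu_ser_def dil_nth)

lemma inv_phi_q4_nu: "inv_phi_q4 = dilate 16 inv_phi * (geom2 oo nu_ser)"
proof -
  have "dilate 4 inv_phi = dilate 4 (inv_phi_q4 * (geom2 oo w_ser))" by (simp only: inv_phi_w[symmetric])
  also have "\<dots> = dilate 4 inv_phi_q4 * (geom2 oo nu_ser)" by (simp add: dil_mult dil_compose nu_ser_def)
  also have "dilate 4 inv_phi_q4 = dilate 16 inv_phi" by (simp add: inv_phi_q4_def dil_dil)
  finally show ?thesis by (simp only: inv_phi_q4_def)
qed

lemma inv_phi_component:
  assumes "[n = r] (mod 4)" "r < 4"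
  shows "(inv_phi * (f oo t_ser)) $ n = (grade_ser r * (refine r f oo nu_ser)) $ n"
proof -
  let ?S = "section4 r (geom2 * (f oo tau))"
  have "(inv_phi * (f oo t_ser)) $ n = (inv_phi_q4 * w_ser ^ r * dilate 4 (?S oo t_ser)) $ n"
    unfolding inv_phi_compose_t_ser section4_def by (rule w_ser_component[OF assms])
  also have "dilate 4 (?S oo t_ser) = (?S oo tau) oo nu_ser"
    by (simp add: compose_t_ser dil_compose nu_ser_def)
  also have "inv_phi_q4 * w_ser ^ r = grade_ser r * (geom2 ^ Suc r oo nu_ser)"
  proof -
    have "inv_phi_q4 * w_ser ^ r = osq ^ r * inv_phi_q4 ^ Suc r" by (simp add: w_ser_def power_mult_distrib ac_simps)
    also have "inv_phi_q4 ^ Suc r = dilate 16 inv_phi ^ Suc r * (geom2 oo nu_ser) ^ Suc r"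
      by (subst inv_phi_q4_nu) (rule power_mult_distrib)
    also have "(geom2 oo nu_ser) ^ Suc r = geom2 ^ Suc r oo nu_ser" by (rule fps_compose_power) simp
    finally show ?thesis by (simp only: grade_ser_def mult.assoc)
  qed
  also have "grade_ser r * (geom2 ^ Suc r oo nu_ser) * ((?S oo tau) oo nu_ser) = grade_ser r * (refine r f oo nu_ser)"
    unfolding refine_def fps_compose_mult_distrib[OF nu_ser_0] by (simp only: mult.assoc)
  finally show ?thesis .
qed

lemma supp_nu: "supp 8 4 nu_ser"
proof -
  have "supp (4 * 4) (4 * 1) nu_ser" unfolding nu_ser_def by (rule supp_dil_mult[OF _ supp_w_ser]) simp
  then have "supp 16 4 nu_ser" by simp
  then show ?thesis by (rule supp_weaken) simp
qed

lemma supp_grade_ser: "supp 8 r (grade_ser r)"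
proof -
  have "supp 8 0 (dilate 16 inv_phi)" by (rule supp_weaken[OF supp_dil]) simp_all
  then have "supp 8 (r * 1 + Suc r * 0) (grade_ser r)"
    unfolding grade_ser_def by (intro supp_mult supp_power supp_osq)
  then show ?thesis by simp
qed

lemma class_mod_8_dvd:
  assumes "[n = r + 4 * p] (mod 8)"
    and "\<And>m. even (m + p) \<Longrightarrow> q dvd h $ m"
  shows "q dvd (grade_ser r * (h oo nu_ser)) $ n"
proof -
  define h' where "h' = Abs_fps (\<lambda>i. if [n = r + i * 4] (mod 8) then h $ i else 0)"
  have "q dvd h' $ m" for m
  proof (cases "[n = r + m * 4] (mod 8)")
    case True
    have "[r + m * 4 = r + 4 * p] (mod 8)" using True assms(1) cong_sym cong_trans by blast
    then have "[m * 4 = 4 * p] (mod 8)" by (simp only: cong_add_lcancel_nat)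
    then have "[4 * m = 4 * p] (mod 4 * 2)" by (simp add: mult.commute)
    then have "4 * (m mod 2) = 4 * (p mod 2)" by (simp only: cong_def mult_mod_right)
    then have "[m = p] (mod 2)" by (simp add: cong_def)
    then have "even m = even p" by (metis cong_dvd_iff dvd_refl)
    then have "even (m + p)" by simp
    then show ?thesis using assms(2) by (simp add: h'_def)
  qed (simp add: h'_def)
  then have "coeffs_dvd q (grade_ser r * (h' oo nu_ser))" by (intro coeffs_dvd_mult coeffs_dvd_compose) (simp add: coeffs_dvd_def)
  then have "q dvd (grade_ser r * (h' oo nu_ser)) $ n" by (simp add: coeffs_dvd_def)
  then show ?thesis unfolding component[OF supp_grade_ser supp_nu, of r h n] h'_def .
qed

definition refine_list :: "nat \<Rightarrow> int list \<Rightarrow> int list" where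
  "refine_list r E = horner_list ((div_list 0 ^^ r) (take 15 geom2_list)) (map (\<lambda>i. geom2_tau_list E ! (r + 4 * i)) [0, 1, 2, 3])"

lemma coeff_list_geom2_power: "coeff_list 15 (geom2 ^ Suc r) = (div_list 0 ^^ r) (take 15 geom2_list)"
proof (induction r)
  case 0
  have "coeff_list 15 geom2 = take 15 (coeff_list 17 geom2)" by (simp add: coeff_list_def take_map)
  then show ?case by (simp add: coeff_list_geom2_list)
next
  case (Suc r)
  have "coeff_list 15 (geom2 ^ Suc (Suc r)) = div_list 0 (coeff_list 15 (geom2 ^ Suc r))"
    using coeff_list_geom2[of 15 "geom2 ^ Suc r"] by simp
  then show ?case using Suc by simp
qed

lemma geom2_f_tau_dvd:
  assumes "\<And>j. 2 ^ (4 * j) dvd f $ j" shows "2 ^ i dvd (geom2 * (f oo tau)) $ i"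
  unfolding mult_compose_nth[OF tau_0]
proof (rule dvd_sum)
  fix j assume "j \<in> {0..i}"
  then have "(2::int) ^ i dvd 2 ^ (4 * j + (i - j))" by (intro le_imp_power_dvd) simp
  also have "\<dots> dvd f $ j * (geom2 * tau ^ j) $ i"
    unfolding power_add by (intro mult_dvd_mono assms geom2_tau_dvd1)
  finally show "2 ^ i dvd f $ j * (geom2 * tau ^ j) $ i" .
qed

text \<open>
Together with the explicit lists this bounds the computation: from \<open>X^15\<close> on all
coefficients are already divisible by \<open>2^15\<close>.
\<close>

lemma refine_high:
  assumes "\<And>j. 2 ^ (4 * j) dvd f $ j" shows "2 ^ m dvd refine r f $ m"
  unfolding refine_def mult_compose_nth[OF tau_0]
proof (rule dvd_sum)
  fix j assume "j \<in> {0..m}"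
  then have "(2::int) ^ m dvd 2 ^ (r + 4 * j + (m - j))" by (intro le_imp_power_dvd) simp
  also have "\<dots> dvd section4 r (geom2 * (f oo tau)) $ j * (geom2 ^ Suc r * tau ^ j) $ m"
    unfolding power_add[of _ "r + 4 * j"] section4_def fps_nth_Abs_fps
    by (intro mult_dvd_mono geom2_f_tau_dvd geom2_tau_dvd assms)
  finally show "2 ^ m dvd section4 r (geom2 * (f oo tau)) $ j * (geom2 ^ Suc r * tau ^ j) $ m" .
qed

lemma refine_approx:
  assumes f: "\<And>j. 2 ^ (4 * j) dvd f $ j" and E: "coeffs_dvd (2 ^ 20) (f - poly_ser E)" and r: "r < 4" and m: "m < 15"
  shows "2 ^ 16 dvd refine r f $ m - refine_list r E ! m"
proof -
  define bs where "bs = map (\<lambda>i. geom2_tau_list E ! (r + 4 * i)) [0, 1, 2, 3]"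
  have "coeffs_dvd (2 ^ 16) (section4 r (geom2 * (f oo tau)) - poly_ser bs)"
    unfolding coeffs_dvd_def
  proof
    fix i
    have c: "2 ^ 16 dvd (geom2 * (f oo tau)) $ j - (geom2 * (poly_ser E oo tau)) $ j" for j
      using coeff_dvd[OF E, of geom2 tau j] by (rule dvd_trans[rotated]) simp
    show "2 ^ 16 dvd (section4 r (geom2 * (f oo tau)) - poly_ser bs) $ i"
    proof (cases "i < 4")
      case True
      have "poly_ser bs $ i = geom2_tau_list E ! (r + 4 * i)"
      proof -
        have "i = 0 \<or> i = 1 \<or> i = 2 \<or> i = 3" using True by linarith
        then show ?thesis by (elim disjE) (simp_all add: poly_ser_def bs_def)
      qed
      also have "\<dots> = (geom2 * (poly_ser E oo tau)) $ (r + 4 * i)" using True r by (intro geom2_tau_list) simp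
      finally show ?thesis using c[of "r + 4 * i"] by (simp add: section4_def)
    next
      case False
      then have "(2::int) ^ 16 dvd 2 ^ (r + 4 * i)" by (intro le_imp_power_dvd) simp
      also have "\<dots> dvd (geom2 * (f oo tau)) $ (r + 4 * i)" by (rule geom2_f_tau_dvd[OF f])
      finally show ?thesis using False by (simp add: section4_def poly_ser_def bs_def)
    qed
  qed
  then have "2 ^ 16 dvd refine r f $ m - (geom2 ^ Suc r * (poly_ser bs oo tau)) $ m"
    unfolding refine_def by (rule coeff_dvd)
  also have "(geom2 ^ Suc r * (poly_ser bs oo tau)) $ m = refine_list r E ! m"
  proof -
    have "coeff_list 15 (geom2 ^ Suc r * (poly_ser bs oo tau)) = refine_list r E"
      using horner_list[of 13 "geom2 ^ Suc r" bs] by (simp add: refine_list_def bs_def coeff_list_geom2_power del: power_Suc)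
    then show ?thesis using coeff_list_nth[OF m] by metis
  qed
  finally show ?thesis .
qed

text \<open>
The series obtained from \<open>E\<close> and from the second iterate are proportional, with ratio
\<open>b : a\<close>, modulo \<open>2^N\<close> at the indices \<open>ms\<close>.
\<close>

definition proportional :: "nat \<Rightarrow> int \<Rightarrow> int \<Rightarrow> nat \<Rightarrow> int list \<Rightarrow> nat list \<Rightarrow> bool" where
  "proportional N a b r E ms \<longleftrightarrow> (let x = refine_list r E; y = refine_list r contr_list2 in
     list_all (\<lambda>m. (a * x ! m - b * y ! m) mod 2 ^ N = 0) ms)"

abbreviation "even_indices \<equiv> [0, 2, 4, 6, 8, 10, 12, 14 :: nat]"
abbreviation "odd_indices \<equiv> [1, 3, 5, 7, 9, 11, 13 :: nat]"

text \<open>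
The pair \<open>(a, b)\<close> is forced, up to a common factor: it consists of the lowest
coefficients of the right parity in the two series. In the class of 2 modulo 8 the proportionality
fails modulo \<open>2^13\<close> at index 2 only.
\<close>

lemma checks0:
  "proportional 12 1031 (- 1) 1 [1] even_indices" "proportional 12 823189 (- 3) 1 [1] odd_indices"
  "proportional 12 48153 1 2 [1] even_indices" "proportional 13 48153 1 2 [1] [0, 4, 6, 8, 10, 12, 14]" "proportional 13 440189 5 2 [1] odd_indices"
  "proportional 12 618559 (- 1) 3 [1] even_indices" "proportional 12 595007 (- 1) 3 [1] odd_indices"
  by code_simp+

lemma checks1:
  "proportional 14 1031 7 1 contr_list1 even_indices" "proportional 14 823189 917 1 contr_list1 odd_indices"
  "proportional 15 48153 25 2 contr_list1 even_indices" "proportional 15 440189 2941 2 contr_list1 odd_indices"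
  "proportional 14 618559 63 3 contr_list1 even_indices" "proportional 14 595007 1087 3 contr_list1 odd_indices"
  by code_simp+

lemma refine_diff_dvd:
  assumes f: "\<And>j. 2 ^ (4 * j) dvd f $ j" "coeffs_dvd (2 ^ 20) (f - poly_ser E)" and r: "r < 4"
    and c: "proportional N a b r E ms" and N: "N \<le> 15" and m: "m < 15 \<longrightarrow> m \<in> set ms"
  shows "2 ^ N dvd (fps_const a * refine r f - fps_const b * refine r (contr_one 2)) $ m"
proof (cases "m < 15")
  case True
  have d0: "2 ^ N dvd a * refine_list r E ! m - b * refine_list r contr_list2 ! m"
    using c m True by (simp add: proportional_def Let_def list_all_iff dvd_eq_mod_eq_0)
  have "(2::int) ^ N dvd 2 ^ 16" using N by (intro le_imp_power_dvd) simp
  then have d1: "2 ^ N dvd refine r f $ m - refine_list r E ! m" and d2: "2 ^ N dvd refine r (contr_one 2) $ m - refine_list r contr_list2 ! m"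
    using refine_approx[OF f r True] refine_approx[OF contr_one_dvd contr_one_2_approx r True] dvd_trans by blast+
  have "2 ^ N dvd (a * (refine r f $ m - refine_list r E ! m) - b * (refine r (contr_one 2) $ m - refine_list r contr_list2 ! m)) +
    (a * refine_list r E ! m - b * refine_list r contr_list2 ! m)"
    by (rule dvd_add[OF dvd_diff[OF dvd_mult[OF d1] dvd_mult[OF d2]] d0])
  then show ?thesis by (simp add: algebra_simps)
next
  case False
  then have "(2::int) ^ N dvd 2 ^ m" using N by (intro le_imp_power_dvd) simp
  then have "2 ^ N dvd refine r f $ m" "2 ^ N dvd refine r (contr_one 2) $ m"
    using refine_high[OF f(1)] refine_high[OF contr_one_dvd] dvd_trans by blast+
  then show ?thesis by simp
qed

lemma combine_nth:
  assumes "[n = r] (mod 4)" "r < 4"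
  shows "(grade_ser r * ((fps_const a * refine r f - fps_const b * refine r (contr_one 2)) oo nu_ser)) $ n =
    a * (inv_phi * (f oo t_ser)) $ n - b * pb (16 * n)"
proof -
  have "pb (4 ^ 2 * n) = (inv_phi * (contr_one 2 oo t_ser)) $ n" by (rule overpartition_contr_one) simp
  then have p: "pb (16 * n) = (grade_ser r * (refine r (contr_one 2) oo nu_ser)) $ n" using inv_phi_component[OF assms] by simp
  have "grade_ser r * ((fps_const a * refine r f - fps_const b * refine r (contr_one 2)) oo nu_ser) =
    fps_const a * (grade_ser r * (refine r f oo nu_ser)) - fps_const b * (grade_ser r * (refine r (contr_one 2) oo nu_ser))"
    by (simp add: fps_compose_sub_distrib fps_compose_mult_distrib right_diff_distrib mult.left_commute)
  then show ?thesis unfolding p inv_phi_component[OF assms] by simp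
qed

text \<open>
Two series in \<open>nu_ser\<close> that are proportional at the exponents of one parity give
proportional coefficients on one residue class modulo 8.
\<close>

lemma compare:
  assumes f: "\<And>j. 2 ^ (4 * j) dvd f $ j" "coeffs_dvd (2 ^ 20) (f - poly_ser E)"
    and r: "r < 4" and n: "[n = r + 4 * p] (mod 8)"
    and c: "proportional N a b r E ms" and N: "N \<le> 15" and ms: "\<And>m. m < 15 \<Longrightarrow> even (m + p) \<Longrightarrow> m \<in> set ms"
  shows "2 ^ N dvd a * (inv_phi * (f oo t_ser)) $ n - b * pb (16 * n)"
proof -
  have "[n = r + 4 * p] (mod 4)" using n by (rule cong_dvd_modulus_nat) simp
  then have n4: "[n = r] (mod 4)" by (simp add: cong_def)
  have "2 ^ N dvd (grade_ser r * ((fps_const a * refine r f - fps_const b * refine r (contr_one 2)) oo nu_ser)) $ n"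
    by (rule class_mod_8_dvd[OF n]) (rule refine_diff_dvd[OF f r c N], use ms in blast)
  then show ?thesis unfolding combine_nth[OF n4 r] .
qed

lemma less_15: "(m :: nat) < 15 \<Longrightarrow> m = 0 \<or> m = 1 \<or> m = 2 \<or> m = 3 \<or> m = 4 \<or> m = 5 \<or> m = 6 \<or> m = 7 \<or> m = 8 \<or> m = 9 \<or> m = 10 \<or> m = 11 \<or> m = 12 \<or> m = 13 \<or> m = 14"
  by (simp add: less_Suc_eq numeral_eq_Suc)

lemma even_indices: "m < 15 \<Longrightarrow> even (m + 0) \<Longrightarrow> m \<in> set even_indices"
  by (drule less_15, elim disjE) simp_all

lemma odd_indices: "m < 15 \<Longrightarrow> even (m + 1) \<Longrightarrow> m \<in> set odd_indices"
  by (drule less_15, elim disjE) simp_all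

lemma contr_one_0_approx: "2 ^ (4 * j) dvd (1 :: int fps) $ j" "coeffs_dvd (2 ^ 20) (1 - poly_ser [1])"
proof -
  have "poly_ser [1] = 1" by (rule fps_ext) (simp add: poly_ser_def)
  then show "coeffs_dvd (2 ^ 20) (1 - poly_ser [1])" by (simp add: coeffs_dvd_def)
qed simp

lemma mod8_cases:
  assumes "odd n \<or> [n = 2] (mod 4)"
  obtains r p where "r \<in> {1, 2, 3}" "p \<in> {0, 1}" "[n = r + 4 * p] (mod (8 :: nat))" "odd n \<longleftrightarrow> r \<noteq> 2"
proof -
  define r where "r = n mod 4"
  define p where "p = n div 4 mod 2"
  have o: "odd n \<longleftrightarrow> r = 1 \<or> r = 3" unfolding r_def by presburger
  have "r = 2" if "[n = 2] (mod 4)" using that by (simp add: r_def cong_def)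
  then have r: "r \<in> {1, 2, 3}" "odd n \<longleftrightarrow> r \<noteq> 2" using assms o by auto
  have "p \<in> {0, 1}" unfolding p_def by auto
  moreover have "n mod 8 = r + 4 * p"
    unfolding r_def p_def using mod_mult2_eq[of n 4 2] by simp
  moreover then have "[n = r + 4 * p] (mod 8)" by (metis cong_def mod_mod_trivial)
  ultimately show ?thesis using r that by blast
qed

lemma compare_odd:
  assumes "odd n" shows "\<exists>a b. odd a \<and> 2 ^ 12 dvd a * pb n - b * pb (16 * n)"
proof -
  obtain r p where rp: "r \<in> {1, 2, 3}" "p \<in> {0, 1}" "[n = r + 4 * p] (mod 8)" "odd n \<longleftrightarrow> r \<noteq> 2"
    using mod8_cases assms by blast
  have "\<exists>a b. odd a \<and> 2 ^ 12 dvd a * (inv_phi * (1 oo t_ser)) $ n - b * pb (16 * n)"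
  proof -
    have "(r = 1 \<and> p = 0) \<or> (r = 1 \<and> p = 1) \<or> (r = 3 \<and> p = 0) \<or> (r = 3 \<and> p = 1)"
      using rp assms by auto
    then show ?thesis
    proof (elim disjE conjE)
      assume "r = 1" "p = 0"
      then have "2 ^ 12 dvd 1031 * (inv_phi * (1 oo t_ser)) $ n - (-1) * pb (16 * n)"
        using rp(3) by (intro compare[where p = 0, OF contr_one_0_approx _ _ checks0(1) _ even_indices]) simp_all
      then show ?thesis by (rule_tac x = 1031 in exI, rule_tac x = "-1" in exI) simp
    next
      assume "r = 1" "p = 1"
      then have "2 ^ 12 dvd 823189 * (inv_phi * (1 oo t_ser)) $ n - (-3) * pb (16 * n)"
        using rp(3) by (intro compare[where p = 1, OF contr_one_0_approx _ _ checks0(2) _ odd_indices]) simp_all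
      then show ?thesis by (rule_tac x = 823189 in exI, rule_tac x = "-3" in exI) simp
    next
      assume "r = 3" "p = 0"
      then have "2 ^ 12 dvd 618559 * (inv_phi * (1 oo t_ser)) $ n - (-1) * pb (16 * n)"
        using rp(3) by (intro compare[where p = 0, OF contr_one_0_approx _ _ checks0(6) _ even_indices]) simp_all
      then show ?thesis by (rule_tac x = 618559 in exI, rule_tac x = "-1" in exI) simp
    next
      assume "r = 3" "p = 1"
      then have "2 ^ 12 dvd 595007 * (inv_phi * (1 oo t_ser)) $ n - (-1) * pb (16 * n)"
        using rp(3) by (intro compare[where p = 1, OF contr_one_0_approx _ _ checks0(7) _ odd_indices]) simp_all
      then show ?thesis by (rule_tac x = 595007 in exI, rule_tac x = "-1" in exI) simp
    qed
  qed
  then obtain a b where "odd a" "2 ^ 12 dvd a * inv_phi $ n - b * pb (16 * n)" by auto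
  then have "odd (- a) \<and> 2 ^ 12 dvd (- a) * pb n - b * pb (16 * n)" using assms by (simp add: inv_phi_nth)
  then show ?thesis by blast
qed

lemma compare_4_odd:
  assumes "odd n" shows "\<exists>a b. odd a \<and> 2 ^ 14 dvd a * pb (4 * n) - b * pb (16 * n)"
proof -
  obtain r p where rp: "r \<in> {1, 2, 3}" "p \<in> {0, 1}" "[n = r + 4 * p] (mod 8)" "odd n \<longleftrightarrow> r \<noteq> 2"
    using mod8_cases assms by blast
  have pb4: "pb (4 * n) = (inv_phi * (contr_one 1 oo t_ser)) $ n" using overpartition_contr_one[of 1 n] by simp
  have "(r = 1 \<and> p = 0) \<or> (r = 1 \<and> p = 1) \<or> (r = 3 \<and> p = 0) \<or> (r = 3 \<and> p = 1)"
    using rp assms by auto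
  then show ?thesis
  proof (elim disjE conjE)
    assume "r = 1" "p = 0"
    then have "2 ^ 14 dvd 1031 * (inv_phi * (contr_one 1 oo t_ser)) $ n - (7) * pb (16 * n)"
      using rp(3) by (intro compare[where p = 0, OF contr_one_dvd contr_one_1_approx _ _ checks1(1) _ even_indices]) simp_all
    then show ?thesis unfolding pb4 by (rule_tac x = 1031 in exI, rule_tac x = "7" in exI) simp
  next
    assume "r = 1" "p = 1"
    then have "2 ^ 14 dvd 823189 * (inv_phi * (contr_one 1 oo t_ser)) $ n - (917) * pb (16 * n)"
      using rp(3) by (intro compare[where p = 1, OF contr_one_dvd contr_one_1_approx _ _ checks1(2) _ odd_indices]) simp_all
    then show ?thesis unfolding pb4 by (rule_tac x = 823189 in exI, rule_tac x = "917" in exI) simp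
  next
    assume "r = 3" "p = 0"
    then have "2 ^ 14 dvd 618559 * (inv_phi * (contr_one 1 oo t_ser)) $ n - (63) * pb (16 * n)"
      using rp(3) by (intro compare[where p = 0, OF contr_one_dvd contr_one_1_approx _ _ checks1(5) _ even_indices]) simp_all
    then show ?thesis unfolding pb4 by (rule_tac x = 618559 in exI, rule_tac x = "63" in exI) simp
  next
    assume "r = 3" "p = 1"
    then have "2 ^ 14 dvd 595007 * (inv_phi * (contr_one 1 oo t_ser)) $ n - (1087) * pb (16 * n)"
      using rp(3) by (intro compare[where p = 1, OF contr_one_dvd contr_one_1_approx _ _ checks1(6) _ odd_indices]) simp_all
    then show ?thesis unfolding pb4 by (rule_tac x = 595007 in exI, rule_tac x = "1087" in exI) simp
  qed
qed

lemma compare_4_twice_odd: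
  assumes "[n = 2] (mod 4)" shows "\<exists>a b. odd a \<and> 2 ^ 15 dvd a * pb (4 * n) - b * pb (16 * n)"
proof -
  obtain r p where rp: "r \<in> {1, 2, 3}" "p \<in> {0, 1}" "[n = r + 4 * p] (mod 8)" "odd n \<longleftrightarrow> r \<noteq> 2"
    using mod8_cases assms by blast
  have pb4: "pb (4 * n) = (inv_phi * (contr_one 1 oo t_ser)) $ n" using overpartition_contr_one[of 1 n] by simp
  have "even n" using cong_dvd_iff[OF cong_dvd_modulus_nat[OF assms, of 2]] by simp
  then have "(r = 2 \<and> p = 0) \<or> (r = 2 \<and> p = 1)" using rp by auto
  then show ?thesis
  proof (elim disjE conjE)
    assume "r = 2" "p = 0"
    then have "2 ^ 15 dvd 48153 * (inv_phi * (contr_one 1 oo t_ser)) $ n - (25) * pb (16 * n)"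
      using rp(3) by (intro compare[where p = 0, OF contr_one_dvd contr_one_1_approx _ _ checks1(3) _ even_indices]) simp_all
    then show ?thesis unfolding pb4 by (rule_tac x = 48153 in exI, rule_tac x = "25" in exI) simp
  next
    assume "r = 2" "p = 1"
    then have "2 ^ 15 dvd 440189 * (inv_phi * (contr_one 1 oo t_ser)) $ n - (2941) * pb (16 * n)"
      using rp(3) by (intro compare[where p = 1, OF contr_one_dvd contr_one_1_approx _ _ checks1(4) _ odd_indices]) simp_all
    then show ?thesis unfolding pb4 by (rule_tac x = 440189 in exI, rule_tac x = "2941" in exI) simp
  qed
qed

text \<open>
Frobenius modulo 2.
\<close>

lemma cong2_square: "cong2_ser (f ^ 2) (dilate 2 f)"
  unfolding cong2_ser_def coeffs_dvd_def
proof
  fix n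
  have sw: "(\<Sum>i\<in>{0..n} - {i. 2 * i = n}. f $ i * f $ (n - i)) = 2 * (\<Sum>i | 2 * i < n. f $ i * f $ (n - i))"
  proof -
    have "{0..n} - {i. 2 * i = n} = {i. 2 * i < n} \<union> {i \<in> {0..n}. n < 2 * i}" by auto
    moreover have "finite {i. 2 * i < n}" by (rule finite_subset[of _ "{0..n}"]) auto
    moreover have "{i. 2 * i < n} \<inter> {i \<in> {0..n}. n < 2 * i} = {}" by auto
    moreover have "(\<Sum>i | i \<in> {0..n} \<and> n < 2 * i. f $ i * f $ (n - i)) = (\<Sum>i | 2 * i < n. f $ i * f $ (n - i))"
      by (rule sum.reindex_bij_witness[of _ "\<lambda>i. n - i" "\<lambda>i. n - i"]) (auto simp: mult.commute)
    ultimately show ?thesis by (simp add: sum.union_disjoint)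
  qed
  have "(f ^ 2) $ n = (\<Sum>i\<in>{0..n} \<inter> {i. 2 * i = n}. f $ i * f $ (n - i)) +
      (\<Sum>i\<in>{0..n} - {i. 2 * i = n}. f $ i * f $ (n - i))"
    unfolding power2_eq_square fps_mult_nth by (subst sum.Int_Diff[of _ _ "{i. 2 * i = n}"]) simp_all
  also have "(\<Sum>i\<in>{0..n} \<inter> {i. 2 * i = n}. f $ i * f $ (n - i)) = (dilate 2 f $ n) ^ 2"
  proof (cases "even n")
    case True
    then obtain k where k: "n = 2 * k" by (rule evenE)
    have "{0..n} \<inter> {i. 2 * i = n} = {k}" using k by auto
    then show ?thesis using k by (simp add: dil_nth power2_eq_square)
  next
    case False
    then have "{0..n} \<inter> {i. 2 * i = n} = {}" by auto
    then show ?thesis using False by (simp add: dil_nth)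
  qed
  finally have contr_one: "(f ^ 2 - dilate 2 f) $ n = (dilate 2 f $ n) ^ 2 - dilate 2 f $ n + 2 * (\<Sum>i | 2 * i < n. f $ i * f $ (n - i))"
    unfolding sw by simp
  show "2 dvd (f ^ 2 - dilate 2 f) $ n" unfolding contr_one by simp
qed

text \<open>
On the class of 2 modulo 8 the comparison is obstructed modulo \<open>2^13\<close> by the single
term \<open>2^12 * nu_ser^2\<close>. Modulo 2 its contribution is the number of representations of
\<open>n\<close> by \<open>2 x^2 + 8 y^2\<close> with odd \<open>x\<close> and \<open>y\<close>, so
it vanishes by assumption.
\<close>

lemma compare_twice_odd:
  assumes n: "[n = 2] (mod 4)" and ns: "\<And>x y. n \<noteq> 2 * (x\<^sup>2 + (2 * y)\<^sup>2)"
  shows "\<exists>a b. odd a \<and> 2 ^ 13 dvd a * pb n - b * pb (16 * n)"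
proof -
  obtain r p where rp: "r \<in> {1, 2, 3}" "p \<in> {0, 1}" "[n = r + 4 * p] (mod 8)" "odd n \<longleftrightarrow> r \<noteq> 2"
    using mod8_cases n by blast
  have ev: "even n" using cong_dvd_iff[OF cong_dvd_modulus_nat[OF n, of 2]] by simp
  then have "(r = 2 \<and> p = 0) \<or> (r = 2 \<and> p = 1)" using rp by auto
  then have "\<exists>a b. odd a \<and> 2 ^ 13 dvd a * (inv_phi * (1 oo t_ser)) $ n - b * pb (16 * n)"
  proof (elim disjE conjE)
    assume "r = 2" "p = 1"
    then have "2 ^ 13 dvd 440189 * (inv_phi * (1 oo t_ser)) $ n - (5) * pb (16 * n)"
      using rp(3) by (intro compare[where p = 1, OF contr_one_0_approx _ _ checks0(5) _ odd_indices]) simp_all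
    then show ?thesis by (rule_tac x = 440189 in exI, rule_tac x = "5" in exI) simp
  next
    assume r: "r = 2" "p = 0"
    define h where "h = fps_const 48153 * refine 2 1 - fps_const 1 * refine 2 (contr_one 2)"
    have "2 ^ 12 dvd h $ 2"
      unfolding h_def by (rule refine_diff_dvd[OF contr_one_0_approx _ checks0(3)]) simp_all
    then obtain c where c: "h $ 2 = 2 ^ 12 * c" by blast
    have "2 ^ 13 dvd (h - fps_const (2 ^ 12 * c) * fps_X ^ 2) $ m" if "even (m + 0)" for m
    proof (cases "m = 2")
      case True then show ?thesis using c by simp
    next
      case False
      have "m < 15 \<longrightarrow> m \<in> set [0, 4, 6, 8, 10, 12, 14]" using that False even_indices[of m] by auto
      then have "2 ^ 13 dvd h $ m"
        unfolding h_def by (intro refine_diff_dvd[OF contr_one_0_approx _ checks0(4)]) simp_all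
      then show ?thesis using False by (simp add: fps_X_power_nth)
    qed
    then have "2 ^ 13 dvd (grade_ser 2 * ((h - fps_const (2 ^ 12 * c) * fps_X ^ 2) oo nu_ser)) $ n"
      by (rule class_mod_8_dvd[OF rp(3)[unfolded r]])
    also have "(grade_ser 2 * ((h - fps_const (2 ^ 12 * c) * fps_X ^ 2) oo nu_ser)) $ n =
      (grade_ser 2 * (h oo nu_ser)) $ n - 2 ^ 12 * c * (grade_ser 2 * nu_ser ^ 2) $ n"
      by (simp add: fps_compose_sub_distrib fps_compose_mult_distrib X_power_compose right_diff_distrib mult.left_commute[of "grade_ser 2"])
    finally have 1: "2 ^ 13 dvd (grade_ser 2 * (h oo nu_ser)) $ n - 2 ^ 12 * c * (grade_ser 2 * nu_ser ^ 2) $ n" .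
    have "even ((grade_ser 2 * nu_ser ^ 2) $ n)"
    proof -
      have "cong2_ser (osq ^ 2 * dilate 16 inv_phi ^ Suc 2 * dilate 4 w_ser ^ 2) (dilate 2 osq * dilate 16 1 ^ Suc 2 * dilate 2 (dilate 4 osq))"
        by (intro cong2_mult cong2_power cong2_dil cong2_inv_phi cong2_square cong2_trans[OF cong2_square] cong2_w_ser) simp_all
      also have "dilate 2 osq * dilate 16 1 ^ Suc 2 * dilate 2 (dilate 4 osq) = dilate 2 (osq * dilate 4 osq)"
        by (simp add: dil_mult)
      finally have "cong2_ser (grade_ser 2 * nu_ser ^ 2) (dilate 2 (osq * dilate 4 osq))" by (simp only: grade_ser_def nu_ser_def)
      moreover have "dilate 2 (osq * dilate 4 osq) $ n = 0"
      proof (rule ccontr)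
        assume "dilate 2 (osq * dilate 4 osq) $ n \<noteq> 0"
        then have "(osq * dilate 4 osq) $ (n div 2) \<noteq> 0" by (simp add: dil_nth split: if_splits)
        then have "\<exists>k\<in>{0..n div 2}. osq $ k * dilate 4 osq $ (n div 2 - k) \<noteq> 0"
          unfolding fps_mult_nth using sum.not_neutral_contains_not_neutral by blast
        then obtain k where k: "k \<le> n div 2" "osq $ k \<noteq> 0" "dilate 4 osq $ (n div 2 - k) \<noteq> 0" by auto
        obtain x where "k = x\<^sup>2" using k(2) by (auto simp: osq_def split: if_splits)
        moreover obtain y where "(n div 2 - k) div 4 = y\<^sup>2" "4 dvd n div 2 - k"
          using k(3) by (auto simp: dil_nth osq_def split: if_splits)
        then have "n div 2 - k = 4 * y\<^sup>2" by auto
        ultimately have "n div 2 = x\<^sup>2 + (2 * y)\<^sup>2" using k(1) by (simp add: power_mult_distrib)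
        then have "2 * (n div 2) = 2 * (x\<^sup>2 + (2 * y)\<^sup>2)" by (simp only:)
        then show False using ns[of x y] ev by (simp only: dvd_mult_div_cancel)
      qed
      ultimately show ?thesis using cong2_nth by fastforce
    qed
    then have "2 ^ 13 dvd 2 ^ 12 * c * (grade_ser 2 * nu_ser ^ 2) $ n" by (auto elim!: evenE)
    with 1 have "2 ^ 13 dvd (grade_ser 2 * (h oo nu_ser)) $ n" by (simp add: dvd_diff_left_iff)
    then have "2 ^ 13 dvd 48153 * (inv_phi * (1 oo t_ser)) $ n - 1 * pb (16 * n)"
      unfolding h_def by (subst (asm) combine_nth[OF n]) simp_all
    then show ?thesis by (rule_tac x = 48153 in exI, rule_tac x = 1 in exI) simp
  qed
  then obtain a b where "odd a" "2 ^ 13 dvd a * inv_phi $ n - b * pb (16 * n)" by auto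
  then show ?thesis using ev by (auto simp: inv_phi_nth)
qed

section \<open>Lambert series from an elliptic differential equation\<close>

text \<open>
Series in \<open>q\<close> whose coefficients are power series in \<open>z\<close>. The variable
\<open>q\<close> stands for \<open>exp (-T)\<close>, so that the shift of \<open>z\<close> by
\<open>n T\<close> multiplies \<open>exp (-z)\<close> by \<open>q^n\<close>.
\<close>

type_synonym bser = "rat fps fps"

definition chi :: "nat \<Rightarrow> int" where
  "chi d = (if even d then 0 else if d mod 4 = 1 then 1 else - 1)"

lemma chi_0 [simp]: "chi 0 = 0" by (simp add: chi_def)
lemma chi_1 [simp]: "chi (Suc 0) = 1" by (simp add: chi_def)
lemma chi_add2 [simp]: "chi (Suc (Suc n)) = - chi n"
proof -
  have "odd n \<Longrightarrow> (Suc (Suc n) mod 4 = 1) = (n mod 4 \<noteq> 1)" by presburger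
  then show ?thesis by (auto simp: chi_def)
qed

definition exp_plus :: "rat fps" where "exp_plus = fps_exp 1"
definition exp_minus :: "rat fps" where "exp_minus = fps_exp (- 1)"

lemma exp_plus_minus: "exp_plus * exp_minus = 1"
  by (simp add: exp_plus_def exp_minus_def flip: fps_exp_add_mult)

text \<open>
The expansion of \<open>2 x / (1 + x^2)\<close> at \<open>x = v q^n\<close>.
\<close>

definition sech_exp :: "rat fps \<Rightarrow> nat \<Rightarrow> bser" where
  "sech_exp v n = Abs_fps (\<lambda>N. if n dvd N then fps_const (2 * of_int (chi (N div n))) * v ^ (N div n) else 0)"

text \<open>
The series of \<open>sech (z + n T)\<close>. For negative \<open>n\<close> it is expanded in
\<open>exp (z + n T)\<close>, as only nonnegative powers of \<open>q\<close> may occur;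
\<open>exp_at\<close>, \<open>side\<close> and \<open>tanh_at\<close> follow the same convention.
\<close>

definition sech_at :: "int \<Rightarrow> bser" where
  "sech_at n = (if n = 0 then fps_const (2 * exp_minus * inverse (1 + exp_minus ^ 2)) else if n > 0 then sech_exp exp_minus (nat n) else sech_exp exp_plus (nat (- n)))"

definition exp_at :: "int \<Rightarrow> bser" where
  "exp_at n = (if n \<ge> 0 then fps_const exp_minus * fps_X ^ nat n else fps_const exp_plus * fps_X ^ nat (- n))"

definition side :: "int \<Rightarrow> bser" where "side n = (if n \<ge> 0 then 1 else - 1)"

definition tanh_at :: "int \<Rightarrow> bser" where "tanh_at n = side n * (1 - exp_at n * sech_at n)"

lemma sech_exp_rel: assumes "n > 0" shows "sech_exp v n * (1 + (fps_const v * fps_X ^ n) ^ 2) = 2 * (fps_const v * fps_X ^ n)"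
proof (rule fps_ext)
  fix N
  have e: "sech_exp v n * (1 + (fps_const v * fps_X ^ n) ^ 2) = sech_exp v n + fps_const (v ^ 2) * (fps_X ^ (2 * n) * sech_exp v n)"
    by (simp add: power_mult_distrib distrib_left mult.commute[of n] flip: power_mult fps_const_power)
  have l: "(sech_exp v n * (1 + (fps_const v * fps_X ^ n) ^ 2)) $ N = sech_exp v n $ N + v ^ 2 * (if N < 2 * n then 0 else sech_exp v n $ (N - 2 * n))"
    unfolding e by (simp add: fps_X_power_mult_nth)
  have r: "(2 * (fps_const v * fps_X ^ n)) $ N = (if N = n then 2 * v else 0)"
    by (simp add: num_mult_nth)
  show "(sech_exp v n * (1 + (fps_const v * fps_X ^ n) ^ 2)) $ N = (2 * (fps_const v * fps_X ^ n)) $ N"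
    unfolding l r
  proof (cases "n dvd N")
    case False
    have "\<not> n dvd N - 2 * n" if "\<not> N < 2 * n"
    proof
      assume "n dvd N - 2 * n"
      then have "n dvd N" by (rule dvd_diffD) (use that in simp_all)
      then show False using False by simp
    qed
    then show "sech_exp v n $ N + v ^ 2 * (if N < 2 * n then 0 else sech_exp v n $ (N - 2 * n)) = (if N = n then 2 * v else 0)"
      using False by (auto simp: sech_exp_def)
  next
    case True
    then obtain j where j: "N = n * j" by blast
    have sj: "sech_exp v n $ (n * i) = fps_const (2 * of_int (chi i)) * v ^ i" for i
      using assms by (simp add: sech_exp_def)
    consider "j = 0" | "j = 1" | i where "j = Suc (Suc i)" by (metis not0_implies_Suc One_nat_def)
    then show "sech_exp v n $ N + v ^ 2 * (if N < 2 * n then 0 else sech_exp v n $ (N - 2 * n)) = (if N = n then 2 * v else 0)"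
    proof cases
      case 1 then show ?thesis using j assms sj[of 0] by simp
    next
      case 2 then show ?thesis using j assms sj[of 1] by (simp add: numeral_fps_const)
    next
      case 3
      have "N - 2 * n = n * i" "\<not> N < 2 * n" "N \<noteq> n" using 3 j assms by (simp_all add: algebra_simps)
      moreover have "sech_exp v n $ N = - (v ^ 2 * (fps_const (2 * of_int (chi i)) * v ^ i))"
        unfolding j sj 3 by (simp add: power2_eq_square ac_simps flip: fps_const_neg)
      ultimately show ?thesis by (simp add: sj)
    qed
  qed
qed

lemma sech_at_rel: "sech_at n * (1 + exp_at n ^ 2) = 2 * exp_at n"
proof -
  have nz: "(1 + exp_minus ^ 2) $ 0 \<noteq> 0" by (simp add: exp_minus_def power2_eq_square)
  have "(1 + fps_const exp_minus ^ 2 :: bser) = fps_const (1 + exp_minus ^ 2)" by (simp flip: fps_const_power fps_const_add)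
  then have "fps_const (2 * exp_minus * inverse (1 + exp_minus ^ 2)) * (1 + fps_const exp_minus ^ 2) =
    fps_const (2 * exp_minus * inverse (1 + exp_minus ^ 2)) * fps_const (1 + exp_minus ^ 2)" by (simp only:)
  also have "\<dots> = fps_const (2 * exp_minus * (inverse (1 + exp_minus ^ 2) * (1 + exp_minus ^ 2)))"
    by (simp only: fps_const_mult mult.assoc)
  also have "inverse (1 + exp_minus ^ 2) * (1 + exp_minus ^ 2) = 1" by (rule inverse_mult_eq_1[OF nz])
  finally have "sech_at 0 * (1 + exp_at 0 ^ 2) = 2 * exp_at 0" by (simp add: sech_at_def exp_at_def numeral_fps_const)
  then show ?thesis
    using sech_exp_rel[of "nat n" exp_minus] sech_exp_rel[of "nat (- n)" exp_plus] by (auto simp: sech_at_def exp_at_def)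
qed

lemma exp_at_nz: "1 + exp_at n ^ 2 \<noteq> 0"
proof
  assume "1 + exp_at n ^ 2 = 0"
  then have "(1 + exp_at n ^ 2) $ 0 $ 0 = 0" by simp
  moreover have "(1 + exp_at n ^ 2) $ 0 $ 0 \<noteq> 0"
    by (cases "n = 0") (auto simp: exp_at_def exp_minus_def exp_plus_def fps_power_zeroth power_0_left)
  ultimately show False by simp
qed

text \<open>
The three addition formulas needed, with \<open>u = exp (-a)\<close> and \<open>v = exp (-b)\<close>
or their inverses; \<open>c\<close> and \<open>ct\<close> are the values of \<open>csch\<close> and
\<open>coth\<close> at the difference. After clearing denominators they are polynomial identities,
one for each choice of signs.
\<close>

lemma hyperbolic_identities:
  fixes s r u v Q c ct e e' :: "'a :: idom"
  assumes s: "s * (1 + u ^ 2) = 2 * u" and r: "r * (1 + v ^ 2) = 2 * v"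
    and c: "c * (1 - Q ^ 2) = 2 * Q" and ct: "ct * (1 - Q ^ 2) = 1 + Q ^ 2"
    and nz: "1 + u ^ 2 \<noteq> 0" "1 + v ^ 2 \<noteq> 0" "1 - Q ^ 2 \<noteq> 0"
    and cs: "(e = 1 \<and> e' = 1 \<and> u = v * Q) \<or> (e = 1 \<and> e' = - 1 \<and> u * v = Q) \<or> (e = - 1 \<and> e' = - 1 \<and> v = u * Q)"
  shows "s * r = c * (e * (1 - u * s) - e' * (1 - v * r))"
    and "s * (e' * (1 - v * r)) = c * r - ct * s"
    and "r * (e * (1 - u * s)) = ct * r - c * s"
proof -
  define a where "a = 1 + u ^ 2"
  define b where "b = 1 + v ^ 2"
  define q where "q = 1 - Q ^ 2"
  have sa: "s * a = 2 * u" and rb: "r * b = 2 * v" and cq: "c * q = 2 * Q" and ctq: "ct * q = 1 + Q ^ 2"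
    using s r c ct by (simp_all add: a_def b_def q_def)
  have ta: "(1 - u * s) * a = 1 - u ^ 2"
  proof -
    have "(1 - u * s) * a = a - u * (s * a)" by (simp add: left_diff_distrib)
    then show ?thesis unfolding sa by (simp add: a_def power2_eq_square)
  qed
  have tb: "(1 - v * r) * b = 1 - v ^ 2"
  proof -
    have "(1 - v * r) * b = b - v * (r * b)" by (simp add: left_diff_distrib)
    then show ?thesis unfolding rb by (simp add: b_def power2_eq_square)
  qed
  have D: "a * b * q \<noteq> 0" using nz by (simp add: a_def b_def q_def)
  have "a * b * q * (s * r) = (s * a) * (r * b) * q" by (simp only: ac_simps)
  also have "\<dots> = 4 * u * v * q" unfolding sa rb by simp
  also have "\<dots> = 2 * Q * (e * (1 - u ^ 2) * b - e' * (1 - v ^ 2) * a)"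
    using cs unfolding a_def b_def q_def
    by (elim disjE conjE) (auto simp: power2_eq_square algebra_simps)
  also have "\<dots> = (c * q) * (e * ((1 - u * s) * a) * b - e' * ((1 - v * r) * b) * a)"
    unfolding ta tb cq ..
  also have "\<dots> = a * b * q * (c * (e * (1 - u * s) - e' * (1 - v * r)))"
    by (simp only: right_diff_distrib ac_simps)
  finally show "s * r = c * (e * (1 - u * s) - e' * (1 - v * r))" using D by simp
  have "a * b * q * (s * (e' * (1 - v * r))) = (s * a) * (e' * ((1 - v * r) * b)) * q" by (simp only: ac_simps)
  also have "\<dots> = 2 * u * (e' * (1 - v ^ 2)) * q" unfolding sa tb ..
  also have "\<dots> = 2 * Q * (2 * v) * a - (1 + Q ^ 2) * (2 * u) * b"
    using cs unfolding a_def b_def q_def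
    by (elim disjE conjE) (auto simp: power2_eq_square algebra_simps)
  also have "\<dots> = (c * q) * (r * b) * a - (ct * q) * (s * a) * b" unfolding sa rb cq ctq ..
  also have "\<dots> = a * b * q * (c * r - ct * s)" by (simp only: right_diff_distrib ac_simps)
  finally show "s * (e' * (1 - v * r)) = c * r - ct * s" using D by simp
  have "a * b * q * (r * (e * (1 - u * s))) = (r * b) * (e * ((1 - u * s) * a)) * q" by (simp only: ac_simps)
  also have "\<dots> = 2 * v * (e * (1 - u ^ 2)) * q" unfolding rb ta ..
  also have "\<dots> = (1 + Q ^ 2) * (2 * v) * a - 2 * Q * (2 * u) * b"
    using cs unfolding a_def b_def q_def
    by (elim disjE conjE) (auto simp: power2_eq_square algebra_simps)
  also have "\<dots> = (ct * q) * (r * b) * a - (c * q) * (s * a) * b" unfolding sa rb cq ctq ..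
  also have "\<dots> = a * b * q * (ct * r - c * s)" by (simp only: right_diff_distrib ac_simps)
  finally show "r * (e * (1 - u * s)) = ct * r - c * s" using D by simp
qed

definition csch_ser :: "int fps" where "csch_ser = Abs_fps (\<lambda>n. if odd n then 2 else 0)"
definition coth_ser :: "int fps" where "coth_ser = Abs_fps (\<lambda>n. if n = 0 then 1 else if even n then 2 else 0)"

lemma csch_ser: "csch_ser * (1 - fps_X ^ 2) = 2 * fps_X"
proof (rule fps_ext)
  fix n
  have "csch_ser * (1 - fps_X ^ 2) = csch_ser - fps_X ^ 2 * csch_ser" by (simp add: right_diff_distrib mult.commute)
  then have e: "(csch_ser * (1 - fps_X ^ 2)) $ n = csch_ser $ n - (if n < 2 then 0 else csch_ser $ (n - 2))"
    by (simp add: fps_X_power_mult_nth)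
  consider "n = 0" | "n = 1" | m where "n = Suc (Suc m)" by (metis not0_implies_Suc One_nat_def)
  then show "(csch_ser * (1 - fps_X ^ 2)) $ n = (2 * fps_X) $ n"
    unfolding e by cases (simp_all add: num_mult_nth numeral_fps_const csch_ser_def fps_X_power_nth)
qed

lemma coth_ser: "coth_ser * (1 - fps_X ^ 2) = 1 + fps_X ^ 2"
proof (rule fps_ext)
  fix n
  have "coth_ser * (1 - fps_X ^ 2) = coth_ser - fps_X ^ 2 * coth_ser" by (simp add: right_diff_distrib mult.commute)
  then have e: "(coth_ser * (1 - fps_X ^ 2)) $ n = coth_ser $ n - (if n < 2 then 0 else coth_ser $ (n - 2))"
    by (simp add: fps_X_power_mult_nth)
  consider "n = 0" | "n = 1" | m where "n = Suc (Suc m)" by (metis not0_implies_Suc One_nat_def)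
  then show "(coth_ser * (1 - fps_X ^ 2)) $ n = (1 + fps_X ^ 2) $ n"
    unfolding e by cases (simp_all add: num_mult_nth coth_ser_def fps_X_power_nth)
qed

definition map_coeffs :: "('a \<Rightarrow> 'b) \<Rightarrow> 'a fps \<Rightarrow> 'b fps" where "map_coeffs h f = Abs_fps (\<lambda>n. h (f $ n))"

lemma map_coeffs_nth [simp]: "map_coeffs h f $ n = h (f $ n)" by (simp add: map_coeffs_def)

text \<open>
Coefficientwise application of a ring homomorphism is a ring homomorphism on power series. It is
used for evaluation at \<open>z = 0\<close> and for the two embeddings of the integral power series
in \<open>q\<close>.
\<close>

locale ring_map =
  fixes h :: "'a :: idom \<Rightarrow> 'b :: idom"
  assumes h_add: "h (a + b) = h a + h b" and h_mult: "h (a * b) = h a * h b" and h_1: "h 1 = 1"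
begin

lemma h_0: "h 0 = 0"
proof -
  have "h 0 = h 0 + h 0" using h_add[of 0 0] by (simp only: add_0_left)
  then show ?thesis by (metis add_cancel_left_right)
qed
lemma h_uminus: "h (- a) = - h a" using h_add[of a "- a"] by (simp add: h_0 eq_neg_iff_add_eq_0 add.commute)
lemma h_sum: "h (sum f S) = (\<Sum>i\<in>S. h (f i))"
  by (induction S rule: infinite_finite_induct) (simp_all add: h_0 h_add)

lemma map_add: "map_coeffs h (f + g) = map_coeffs h f + map_coeffs h g"
  by (rule fps_ext) (simp add: h_add)
lemma map_uminus: "map_coeffs h (- f) = - map_coeffs h f"
  by (rule fps_ext) (simp add: h_uminus)
lemma map_diff: "map_coeffs h (f - g) = map_coeffs h f - map_coeffs h g"
  using map_add[of f "- g"] by (simp add: map_uminus)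
lemma map_mult: "map_coeffs h (f * g) = map_coeffs h f * map_coeffs h g"
  by (rule fps_ext) (simp add: fps_mult_nth h_sum h_mult)
lemma map_1: "map_coeffs h 1 = 1"
  by (rule fps_ext) (simp add: h_0 h_1)
lemma map_0: "map_coeffs h 0 = 0"
  by (rule fps_ext) (simp add: h_0)
lemma map_power: "map_coeffs h (f ^ k) = map_coeffs h f ^ k"
  by (induction k) (simp_all add: map_1 map_mult)
lemma map_of_nat: "map_coeffs h (of_nat k) = of_nat k"
  by (induction k) (simp_all add: map_0 map_1 map_add)
lemma map_of_int: "map_coeffs h (of_int k) = of_int k"
  by (cases k rule: int_diff_cases) (simp add: map_diff map_of_nat)
lemma map_numeral: "map_coeffs h (numeral k) = numeral k"
  using map_of_nat[of "numeral k"] by simp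
lemma map_sum: "map_coeffs h (sum f S) = (\<Sum>i\<in>S. map_coeffs h (f i))"
  by (induction S rule: infinite_finite_induct) (simp_all add: map_0 map_add)
lemma map_X: "map_coeffs h fps_X = fps_X"
  by (rule fps_ext) (simp add: fps_X_nth h_0 h_1)

end

definition lift_q :: "int fps \<Rightarrow> bser" where "lift_q = map_coeffs (\<lambda>a. fps_const (of_int a))"
definition at0 :: "bser \<Rightarrow> rat fps" where "at0 = map_coeffs (\<lambda>f. f $ 0)"
definition embed_rat :: "int fps \<Rightarrow> rat fps" where "embed_rat = map_coeffs of_int"

text \<open>
The derivative with respect to \<open>z\<close>.
\<close>

definition dz :: "bser \<Rightarrow> bser" where "dz = map_coeffs fps_deriv"

interpretation lift_q: ring_map "\<lambda>a. fps_const (of_int a) :: rat fps"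
  by unfold_locales simp_all
interpretation at0: ring_map "\<lambda>f :: rat fps. f $ 0"
  by unfold_locales simp_all
interpretation embed_rat: ring_map "of_int :: int \<Rightarrow> rat"
  by unfold_locales simp_all

lemma at0_lift_q: "at0 (lift_q f) = embed_rat f"
  by (rule fps_ext) (simp add: at0_def lift_q_def embed_rat_def)

lemma embed_rat_inj: "embed_rat f = embed_rat g \<Longrightarrow> f = g"
  by (simp add: embed_rat_def fps_eq_iff)

lemma dz_add: "dz (f + g) = dz f + dz g"
  by (rule fps_ext) (simp add: dz_def)
lemma dz_mult: "dz (f * g) = f * dz g + dz f * g"
proof (rule fps_ext)
  fix n
  have "fps_deriv (\<Sum>i=0..n. f $ i * g $ (n - i)) = (\<Sum>i=0..n. fps_deriv (f $ i * g $ (n - i)))"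
    by (rule fps_deriv_sum)
  then show "dz (f * g) $ n = (f * dz g + dz f * g) $ n"
    by (simp add: dz_def fps_mult_nth sum.distrib)
qed
lemma dz_lift_q: "dz (lift_q f) = 0"
  by (rule fps_ext) (simp add: dz_def lift_q_def)
lemma dz_numeral: "dz (numeral k) = 0"
proof -
  have "lift_q (numeral k) = numeral k" by (simp add: lift_q_def lift_q.map_numeral)
  then show ?thesis using dz_lift_q[of "numeral k"] by simp
qed
lemma dz_1: "dz 1 = 0"
proof -
  have "lift_q 1 = 1" by (simp add: lift_q_def lift_q.map_1)
  then show ?thesis using dz_lift_q[of 1] by simp
qed
lemma dz_uminus: "dz (- f) = - dz f"
  by (rule fps_ext) (simp add: dz_def)
lemma dz_diff: "dz (f - g) = dz f - dz g"
  using dz_add[of f "- g"] by (simp add: dz_uminus)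
lemma dz_0: "dz 0 = 0"
  by (rule fps_ext) (simp add: dz_def)
lemma dz_sum: "dz (sum f S) = (\<Sum>i\<in>S. dz (f i))"
  by (induction S rule: infinite_finite_induct) (simp_all add: dz_add dz_0)

lemma dz_exp_at: "dz (exp_at n) = - side n * exp_at n"
proof -
  have "dz (fps_const a * fps_X ^ k) = fps_const (fps_deriv a) * fps_X ^ k" for a k
    by (rule fps_ext) (simp add: dz_def fps_X_power_nth)
  then show ?thesis by (simp add: exp_at_def side_def exp_minus_def exp_plus_def flip: fps_const_neg)
qed

lemma side_sq: "side n * side n = 1" by (simp add: side_def)
lemma dz_side: "dz (side n) = 0" by (simp add: side_def dz_uminus dz_1)

lemma sech_at_sq: "sech_at n ^ 2 + exp_at n ^ 2 * sech_at n ^ 2 = 2 * exp_at n * sech_at n"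
proof -
  have "sech_at n ^ 2 + exp_at n ^ 2 * sech_at n ^ 2 = sech_at n * (sech_at n * (1 + exp_at n ^ 2))" by (simp add: power2_eq_square algebra_simps)
  then show ?thesis unfolding sech_at_rel by simp
qed

lemma tanh_at_sq: "tanh_at n ^ 2 = 1 - sech_at n ^ 2"
proof -
  have "tanh_at n ^ 2 = (side n * side n) * (1 - exp_at n * sech_at n) ^ 2" by (simp add: tanh_at_def power2_eq_square ac_simps)
  also have "\<dots> = 1 - 2 * exp_at n * sech_at n + exp_at n ^ 2 * sech_at n ^ 2" unfolding side_sq by (simp add: power2_eq_square algebra_simps)
  also have "\<dots> = 1 - sech_at n ^ 2" unfolding sech_at_sq[symmetric] by simp
  finally show ?thesis .
qed

lemma dz_sech_at: "dz (sech_at n) = - sech_at n * tanh_at n"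
proof -
  have "dz (sech_at n * (1 + exp_at n ^ 2)) = dz (2 * exp_at n)" by (simp only: sech_at_rel)
  then have "sech_at n * (2 * (exp_at n * dz (exp_at n))) + dz (sech_at n) * (1 + exp_at n ^ 2) = 2 * dz (exp_at n)"
    by (simp add: dz_mult dz_add dz_1 dz_numeral power2_eq_square mult.commute)
  then have "dz (sech_at n) * (1 + exp_at n ^ 2) = - (2 * exp_at n) * (side n * (1 - exp_at n * sech_at n))"
    unfolding dz_exp_at by (simp add: algebra_simps)
  also have "\<dots> = - sech_at n * tanh_at n * (1 + exp_at n ^ 2)" unfolding tanh_at_def sech_at_rel[symmetric] by (simp only: ac_simps mult_minus_left mult_minus_right)
  finally show ?thesis by (rule mult_right_cancel[OF exp_at_nz[of n], THEN iffD1])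
qed

lemma dz_tanh_at: "dz (tanh_at n) = sech_at n ^ 2"
proof -
  have "dz (tanh_at n) = side n * (- (exp_at n * dz (sech_at n)) - dz (exp_at n) * sech_at n)"
    unfolding tanh_at_def by (simp add: dz_mult dz_diff dz_1 dz_side)
  also have "\<dots> = (side n * side n) * (exp_at n * sech_at n * (1 - exp_at n * sech_at n)) + (side n * side n) * (exp_at n * sech_at n)"
    unfolding dz_sech_at dz_exp_at tanh_at_def by (simp add: algebra_simps)
  also have "\<dots> = 2 * exp_at n * sech_at n - exp_at n ^ 2 * sech_at n ^ 2" unfolding side_sq by (simp add: power2_eq_square algebra_simps)
  also have "\<dots> = sech_at n ^ 2" unfolding sech_at_sq[symmetric] by simp
  finally show ?thesis .
qed

text \<open>
The differential equation of the hyperbolic secant.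
\<close>

lemma dz_dz_sech_at: "dz (dz (sech_at n)) = sech_at n - 2 * sech_at n ^ 3"
proof -
  have "dz (dz (sech_at n)) = - sech_at n * sech_at n ^ 2 + sech_at n * tanh_at n ^ 2"
    unfolding dz_sech_at dz_mult dz_tanh_at dz_uminus by (simp add: dz_sech_at power2_eq_square ac_simps)
  then show ?thesis unfolding tanh_at_sq by (simp add: power2_eq_square power3_eq_cube algebra_simps)
qed

lemma dil_X: "m > 0 \<Longrightarrow> dilate m fps_X = (fps_X :: int fps) ^ m"
  unfolding dilate_def by simp

definition csch_at :: "nat \<Rightarrow> bser" where "csch_at k = lift_q (dilate k csch_ser)"
definition coth_at :: "nat \<Rightarrow> bser" where "coth_at k = lift_q (dilate k coth_ser)"

lemma csch_rel: assumes "k > 0" shows "csch_at k * (1 - (fps_X ^ k) ^ 2) = 2 * fps_X ^ k"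
proof -
  have "lift_q (dilate k (csch_ser * (1 - fps_X ^ 2))) = lift_q (dilate k (2 * fps_X))" by (simp only: csch_ser)
  then show ?thesis using assms
    by (simp add: csch_at_def dil_mult dil_diff dil_power dil_X lift_q_def lift_q.map_mult lift_q.map_diff lift_q.map_power lift_q.map_X lift_q.map_1 lift_q.map_numeral)
qed

lemma coth_rel: assumes "k > 0" shows "coth_at k * (1 - (fps_X ^ k) ^ 2) = 1 + (fps_X ^ k) ^ 2"
proof -
  have "lift_q (dilate k (coth_ser * (1 - fps_X ^ 2))) = lift_q (dilate k (1 + fps_X ^ 2))" by (simp only: coth_ser)
  then show ?thesis using assms
    by (simp add: coth_at_def dil_mult dil_diff dil_add dil_power dil_X lift_q_def lift_q.map_mult lift_q.map_diff lift_q.map_add lift_q.map_power lift_q.map_X lift_q.map_1)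
qed

lemma pair_identities:
  assumes "m < n" defines "k \<equiv> nat (n - m)"
  shows "sech_at n * sech_at m = csch_at k * (tanh_at n - tanh_at m)"
    and "sech_at n * tanh_at m = csch_at k * sech_at m - coth_at k * sech_at n"
    and "sech_at m * tanh_at n = coth_at k * sech_at m - csch_at k * sech_at n"
proof -
  have k: "k > 0" using assms by simp
  have nz: "1 - (fps_X ^ k) ^ 2 \<noteq> (0 :: bser)"
  proof
    assume "1 - (fps_X ^ k) ^ 2 = (0 :: bser)"
    then have "(1 - (fps_X ^ k) ^ 2 :: bser) $ 0 = 0" by simp
    then show False using k by (simp add: fps_power_zeroth power_0_left)
  qed
  have xx: "fps_const exp_plus * fps_const exp_minus = (1 :: bser)" "fps_const exp_minus * fps_const exp_plus = (1 :: bser)"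
    using exp_plus_minus by (simp_all add: mult.commute)
  have "(side n = 1 \<and> side m = 1 \<and> exp_at n = exp_at m * fps_X ^ k) \<or> (side n = 1 \<and> side m = - 1 \<and> exp_at n * exp_at m = fps_X ^ k) \<or>
    (side n = - 1 \<and> side m = - 1 \<and> exp_at m = exp_at n * fps_X ^ k)"
  proof -
    consider "m \<ge> 0" | "n \<ge> 0" "m < 0" | "n < 0" using assms by linarith
    then show ?thesis
    proof cases
      case 1
      then have "nat n = nat m + k" using assms by (simp add: k_def)
      then show ?thesis using 1 assms by (simp add: side_def exp_at_def power_add mult.assoc)
    next
      case 2
      then have "k = nat n + nat (- m)" using assms by (simp add: k_def)
      moreover have "exp_at n * exp_at m = (fps_const exp_minus * fps_const exp_plus) * (fps_X ^ nat n * fps_X ^ nat (- m))"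
        using 2 by (simp only: exp_at_def if_True if_False not_le ac_simps) simp
      ultimately show ?thesis using 2 by (simp only: xx) (simp add: side_def power_add)
    next
      case 3
      then have "nat (- m) = nat (- n) + k" using assms by (simp add: k_def)
      then show ?thesis using 3 assms by (simp add: side_def exp_at_def power_add mult.assoc)
    qed
  qed
  note h = hyperbolic_identities[OF sech_at_rel sech_at_rel csch_rel[OF k] coth_rel[OF k] exp_at_nz exp_at_nz nz this]
  show "sech_at n * sech_at m = csch_at k * (tanh_at n - tanh_at m)" using h(1) by (simp add: tanh_at_def)
  show "sech_at n * tanh_at m = csch_at k * sech_at m - coth_at k * sech_at n" using h(2) by (simp add: tanh_at_def)
  show "sech_at m * tanh_at n = coth_at k * sech_at m - csch_at k * sech_at n" using h(3) by (simp add: tanh_at_def)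
qed

definition csch_diff :: "int \<Rightarrow> bser" where
  "csch_diff j = (if j = 0 then 0 else if j > 0 then csch_at (nat j) else - csch_at (nat (- j)))"
definition coth_diff :: "int \<Rightarrow> bser" where
  "coth_diff j = (if j = 0 then 0 else if j > 0 then coth_at (nat j) else - coth_at (nat (- j)))"

text \<open>
Minus the derivative of \<open>csch\<close> at \<open>j T\<close> up to the square of
\<open>csch\<close>; it is what remains of the products of the coefficients when a product of three
secants is reduced to single ones.
\<close>

definition gap_at :: "int \<Rightarrow> bser" where "gap_at j = csch_diff j * coth_diff j - csch_diff j ^ 2"

lemma csch_diff_neg: "csch_diff (- j) = - csch_diff j" by (simp add: csch_diff_def)
lemma coth_diff_neg: "coth_diff (- j) = - coth_diff j" by (simp add: coth_diff_def)
lemma gap_at_neg: "gap_at (- j) = gap_at j" by (simp add: gap_at_def csch_diff_neg coth_diff_neg)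

text \<open>
Partial fractions: a product of two secants at different shifts is a combination of hyperbolic
tangents.
\<close>

lemma sech_at_mult: assumes "n \<noteq> m" shows "sech_at n * sech_at m = csch_diff (n - m) * (tanh_at n - tanh_at m)"
proof (cases "m < n")
  case True then show ?thesis using pair_identities(1)[OF True] by (simp add: csch_diff_def)
next
  case False
  then have l: "n < m" using assms by simp
  then have "csch_diff (n - m) = - csch_at (nat (m - n))" by (simp add: csch_diff_def)
  then show ?thesis using pair_identities(1)[OF l] by (simp add: algebra_simps)
qed

lemma sech_at_tanh_at: assumes "n \<noteq> m" shows "sech_at n * tanh_at m = csch_diff (n - m) * sech_at m - coth_diff (n - m) * sech_at n"
proof (cases "m < n")
  case True then show ?thesis using pair_identities(2)[OF True] by (simp add: csch_diff_def coth_diff_def)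
next
  case False
  then have l: "n < m" using assms by simp
  then have "csch_diff (n - m) = - csch_at (nat (m - n))" "coth_diff (n - m) = - coth_at (nat (m - n))" by (simp_all add: csch_diff_def coth_diff_def)
  then show ?thesis using pair_identities(3)[OF l] by simp
qed

lemma sech_at_mult_mult: assumes "n \<noteq> m"
  shows "sech_at n ^ 2 * sech_at m = csch_diff (n - m) * (sech_at n * tanh_at n) - csch_diff (n - m) ^ 2 * sech_at m + csch_diff (n - m) * coth_diff (n - m) * sech_at n"
proof -
  have "sech_at n ^ 2 * sech_at m = sech_at n * (sech_at n * sech_at m)" by (simp add: power2_eq_square mult.assoc)
  also have "\<dots> = csch_diff (n - m) * (sech_at n * tanh_at n) - csch_diff (n - m) * (sech_at n * tanh_at m)"
    unfolding sech_at_mult[OF assms] by (simp add: algebra_simps)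
  finally show ?thesis unfolding sech_at_tanh_at[OF assms] by (simp add: algebra_simps power2_eq_square)
qed

definition vanish_below :: "nat \<Rightarrow> bser \<Rightarrow> bool" where "vanish_below a f \<longleftrightarrow> (\<forall>i<a. f $ i = 0)"

lemma vanish_below_0: "vanish_below a 0" by (simp add: vanish_below_def)
lemma vanish_below_zero: "vanish_below 0 f" by (simp add: vanish_below_def)
lemma vanish_below_add: "vanish_below a f \<Longrightarrow> vanish_below a g \<Longrightarrow> vanish_below a (f + g)" by (simp add: vanish_below_def)
lemma vanish_below_diff: "vanish_below a f \<Longrightarrow> vanish_below a g \<Longrightarrow> vanish_below a (f - g)" by (simp add: vanish_below_def)
lemma vanish_below_uminus: "vanish_below a f \<Longrightarrow> vanish_below a (- f)" by (simp add: vanish_below_def)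
lemma vanish_below_sum: "(\<And>i. i \<in> S \<Longrightarrow> vanish_below a (f i)) \<Longrightarrow> vanish_below a (sum f S)"
  by (simp add: vanish_below_def fps_sum_nth)
lemma vanish_below_mono: "vanish_below b f \<Longrightarrow> a \<le> b \<Longrightarrow> vanish_below a f" by (simp add: vanish_below_def)
lemma vanish_below_mult: assumes "vanish_below a f" "vanish_below b g" shows "vanish_below (a + b) (f * g)"
  unfolding vanish_below_def fps_mult_nth
proof (intro allI impI sum.neutral ballI)
  fix i k assume "i < a + b" "k \<in> {0..i}"
  then have "k < a \<or> i - k < b" by auto
  then show "f $ k * g $ (i - k) = 0" using assms by (auto simp: vanish_below_def)
qed
lemma vanish_below_mult_right: "vanish_below a f \<Longrightarrow> vanish_below a (f * g)"
  using vanish_below_mult[of a f 0 g] by (simp add: vanish_below_zero)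
lemma vanish_below_mult_left: "vanish_below a g \<Longrightarrow> vanish_below a (f * g)"
  using vanish_below_mult_right[of a g f] by (simp add: mult.commute)
lemma vanish_below_dz: "vanish_below a f \<Longrightarrow> vanish_below a (dz f)" by (simp add: vanish_below_def dz_def)

lemma vanish_below_exp_at: "vanish_below (nat \<bar>n\<bar>) (exp_at n)" by (auto simp: vanish_below_def exp_at_def)
lemma vanish_below_sech_at: "vanish_below (nat \<bar>n\<bar>) (sech_at n)"
  by (auto simp: vanish_below_def sech_at_def sech_exp_def dest!: dvd_imp_le)
lemma vanish_below_tanh_at: "vanish_below (2 * nat \<bar>n\<bar>) (tanh_at n - side n)"
proof -
  have "tanh_at n - side n = - side n * (exp_at n * sech_at n)" by (simp add: tanh_at_def right_diff_distrib)
  moreover have "vanish_below (nat \<bar>n\<bar> + nat \<bar>n\<bar>) (exp_at n * sech_at n)" by (rule vanish_below_mult[OF vanish_below_exp_at vanish_below_sech_at])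
  ultimately show ?thesis by (simp only: mult_2 vanish_below_mult_left)
qed
lemma vanish_below_csch: "vanish_below k (csch_at k)"
proof (cases "k = 0")
  case False
  have "dilate k csch_ser $ i = 0" if "i < k" for i
    using that False by (auto simp: dil_nth csch_ser_def dest: dvd_imp_le)
  then show ?thesis by (simp add: vanish_below_def csch_at_def lift_q_def)
qed (simp add: vanish_below_zero)
lemma vanish_below_csch_diff: "vanish_below (nat \<bar>j\<bar>) (csch_diff j)"
  using vanish_below_csch[of "nat j"] vanish_below_csch[of "nat (- j)"] by (auto simp: csch_diff_def vanish_below_0 intro: vanish_below_uminus)
lemma vanish_below_gap_at: "vanish_below (nat \<bar>j\<bar>) (gap_at j)"
  unfolding gap_at_def power2_eq_square by (intro vanish_below_diff vanish_below_mult_right vanish_below_csch_diff)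

text \<open>
Sums over two windows agree up to the order of vanishing of the terms outside the smaller one.
\<close>

lemma vanish_below_centered:
  assumes "finite S" "{- int a..int a} \<subseteq> S" "\<And>j. vanish_below (nat \<bar>j\<bar>) (f j)"
  shows "vanish_below (Suc a) (sum f S - sum f {- int a..int a})"
proof -
  have "sum f S - sum f {- int a..int a} = sum f (S - {- int a..int a})"
    using assms by (simp add: sum_diff)
  also have "vanish_below (Suc a) \<dots>"
  proof (rule vanish_below_sum)
    fix j assume "j \<in> S - {- int a..int a}"
    then have "Suc a \<le> nat \<bar>j\<bar>" by auto
    then show "vanish_below (Suc a) (f j)" using assms(3) vanish_below_mono by blast
  qed
  finally show ?thesis .
qed

lemma double_eq_0: assumes "f + f = (0 :: bser)" shows "f = 0"
proof -
  have "2 * f = 0" using assms by (simp only: mult_2)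
  moreover have "(2 :: bser) \<noteq> 0" by simp
  ultimately show ?thesis by (simp only: mult_eq_0_iff) blast
qed

lemma sum_odd_0: assumes "\<And>j. f (- j) = - f j" shows "(\<Sum>j\<in>{- a..a :: int}. f j) = (0 :: bser)"
proof -
  have "(\<Sum>j\<in>{- a..a}. f j) = (\<Sum>j\<in>{- a..a}. - f j)"
    by (rule sum.reindex_bij_witness[of _ uminus uminus]) (auto simp: assms)
  then have "(\<Sum>j\<in>{- a..a}. f j) + (\<Sum>j\<in>{- a..a}. f j) = 0" by (simp add: sum_negf eq_neg_iff_add_eq_0)
  then show ?thesis by (rule double_eq_0)
qed

context
  fixes L :: nat
begin

definition "window = {- int L..int L}"
definition "sech_win = (\<Sum>n\<in>window. sech_at n)"
definition "sech2_win = (\<Sum>n\<in>window. sech_at n ^ 2)"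
definition "sech3_win = (\<Sum>n\<in>window. sech_at n ^ 3)"
definition "csch_row n = (\<Sum>m\<in>window. csch_diff (n - m))"
definition "gap_row n = (\<Sum>m\<in>window. gap_at (n - m))"

lemma shift_sum: "(\<Sum>m\<in>window. f (n - m)) = (\<Sum>j\<in>{n - int L..n + int L}. f j)"
  unfolding window_def by (rule sum.reindex_bij_witness[of _ "\<lambda>j. n - j" "\<lambda>m. n - m"]) auto

lemma csch_row_vanish_below: assumes "n \<in> window" shows "vanish_below (Suc (L - nat \<bar>n\<bar>)) (csch_row n)"
proof -
  have "{- int (L - nat \<bar>n\<bar>)..int (L - nat \<bar>n\<bar>)} \<subseteq> {n - int L..n + int L}"
    using assms by (auto simp: window_def)
  from vanish_below_centered[OF _ this vanish_below_csch_diff] show ?thesis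
    unfolding csch_row_def shift_sum[where f = csch_diff] sum_odd_0[where f = csch_diff, OF csch_diff_neg] by simp
qed

lemma gap_row_vanish_below: assumes "n \<in> window" shows "vanish_below (Suc (L - nat \<bar>n\<bar>)) (gap_row n - (\<Sum>j\<in>window. gap_at j))"
proof -
  let ?a = "L - nat \<bar>n\<bar>"
  have "{- int ?a..int ?a} \<subseteq> {n - int L..n + int L}" "{- int ?a..int ?a} \<subseteq> window"
    using assms by (auto simp: window_def)
  then have "vanish_below (Suc ?a) (gap_row n - sum gap_at {- int ?a..int ?a})" "vanish_below (Suc ?a) (sum gap_at window - sum gap_at {- int ?a..int ?a})"
    unfolding gap_row_def shift_sum[where f = gap_at] by (intro vanish_below_centered vanish_below_gap_at; simp add: window_def)+
  from vanish_below_diff[OF this] show ?thesis by simp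
qed

text \<open>
Partial fractions turn the products of two different terms into a combination of tangents, whose
coefficients are sums of \<open>csch\<close> over shifted windows.
\<close>

lemma sech_win_sq: "sech_win ^ 2 = sech2_win + 2 * (\<Sum>n\<in>window. tanh_at n * csch_row n)"
proof -
  have fin: "finite window" by (simp add: window_def)
  have "sech_at n * sech_at m = (if n = m then sech_at n ^ 2 else 0) + (csch_diff (n - m) * tanh_at n - csch_diff (n - m) * tanh_at m)" for n m
  proof (cases "n = m")
    case True then show ?thesis by (simp add: csch_diff_def power2_eq_square)
  next
    case False then show ?thesis using sech_at_mult[OF False] by (simp add: right_diff_distrib)
  qed
  then have "sech_win ^ 2 = (\<Sum>n\<in>window. \<Sum>m\<in>window. (if n = m then sech_at n ^ 2 else 0) + (csch_diff (n - m) * tanh_at n - csch_diff (n - m) * tanh_at m))"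
    unfolding power2_eq_square sech_win_def sum_product by simp
  also have "\<dots> = (\<Sum>n\<in>window. \<Sum>m\<in>window. if n = m then sech_at n ^ 2 else 0) + ((\<Sum>n\<in>window. \<Sum>m\<in>window. csch_diff (n - m) * tanh_at n) -
     (\<Sum>n\<in>window. \<Sum>m\<in>window. csch_diff (n - m) * tanh_at m))" by (simp only: sum.distrib sum_subtractf)
  also have "(\<Sum>n\<in>window. \<Sum>m\<in>window. if n = m then sech_at n ^ 2 else 0) = sech2_win"
    unfolding sech2_win_def using fin by (intro sum.cong refl) simp
  also have "(\<Sum>n\<in>window. \<Sum>m\<in>window. csch_diff (n - m) * tanh_at n) = (\<Sum>n\<in>window. tanh_at n * csch_row n)"
    unfolding csch_row_def sum_distrib_left by (simp add: mult.commute)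
  also have "(\<Sum>n\<in>window. \<Sum>m\<in>window. csch_diff (n - m) * tanh_at m) = (\<Sum>m\<in>window. \<Sum>n\<in>window. csch_diff (n - m) * tanh_at m)" by (rule sum.swap)
  also have "\<dots> = - (\<Sum>n\<in>window. tanh_at n * csch_row n)"
    unfolding csch_row_def sum_distrib_left sum_negf[symmetric]
  proof (intro sum.cong refl)
    fix n m show "csch_diff (n - m) * tanh_at m = - (tanh_at m * csch_diff (m - n))" using csch_diff_neg[of "m - n"] by (simp add: mult.commute)
  qed
  finally show ?thesis by simp
qed

lemma sech2_win_mult: "sech2_win * sech_win = sech3_win + (\<Sum>n\<in>window. sech_at n * tanh_at n * csch_row n) + (\<Sum>n\<in>window. sech_at n * gap_row n)"
proof -
  have fin: "finite window" by (simp add: window_def)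
  have "sech_at n ^ 2 * sech_at m = (if n = m then sech_at n ^ 3 else 0) + csch_diff (n - m) * (sech_at n * tanh_at n) +
     (csch_diff (n - m) * coth_diff (n - m) * sech_at n - csch_diff (n - m) ^ 2 * sech_at m)" for n m
  proof (cases "n = m")
    case True then show ?thesis by (simp add: csch_diff_def power2_eq_square power3_eq_cube)
  next
    case False then show ?thesis using sech_at_mult_mult[OF False] by simp
  qed
  then have "sech2_win * sech_win = (\<Sum>n\<in>window. \<Sum>m\<in>window. (if n = m then sech_at n ^ 3 else 0) + csch_diff (n - m) * (sech_at n * tanh_at n) +
     (csch_diff (n - m) * coth_diff (n - m) * sech_at n - csch_diff (n - m) ^ 2 * sech_at m))"
    unfolding sech_win_def sech2_win_def sum_product by simp
  also have "\<dots> = (\<Sum>n\<in>window. \<Sum>m\<in>window. if n = m then sech_at n ^ 3 else 0) + (\<Sum>n\<in>window. \<Sum>m\<in>window. csch_diff (n - m) * (sech_at n * tanh_at n)) +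
     ((\<Sum>n\<in>window. \<Sum>m\<in>window. csch_diff (n - m) * coth_diff (n - m) * sech_at n) - (\<Sum>n\<in>window. \<Sum>m\<in>window. csch_diff (n - m) ^ 2 * sech_at m))"
    by (simp only: sum.distrib sum_subtractf)
  also have "(\<Sum>n\<in>window. \<Sum>m\<in>window. if n = m then sech_at n ^ 3 else 0) = sech3_win"
    unfolding sech3_win_def using fin by (intro sum.cong refl) simp
  also have "(\<Sum>n\<in>window. \<Sum>m\<in>window. csch_diff (n - m) * (sech_at n * tanh_at n)) = (\<Sum>n\<in>window. sech_at n * tanh_at n * csch_row n)"
    unfolding csch_row_def sum_distrib_left by (simp add: mult.commute)
  also have "(\<Sum>n\<in>window. \<Sum>m\<in>window. csch_diff (n - m) ^ 2 * sech_at m) = (\<Sum>m\<in>window. \<Sum>n\<in>window. csch_diff (n - m) ^ 2 * sech_at m)" by (rule sum.swap)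
  also have "\<dots> = (\<Sum>n\<in>window. \<Sum>m\<in>window. csch_diff (n - m) ^ 2 * sech_at n)"
  proof (intro sum.cong refl)
    fix n m show "csch_diff (n - m) ^ 2 * sech_at m = csch_diff (m - n) ^ 2 * sech_at m" using csch_diff_neg[of "m - n"] by simp
  qed
  also have "(\<Sum>n\<in>window. \<Sum>m\<in>window. csch_diff (n - m) * coth_diff (n - m) * sech_at n) - (\<Sum>n\<in>window. \<Sum>m\<in>window. csch_diff (n - m) ^ 2 * sech_at n) =
     (\<Sum>n\<in>window. sech_at n * gap_row n)"
    unfolding gap_row_def sum_distrib_left gap_at_def sum_subtractf[symmetric] by (simp add: algebra_simps)
  finally show ?thesis .
qed

lemma error_B: assumes n: "n \<in> window" and "vanish_below (nat \<bar>n\<bar>) f" "vanish_below (Suc (L - nat \<bar>n\<bar>)) g" shows "vanish_below (Suc L) (f * g)"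
proof -
  have "nat \<bar>n\<bar> + Suc (L - nat \<bar>n\<bar>) = Suc L" using n by (auto simp: window_def)
  then show ?thesis using vanish_below_mult[OF assms(2,3)] by simp
qed

text \<open>
The sums over shifted windows differ from those over the centred window only in terms of high order,
and the sum of the odd function \<open>csch\<close> over the centred window vanishes.
\<close>

lemma sech2_win_mult_approx: "vanish_below (Suc L) (sech2_win * sech_win - sech3_win - (\<Sum>j\<in>window. gap_at j) * sech_win)"
proof -
  define G where "G = (\<Sum>j\<in>window. gap_at j)"
  have "(\<Sum>n\<in>window. sech_at n * (gap_row n - G)) = (\<Sum>n\<in>window. sech_at n * gap_row n) - G * sech_win"
    unfolding sech_win_def right_diff_distrib sum_subtractf sum_distrib_left by (simp add: mult.commute)
  then have "sech2_win * sech_win - sech3_win - G * sech_win = (\<Sum>n\<in>window. sech_at n * tanh_at n * csch_row n) + (\<Sum>n\<in>window. sech_at n * (gap_row n - G))"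
    unfolding sech2_win_mult by simp
  then have "sech2_win * sech_win - sech3_win - (\<Sum>j\<in>window. gap_at j) * sech_win =
      (\<Sum>n\<in>window. sech_at n * tanh_at n * csch_row n) + (\<Sum>n\<in>window. sech_at n * (gap_row n - (\<Sum>j\<in>window. gap_at j)))"
    unfolding G_def .
  also have "vanish_below (Suc L) \<dots>"
  proof (intro vanish_below_add vanish_below_sum)
    fix n assume n: "n \<in> window"
    show "vanish_below (Suc L) (sech_at n * tanh_at n * csch_row n)"
      by (rule error_B[OF n vanish_below_mult_right[OF vanish_below_sech_at] csch_row_vanish_below[OF n]])
    show "vanish_below (Suc L) (sech_at n * (gap_row n - (\<Sum>j\<in>window. gap_at j)))"
      by (rule error_B[OF n vanish_below_sech_at gap_row_vanish_below[OF n]])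
  qed
  finally show ?thesis .
qed

lemma side_csch_row: "(\<Sum>n\<in>window. side n * csch_row n) = 2 * (\<Sum>n\<in>{0..L}. \<Sum>m\<in>{1..L}. csch_at (n + m))"
proof -
  let ?N = "{0..int L}" and ?M = "{- int L..-1}"
  have U: "window = ?N \<union> ?M" "?N \<inter> ?M = {}" by (auto simp: window_def)
  have sech_exp: "(\<Sum>n\<in>window. f n) = (\<Sum>n\<in>?N. f n) + (\<Sum>n\<in>?M. f n)" for f :: "int \<Rightarrow> bser"
    unfolding U(1) by (rule sum.union_disjoint) (use U(2) in auto)
  define X where "X S T = (\<Sum>n\<in>S. \<Sum>m\<in>T. csch_diff (n - m))" for S T
  have X_swap: "X T S = - X S T" for S T
    unfolding X_def sum_negf[symmetric]
    by (subst sum.swap) (intro sum.cong refl, metis csch_diff_neg minus_diff_eq)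
  then have X_self: "X S S = 0" for S
  proof -
    have "X S S + X S S = 0" using X_swap[of S S] by (simp add: eq_neg_iff_add_eq_0)
    then show ?thesis by (rule double_eq_0)
  qed
  have "(\<Sum>n\<in>window. side n * csch_row n) = (\<Sum>n\<in>?N. csch_row n) + (\<Sum>n\<in>?M. - csch_row n)"
    unfolding sech_exp by (intro arg_cong2[of _ _ _ _ "(+)"] sum.cong refl) (auto simp: side_def)
  also have "\<dots> = X ?N ?N + X ?N ?M - (X ?M ?N + X ?M ?M)"
    unfolding csch_row_def X_def sech_exp by (simp add: sum.distrib sum_negf sum_subtractf)
  also have "\<dots> = 2 * X ?N ?M" unfolding X_self X_swap[of ?M ?N] by simp
  also have "X ?N ?M = (\<Sum>n\<in>{0..L}. \<Sum>m\<in>{1..L}. csch_at (n + m))"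
    unfolding X_def
  proof (rule sum.reindex_bij_witness[of _ int nat])
    fix n assume n: "n \<in> {0..int L}"
    show "(\<Sum>m\<in>{1..L}. csch_at (nat n + m)) = (\<Sum>m\<in>?M. csch_diff (n - m))"
      by (rule sum.reindex_bij_witness[of _ "\<lambda>m. nat (- m)" "\<lambda>m. - int m"])
        (use n in \<open>auto simp: csch_diff_def nat_add_distrib\<close>)
  qed auto
  finally show ?thesis .
qed

text \<open>
The number of ways of writing \<open>k\<close> as \<open>n + m\<close> with \<open>n \<ge> 0\<close>
and \<open>m \<ge> 1\<close> is \<open>k\<close>.
\<close>

lemma double_csch_sum: "vanish_below (Suc L) ((\<Sum>n\<in>{0..L}. \<Sum>m\<in>{1..L}. csch_at (n + m)) - (\<Sum>k\<in>{1..L}. of_nat k * csch_at k))"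
proof -
  have "(\<Sum>n\<in>{0..L}. \<Sum>m\<in>{1..L}. csch_at (n + m)) = (\<Sum>m\<in>{1..L}. \<Sum>n\<in>{0..L}. csch_at (n + m))" by (rule sum.swap)
  also have "\<dots> = (\<Sum>m\<in>{1..L}. (\<Sum>n\<in>{0..L - m}. csch_at (n + m)) + (\<Sum>n\<in>{L - m<..L}. csch_at (n + m)))"
  proof (intro sum.cong refl)
    fix m
    have "{0..L} = {0..L - m} \<union> {L - m<..L}" "{0..L - m} \<inter> {L - m<..L} = {}" by auto
    then show "(\<Sum>n\<in>{0..L}. csch_at (n + m)) = (\<Sum>n\<in>{0..L - m}. csch_at (n + m)) + (\<Sum>n\<in>{L - m<..L}. csch_at (n + m))"
      by (simp only: sum.union_disjoint finite_atLeastAtMost finite_greaterThanAtMost)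
  qed
  also have "\<dots> = (\<Sum>m\<in>{1..L}. \<Sum>n\<in>{0..L - m}. csch_at (n + m)) + (\<Sum>m\<in>{1..L}. \<Sum>n\<in>{L - m<..L}. csch_at (n + m))"
    by (rule sum.distrib)
  also have "(\<Sum>m\<in>{1..L}. \<Sum>n\<in>{0..L - m}. csch_at (n + m)) = (\<Sum>m\<in>{1..L}. \<Sum>k\<in>{1..L}. if m \<le> k then csch_at k else 0)"
  proof (rule sum.cong[OF refl])
    fix m assume m: "m \<in> {1..L}"
    have "(\<Sum>n\<in>{0..L - m}. csch_at (n + m)) = (\<Sum>k\<in>{m..L}. csch_at k)"
      by (rule sum.reindex_bij_witness[of _ "\<lambda>k. k - m" "\<lambda>n. n + m"]) (use m in auto)
    also have "\<dots> = (\<Sum>k\<in>{1..L}. if m \<le> k then csch_at k else 0)"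
      by (rule sum.mono_neutral_cong_left) (use m in auto)
    finally show "(\<Sum>n\<in>{0..L - m}. csch_at (n + m)) = (\<Sum>k\<in>{1..L}. if m \<le> k then csch_at k else 0)" .
  qed
  also have "\<dots> = (\<Sum>k\<in>{1..L}. \<Sum>m\<in>{1..L}. if m \<le> k then csch_at k else 0)" by (rule sum.swap)
  also have "\<dots> = (\<Sum>k\<in>{1..L}. of_nat k * csch_at k)"
  proof (rule sum.cong[OF refl])
    fix k assume k: "k \<in> {1..L}"
    have "(\<Sum>m\<in>{1..L}. if m \<le> k then csch_at k else 0) = (\<Sum>m\<in>{1..k}. csch_at k)"
      by (rule sum.mono_neutral_cong_right) (use k in auto)
    then show "(\<Sum>m\<in>{1..L}. if m \<le> k then csch_at k else 0) = of_nat k * csch_at k" by simp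
  qed
  finally have "(\<Sum>n\<in>{0..L}. \<Sum>m\<in>{1..L}. csch_at (n + m)) - (\<Sum>k\<in>{1..L}. of_nat k * csch_at k) =
    (\<Sum>m\<in>{1..L}. \<Sum>n\<in>{L - m<..L}. csch_at (n + m))" by simp
  also have "vanish_below (Suc L) \<dots>"
  proof (intro vanish_below_sum)
    fix m n assume "n \<in> {L - m<..L}" "m \<in> {1..L}"
    then have "Suc L \<le> n + m" by auto
    then show "vanish_below (Suc L) (csch_at (n + m))" using vanish_below_csch vanish_below_mono by blast
  qed
  finally show ?thesis .
qed

text \<open>
Only the constant part \<open>side\<close> of the tangents survives; the remaining parts have high
order.
\<close>

lemma sech_win_sq_approx: "vanish_below (Suc L) (sech_win ^ 2 - sech2_win - 4 * (\<Sum>k\<in>{1..L}. of_nat k * csch_at k))"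
proof -
  let ?D = "(\<Sum>n\<in>{0..L}. \<Sum>m\<in>{1..L}. csch_at (n + m))" and ?E = "(\<Sum>k\<in>{1..L}. of_nat k * csch_at k)"
  have "(\<Sum>n\<in>window. tanh_at n * csch_row n) = (\<Sum>n\<in>window. (tanh_at n - side n) * csch_row n) + (\<Sum>n\<in>window. side n * csch_row n)"
    by (simp add: left_diff_distrib sum_subtractf)
  then have "sech_win ^ 2 - sech2_win - 4 * ?E = 2 * (\<Sum>n\<in>window. (tanh_at n - side n) * csch_row n) + 4 * (?D - ?E)"
    unfolding sech_win_sq side_csch_row by (simp add: right_diff_distrib)
  also have "vanish_below (Suc L) \<dots>"
  proof (rule vanish_below_add[OF vanish_below_mult_left[OF vanish_below_sum] vanish_below_mult_left[OF double_csch_sum]])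
    fix n assume n: "n \<in> window"
    have "vanish_below (nat \<bar>n\<bar>) (tanh_at n - side n)" by (rule vanish_below_mono[OF vanish_below_tanh_at]) simp
    then show "vanish_below (Suc L) ((tanh_at n - side n) * csch_row n)" by (rule error_B[OF n _ csch_row_vanish_below[OF n]])
  qed
  finally show ?thesis .
qed

lemma dz_dz_sech_win: "dz (dz sech_win) = sech_win - 2 * sech3_win"
  unfolding sech_win_def sech3_win_def dz_sum dz_dz_sech_at by (simp add: sum_subtractf sum_distrib_left)

end

text \<open>
The limit of the windows, the elliptic function \<open>sum of sech (z + n T)\<close>.
\<close>

definition sech_sum :: bser where "sech_sum = Abs_fps (\<lambda>N. sech_win N $ N)"

lemma sech_sum_approx: "vanish_below (Suc L) (sech_sum - sech_win L)"
  unfolding vanish_below_def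
proof (intro allI impI)
  fix i assume i: "i < Suc L"
  have "vanish_below (Suc i) (sum sech_at {- int L..int L} - sum sech_at {- int i..int i})"
    using i by (intro vanish_below_centered vanish_below_sech_at) auto
  then have "(sech_win L - sech_win i) $ i = 0" by (simp add: vanish_below_def sech_win_def window_def)
  then show "(sech_sum - sech_win L) $ i = 0" by (simp add: sech_sum_def)
qed

definition lambert_ser :: "(nat \<Rightarrow> int) \<Rightarrow> int fps \<Rightarrow> int fps" where
  "lambert_ser a h = Abs_fps (\<lambda>N. \<Sum>k\<in>{1..N}. a k * dilate k h $ N)"

lemma of_int_fps: "(of_int c :: int fps) = fps_const c"
  by (cases c rule: int_diff_cases) (simp add: fps_of_nat[symmetric] flip: fps_const_sub)

lemma lambert_ser_approx:
  assumes h: "h $ 0 = 0" and i: "i \<le> L"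
  shows "lambert_ser a h $ i = (\<Sum>k\<in>{1..L}. of_int (a k) * dilate k h) $ i"
proof -
  have "(\<Sum>k\<in>{1..L}. of_int (a k) * dilate k h) $ i = (\<Sum>k\<in>{1..L}. a k * dilate k h $ i)"
    by (simp add: fps_sum_nth of_int_fps)
  also have "\<dots> = (\<Sum>k\<in>{1..i}. a k * dilate k h $ i)"
  proof (rule sum.mono_neutral_right)
    show "\<forall>k\<in>{1..L} - {1..i}. a k * dilate k h $ i = 0"
      using h by (auto simp: dil_nth dest: dvd_imp_le)
  qed (use i in auto)
  finally show ?thesis by (simp add: lambert_ser_def)
qed

lemma lift_q_vanish_below: assumes "\<And>i. i \<le> L \<Longrightarrow> f $ i = g $ i" shows "vanish_below (Suc L) (lift_q f - lift_q g)"
  using assms by (simp add: vanish_below_def lift_q_def)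

definition gap_ser :: "int fps" where "gap_ser = coth_ser * csch_ser - csch_ser ^ 2"
definition gap_lambert :: "int fps" where "gap_lambert = lambert_ser (\<lambda>_. 1) gap_ser"
definition csch_lambert :: "int fps" where "csch_lambert = lambert_ser int csch_ser"

text \<open>
Obtained by adding up the constants: 1 from the equation of a single secant, twice the sum of
\<open>gap_at\<close>, and twice the constant by which the square of the sum exceeds the sum of the
squares.
\<close>

definition ode_coeff :: "int fps" where "ode_coeff = 1 + 4 * gap_lambert + 8 * csch_lambert"

lemma cs0_0: "csch_ser $ 0 = 0" by (simp add: csch_ser_def)
lemma gap_ser_0: "gap_ser $ 0 = 0" by (simp add: gap_ser_def cs0_0 power2_eq_square)

lemma lift_q_add: "lift_q (f + g) = lift_q f + lift_q g" by (simp add: lift_q_def lift_q.map_add)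
lemma lift_q_mult: "lift_q (f * g) = lift_q f * lift_q g" by (simp add: lift_q_def lift_q.map_mult)
lemma lift_q_diff: "lift_q (f - g) = lift_q f - lift_q g" by (simp add: lift_q_def lift_q.map_diff)
lemma lift_q_power: "lift_q (f ^ k) = lift_q f ^ k" by (simp add: lift_q_def lift_q.map_power)
lemma lift_q_1: "lift_q 1 = 1" by (simp add: lift_q_def lift_q.map_1)
lemma lift_q_numeral: "lift_q (numeral k) = numeral k" by (simp add: lift_q_def lift_q.map_numeral)
lemma lift_q_of_nat: "lift_q (of_nat k) = of_nat k" by (simp add: lift_q_def lift_q.map_of_nat)
lemma lift_q_sum: "lift_q (sum f S) = (\<Sum>i\<in>S. lift_q (f i))" by (simp add: lift_q_def lift_q.map_sum)

lemma csch_lambert_approx: "vanish_below (Suc L) (lift_q csch_lambert - (\<Sum>k\<in>{1..L}. of_nat k * csch_at k))"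
proof -
  have "vanish_below (Suc L) (lift_q csch_lambert - lift_q (\<Sum>k\<in>{1..L}. of_int (int k) * dilate k csch_ser))"
    unfolding csch_lambert_def by (intro lift_q_vanish_below lambert_ser_approx cs0_0)
  then show ?thesis by (simp add: lift_q_sum lift_q_mult lift_q_of_nat csch_at_def)
qed

lemma gap_at_pos: "k > 0 \<Longrightarrow> gap_at (int k) = lift_q (dilate k gap_ser)"
  by (simp add: gap_at_def csch_diff_def coth_diff_def gap_ser_def csch_at_def coth_at_def dil_diff dil_mult dil_power lift_q_diff lift_q_mult lift_q_power mult.commute)

lemma sum_window_even:
  assumes "\<And>j. f (- j) = f j" shows "(\<Sum>j\<in>window L. f j) = f 0 + 2 * (\<Sum>k\<in>{1..L}. f (int k) :: 'a :: idom)"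
proof -
  have "window L = insert 0 (int ` {1..L} \<union> (\<lambda>k. - int k) ` {1..L})"
  proof (intro equalityI subsetI)
    fix j assume j: "j \<in> window L"
    consider "j = 0" | "j > 0" | "j < 0" by linarith
    then show "j \<in> insert 0 (int ` {1..L} \<union> (\<lambda>k. - int k) ` {1..L})"
    proof cases
      case 2 then have "j = int (nat j)" "nat j \<in> {1..L}" using j by (auto simp: window_def)
      then show ?thesis by blast
    next
      case 3 then have "j = - int (nat (- j))" "nat (- j) \<in> {1..L}" using j by (auto simp: window_def)
      then show ?thesis by blast
    qed simp
  qed (auto simp: window_def)
  moreover have "int ` {1..L} \<inter> (\<lambda>k. - int k) ` {1..L} = {}" by auto
  moreover have "(\<Sum>j\<in>int ` {1..L}. f j) = (\<Sum>k\<in>{1..L}. f (int k))"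
    by (subst sum.reindex) (auto simp: inj_on_def)
  moreover have "(\<Sum>j\<in>(\<lambda>k. - int k) ` {1..L}. f j) = (\<Sum>k\<in>{1..L}. f (int k))"
    by (subst sum.reindex) (auto simp: inj_on_def assms)
  ultimately show ?thesis by (subst (1) \<open>window L = _\<close>) (subst sum.insert; auto simp: sum.union_disjoint)
qed

lemma gap_lambert_approx: "vanish_below (Suc L) (2 * lift_q gap_lambert - (\<Sum>j\<in>window L. gap_at j))"
proof -
  have "vanish_below (Suc L) (lift_q gap_lambert - lift_q (\<Sum>k\<in>{1..L}. of_int 1 * dilate k gap_ser))"
    unfolding gap_lambert_def by (intro lift_q_vanish_below lambert_ser_approx gap_ser_0)
  then have "vanish_below (Suc L) (2 * (lift_q gap_lambert - (\<Sum>k\<in>{1..L}. lift_q (dilate k gap_ser))))"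
    by (intro vanish_below_mult_left) (simp add: lift_q_sum)
  moreover have "(\<Sum>j\<in>window L. gap_at j) = 2 * (\<Sum>k\<in>{1..L}. lift_q (dilate k gap_ser))"
  proof -
    have "(\<Sum>k\<in>{1..L}. gap_at (int k)) = (\<Sum>k\<in>{1..L}. lift_q (dilate k gap_ser))" by (intro sum.cong gap_at_pos refl) simp
    moreover have "gap_at 0 = 0" by (simp add: gap_at_def csch_diff_def)
    ultimately show ?thesis by (subst sum_window_even) (simp_all add: gap_at_neg)
  qed
  ultimately show ?thesis by (simp add: right_diff_distrib)
qed

lemma eq_if_vanish_below: assumes "\<And>L. vanish_below (Suc L) (f - g)" shows "f = g"
proof (rule fps_ext)
  fix n show "f $ n = g $ n" using assms[of n] by (simp add: vanish_below_def)
qed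

text \<open>
Summing the equations of the single terms leaves the sum of the cubes, and the two window identities
express it through the first power and the cube of the sum. All errors have order greater than
\<open>L\<close>, and \<open>L\<close> is arbitrary.
\<close>

theorem sech_sum_ode: "dz (dz sech_sum) = lift_q ode_coeff * sech_sum - 2 * sech_sum ^ 3"
proof (rule eq_if_vanish_below)
  fix L
  let ?Y = "sech_win L" and ?K = "\<Sum>j\<in>window L. gap_at j" and ?E = "\<Sum>k\<in>{1..L}. of_nat k * csch_at k"
  define D where "D = sech_sum - ?Y"
  have D: "vanish_below (Suc L) D" unfolding D_def by (rule sech_sum_approx)
  have yD: "sech_sum = ?Y + D" by (simp add: D_def)
  define E1 where "E1 = sech2_win L * ?Y - sech3_win L - ?K * ?Y"
  define E2 where "E2 = ?Y ^ 2 - sech2_win L - 4 * ?E"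
  define E3 where "E3 = 2 * lift_q gap_lambert - ?K"
  define E4 where "E4 = lift_q csch_lambert - ?E"
  have E: "vanish_below (Suc L) E1" "vanish_below (Suc L) E2" "vanish_below (Suc L) E3" "vanish_below (Suc L) E4"
    unfolding E1_def E2_def E3_def E4_def by (rule sech2_win_mult_approx sech_win_sq_approx gap_lambert_approx csch_lambert_approx)+
  have sech3_win: "sech3_win L = sech2_win L * ?Y - ?K * ?Y - E1" by (simp add: E1_def)
  have sech2_win: "sech2_win L = ?Y ^ 2 - 4 * ?E - E2" by (simp add: E2_def)
  have K: "?K = 2 * lift_q gap_lambert - E3" and Ee: "?E = lift_q csch_lambert - E4" by (simp_all add: E3_def E4_def)
  have c: "lift_q ode_coeff = 1 + 4 * lift_q gap_lambert + 8 * lift_q csch_lambert" by (simp add: ode_coeff_def lift_q_add lift_q_mult lift_q_1 lift_q_numeral)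
  have "dz (dz sech_sum) = dz (dz D) + ?Y - 2 * sech3_win L"
    unfolding yD dz_add dz_dz_sech_win by simp
  also have "\<dots> = dz (dz D) + ?Y - 2 * ((?Y ^ 2 - 4 * (lift_q csch_lambert - E4) - E2) * ?Y - (2 * lift_q gap_lambert - E3) * ?Y - E1)"
    unfolding sech3_win sech2_win K Ee ..
  also have "\<dots> - (lift_q ode_coeff * sech_sum - 2 * sech_sum ^ 3) =
    dz (dz D) + E1 * 2 + E2 * (2 * ?Y) - E3 * (2 * ?Y) - E4 * (8 * ?Y) - D * lift_q ode_coeff
      + D * (2 * (3 * ?Y ^ 2 + 3 * ?Y * D + D ^ 2))"
    unfolding yD c by (simp add: algebra_simps power2_eq_square power3_eq_cube)
  finally have "dz (dz sech_sum) - (lift_q ode_coeff * sech_sum - 2 * sech_sum ^ 3) =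
    dz (dz D) + E1 * 2 + E2 * (2 * ?Y) - E3 * (2 * ?Y) - E4 * (8 * ?Y) - D * lift_q ode_coeff
      + D * (2 * (3 * ?Y ^ 2 + 3 * ?Y * D + D ^ 2))" .
  also have "vanish_below (Suc L) \<dots>"
    by (rule vanish_below_add[OF vanish_below_diff[OF vanish_below_diff[OF vanish_below_diff[OF vanish_below_add[OF vanish_below_add[OF vanish_below_dz[OF vanish_below_dz[OF D]]
      vanish_below_mult_right[OF E(1)]] vanish_below_mult_right[OF E(2)]] vanish_below_mult_right[OF E(3)]] vanish_below_mult_right[OF E(4)]]
      vanish_below_mult_right[OF D]] vanish_below_mult_right[OF D]])
  finally show "vanish_below (Suc L) (dz (dz sech_sum) - (lift_q ode_coeff * sech_sum - 2 * sech_sum ^ 3))" .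
qed

lemma at0_add: "at0 (f + g) = at0 f + at0 g" by (simp add: at0_def at0.map_add)
lemma at0_mult: "at0 (f * g) = at0 f * at0 g" by (simp add: at0_def at0.map_mult)
lemma at0_diff: "at0 (f - g) = at0 f - at0 g" by (simp add: at0_def at0.map_diff)
lemma at0_uminus: "at0 (- f) = - at0 f" by (simp add: at0_def at0.map_uminus)
lemma at0_power: "at0 (f ^ k) = at0 f ^ k" by (simp add: at0_def at0.map_power)
lemma at0_1: "at0 1 = 1" by (simp add: at0_def at0.map_1)
lemma at0_sum: "at0 (sum f S) = (\<Sum>i\<in>S. at0 (f i))" by (simp add: at0_def at0.map_sum)
lemma at0_nth: "at0 f $ n = f $ n $ 0" by (simp add: at0_def)

lemma embed_rat_add: "embed_rat (f + g) = embed_rat f + embed_rat g" by (simp add: embed_rat_def embed_rat.map_add)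
lemma embed_rat_mult: "embed_rat (f * g) = embed_rat f * embed_rat g" by (simp add: embed_rat_def embed_rat.map_mult)
lemma embed_rat_power: "embed_rat (f ^ k) = embed_rat f ^ k" by (simp add: embed_rat_def embed_rat.map_power)
lemma embed_rat_1: "embed_rat 1 = 1" by (simp add: embed_rat_def embed_rat.map_1)
lemma embed_rat_numeral: "embed_rat (numeral k) = numeral k" by (simp add: embed_rat_def embed_rat.map_numeral)
lemma embed_rat_sum: "embed_rat (sum f S) = (\<Sum>i\<in>S. embed_rat (f i))" by (simp add: embed_rat_def embed_rat.map_sum)
lemma embed_rat_nth: "embed_rat f $ n = of_int (f $ n)" by (simp add: embed_rat_def)

definition sech_ser :: "int fps" where "sech_ser = Abs_fps (\<lambda>n. 2 * chi n)"

lemma at0_sech_exp: assumes "v $ 0 = 1" "n > 0" shows "at0 (sech_exp v n) = embed_rat (dilate n sech_ser)"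
  by (rule fps_ext) (use assms in \<open>auto simp: at0_nth sech_exp_def embed_rat_nth dil_nth sech_ser_def fps_power_zeroth\<close>)

lemma at0_sech_at_0: "at0 (sech_at 0) = 1"
  by (rule fps_ext) (auto simp: at0_nth sech_at_def exp_minus_def fps_power_zeroth)

lemma at0_sech_at_pos: "k > 0 \<Longrightarrow> at0 (sech_at (int k)) = embed_rat (dilate k sech_ser)"
  by (simp add: sech_at_def at0_sech_exp exp_minus_def)

lemma at0_sech_at_neg: "at0 (sech_at (- n)) = at0 (sech_at n)"
  by (auto simp: sech_at_def at0_sech_exp exp_minus_def exp_plus_def)

lemma at0_exp_at_neg: "at0 (exp_at (- n)) = at0 (exp_at n)"
  by (rule fps_ext) (auto simp: at0_nth exp_at_def exp_minus_def exp_plus_def fps_X_power_nth)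

text \<open>
Jacobi's formula for the number of representations by two squares, as a Lambert series.
\<close>

definition two_sq_ser :: "int fps" where
  "two_sq_ser = Abs_fps (\<lambda>N. if N = 0 then 1 else 4 * (\<Sum>d | d dvd N. chi d))"

lemma sum_divisors: assumes "(N :: nat) > 0"
  shows "(\<Sum>k\<in>{1..N}. if k dvd N then f k (N div k) else 0) = (\<Sum>k | k dvd N. f k (N div k))"
proof -
  have "{k \<in> {1..N}. k dvd N} = {k. k dvd N}" using assms by (auto dest: dvd_imp_le simp: Suc_le_eq dvd_pos_nat)
  then show ?thesis by (simp flip: sum.inter_filter)
qed

lemma sum_divisors_flip: assumes "(N :: nat) > 0"
  shows "(\<Sum>k | k dvd N. f (N div k)) = (\<Sum>k | k dvd (N :: nat). f k)"
  by (rule sum.reindex_bij_witness[of _ "\<lambda>k. N div k" "\<lambda>k. N div k"]) (use assms in \<open>auto elim!: dvdE\<close>)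

lemma at0_sech_sum: "at0 sech_sum = embed_rat two_sq_ser"
proof (rule fps_ext)
  fix N
  have "at0 sech_sum $ N = at0 (sech_win N) $ N" by (simp add: at0_nth sech_sum_def)
  also have "at0 (sech_win N) = (\<Sum>n\<in>window N. at0 (sech_at n))" by (simp add: sech_win_def at0_sum)
  also have "\<dots> = 1 + 2 * (\<Sum>k\<in>{1..N}. at0 (sech_at (int k)))"
    by (subst sum_window_even) (simp_all add: at0_sech_at_neg at0_sech_at_0)
  also have "(\<Sum>k\<in>{1..N}. at0 (sech_at (int k))) = (\<Sum>k\<in>{1..N}. embed_rat (dilate k sech_ser))"
    by (intro sum.cong at0_sech_at_pos refl) simp
  also have "(1 + 2 * (\<Sum>k\<in>{1..N}. embed_rat (dilate k sech_ser))) $ N = embed_rat two_sq_ser $ N"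
  proof (cases "N = 0")
    case False
    have "(\<Sum>k\<in>{1..N}. dilate k sech_ser $ N) = (\<Sum>k\<in>{1..N}. if k dvd N then 2 * chi (N div k) else 0)"
      by (intro sum.cong refl) (simp add: dil_nth sech_ser_def)
    also have "\<dots> = (\<Sum>k | k dvd N. 2 * chi (N div k))" using False by (intro sum_divisors) simp
    also have "\<dots> = (\<Sum>k | k dvd N. 2 * chi k)" using False by (intro sum_divisors_flip) simp
    finally have e: "(\<Sum>k\<in>{1..N}. dilate k sech_ser $ N) = 2 * (\<Sum>k | k dvd N. chi k)" by (simp add: sum_distrib_left)
    have "(\<Sum>k\<in>{1..N}. embed_rat (dilate k sech_ser)) $ N = of_int (\<Sum>k\<in>{1..N}. dilate k sech_ser $ N)"
      by (simp add: fps_sum_nth embed_rat_nth)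
    then show ?thesis unfolding e using False by (simp add: num_mult_nth embed_rat_nth two_sq_ser_def)
  qed (simp add: embed_rat_nth two_sq_ser_def)
  finally show "at0 sech_sum $ N = embed_rat two_sq_ser $ N" .
qed

lemma sech_ser_rel: "sech_ser * (1 + fps_X ^ 2) = 2 * fps_X"
proof (rule fps_ext)
  fix n
  have "sech_ser * (1 + fps_X ^ 2) = sech_ser + fps_X ^ 2 * sech_ser" by (simp add: distrib_left mult.commute)
  then have e: "(sech_ser * (1 + fps_X ^ 2)) $ n = sech_ser $ n + (if n < 2 then 0 else sech_ser $ (n - 2))"
    by (simp add: fps_X_power_mult_nth)
  consider "n = 0" | "n = 1" | m where "n = Suc (Suc m)" by (metis not0_implies_Suc One_nat_def)
  then show "(sech_ser * (1 + fps_X ^ 2)) $ n = (2 * fps_X) $ n"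
    unfolding e by cases (simp_all add: numeral_fps_const sech_ser_def)
qed

lemma one_X_nz: "1 + fps_X \<noteq> (0 :: int fps)" "1 - fps_X \<noteq> (0 :: int fps)" "1 + fps_X ^ 2 \<noteq> (0 :: int fps)"
proof -
  have "(1 + fps_X :: int fps) $ 0 = 1" "(1 - fps_X :: int fps) $ 0 = 1" "(1 + fps_X ^ 2 :: int fps) $ 0 = 1" by simp_all
  then show "1 + fps_X \<noteq> (0 :: int fps)" "1 - fps_X \<noteq> (0 :: int fps)" "1 + fps_X ^ 2 \<noteq> (0 :: int fps)"
    by (metis fps_zero_nth zero_neq_one)+
qed

lemma gap_ser_rel: "gap_ser * (1 + fps_X) ^ 2 = 2 * fps_X"
proof -
  have "gap_ser * (1 - fps_X ^ 2) ^ 2 = (coth_ser * (1 - fps_X ^ 2)) * (csch_ser * (1 - fps_X ^ 2)) - (csch_ser * (1 - fps_X ^ 2)) ^ 2"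
    by (simp add: gap_ser_def left_diff_distrib power_mult_distrib power2_eq_square[of "1 - fps_X ^ 2"] ac_simps)
  also have "\<dots> = 2 * fps_X * (1 - fps_X) ^ 2"
    unfolding csch_ser coth_ser by (simp add: power2_eq_square algebra_simps)
  finally have "gap_ser * (1 - fps_X ^ 2) ^ 2 = 2 * fps_X * (1 - fps_X) ^ 2" .
  moreover have "(1 - fps_X ^ 2 :: int fps) = (1 + fps_X) * (1 - fps_X)" by (simp add: power2_eq_square algebra_simps)
  ultimately have "(gap_ser * (1 + fps_X) ^ 2) * (1 - fps_X) ^ 2 = (2 * fps_X) * (1 - fps_X) ^ 2"
    by (simp only: power_mult_distrib mult.assoc)
  moreover have "(1 - fps_X :: int fps) ^ 2 \<noteq> 0" using one_X_nz by simp
  ultimately show ?thesis by (rule mult_right_cancel[THEN iffD1, rotated])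
qed

lemma gap_ser_nth: "gap_ser $ n = - 2 * (- 1) ^ n * int n"
proof -
  define h where "h = Abs_fps (\<lambda>n. - 2 * (- 1) ^ n * int n)"
  have "h * (1 + fps_X) ^ 2 = 2 * fps_X"
  proof (rule fps_ext)
    fix n
    have "h * (1 + fps_X) ^ 2 = h + 2 * (fps_X ^ 1 * h) + fps_X ^ 2 * h" by (simp add: power2_eq_square algebra_simps)
    then have e: "(h * (1 + fps_X) ^ 2) $ n = h $ n + 2 * (if n < 1 then 0 else h $ (n - 1)) + (if n < 2 then 0 else h $ (n - 2))"
      by (simp only: fps_add_nth num_mult_nth fps_X_power_mult_nth)
    consider "n = 0" | "n = 1" | m where "n = Suc (Suc m)" by (metis not0_implies_Suc One_nat_def)
    then show "(h * (1 + fps_X) ^ 2) $ n = (2 * fps_X) $ n"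
      unfolding e by cases (simp_all add: numeral_fps_const h_def algebra_simps)
  qed
  then have "gap_ser * (1 + fps_X) ^ 2 = h * (1 + fps_X) ^ 2" by (simp only: gap_ser_rel)
  then have "gap_ser = h" using one_X_nz by simp
  then show ?thesis unfolding h_def by (metis fps_nth_Abs_fps)
qed

lemma sech_ser_sq: "sech_ser ^ 2 = 2 * dilate 2 gap_ser"
proof -
  have "dilate 2 (gap_ser * (1 + fps_X) ^ 2) = dilate 2 (2 * fps_X)" by (simp only: gap_ser_rel)
  then have "dilate 2 gap_ser * (1 + fps_X ^ 2) ^ 2 = 2 * fps_X ^ 2" by (simp add: dil_mult dil_power dil_add dil_X)
  then have "2 * dilate 2 gap_ser * (1 + fps_X ^ 2) ^ 2 = (2 * fps_X) ^ 2" by (simp add: power2_eq_square mult.assoc)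
  also have "\<dots> = sech_ser ^ 2 * (1 + fps_X ^ 2) ^ 2" by (simp only: sech_ser_rel[symmetric] power_mult_distrib)
  finally show ?thesis using one_X_nz by simp
qed

lemma dil_sum: "dilate m (sum f S) = (\<Sum>i\<in>S. dilate m (f i))"
  by (induction S rule: infinite_finite_induct) (simp_all add: dil_add, simp_all add: dilate_def)

text \<open>
The window identity for the square of the sum, evaluated at \<open>z = 0\<close>.
\<close>

lemma two_sq_ser_sq: "two_sq_ser ^ 2 = 1 + 4 * dilate 2 gap_lambert + 4 * csch_lambert"
proof (rule embed_rat_inj, rule fps_ext)
  fix i
  define E where "E = (\<Sum>k\<in>{1..i}. of_nat k * dilate k csch_ser)"
  define H where "H = (\<Sum>k\<in>{1..i}. dilate k gap_ser)"
  have sech_sum: "vanish_below (Suc i) (sech_sum ^ 2 - sech_win i ^ 2)"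
  proof -
    have "sech_sum ^ 2 - sech_win i ^ 2 = (sech_sum - sech_win i) * (sech_sum + sech_win i)" by (simp add: power2_eq_square algebra_simps)
    then show ?thesis using vanish_below_mult_right[OF sech_sum_approx] by metis
  qed
  have JE: "(\<Sum>k\<in>{1..i}. of_nat k * csch_at k) = lift_q E" by (simp add: E_def lift_q_sum lift_q_mult lift_q_of_nat csch_at_def)
  have "vanish_below (Suc i) (sech_sum ^ 2 - (sech2_win i + 4 * lift_q E))"
    using vanish_below_add[OF sech_sum sech_win_sq_approx[of i, unfolded JE]] by (simp add: algebra_simps)
  then have "(sech_sum ^ 2) $ i = (sech2_win i + 4 * lift_q E) $ i" by (simp add: vanish_below_def)
  then have "at0 (sech_sum ^ 2) $ i = at0 (sech2_win i + 4 * lift_q E) $ i" by (simp only: at0_nth)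
  moreover have "at0 (sech_sum ^ 2) = embed_rat (two_sq_ser ^ 2)" by (simp add: at0_power at0_sech_sum embed_rat_power)
  moreover have "at0 (sech2_win i + 4 * lift_q E) = embed_rat (1 + 4 * dilate 2 H + 4 * E)"
  proof -
    have "at0 (sech2_win i) = (\<Sum>n\<in>window i. at0 (sech_at n) ^ 2)" by (simp add: sech2_win_def at0_sum at0_power)
    also have "\<dots> = 1 + 2 * (\<Sum>k\<in>{1..i}. at0 (sech_at (int k)) ^ 2)"
      by (subst sum_window_even) (simp_all add: at0_sech_at_neg at0_sech_at_0)
    also have "(\<Sum>k\<in>{1..i}. at0 (sech_at (int k)) ^ 2) = (\<Sum>k\<in>{1..i}. embed_rat (2 * dilate 2 (dilate k gap_ser)))"
    proof (rule sum.cong[OF refl])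
      fix k assume "k \<in> {1..i}"
      then have k: "k > 0" by simp
      have "at0 (sech_at (int k)) ^ 2 = embed_rat (dilate k (sech_ser ^ 2))" by (simp add: at0_sech_at_pos[OF k] embed_rat_power dil_power k)
      also have "dilate k (sech_ser ^ 2) = 2 * dilate 2 (dilate k gap_ser)"
        unfolding sech_ser_sq using k by (simp add: dil_mult dil_dil mult.commute)
      finally show "at0 (sech_at (int k)) ^ 2 = embed_rat (2 * dilate 2 (dilate k gap_ser))" .
    qed
    also have "1 + 2 * \<dots> = embed_rat (1 + 4 * dilate 2 H)"
      by (simp add: H_def embed_rat_add embed_rat_mult embed_rat_1 embed_rat_numeral dil_sum embed_rat_sum flip: sum_distrib_left)
    finally have "at0 (sech2_win i) = embed_rat (1 + 4 * dilate 2 H)" .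
    moreover have "at0 (4 * lift_q E) = embed_rat (4 * E)"
    proof -
      have "4 * lift_q E = lift_q (4 * E)" by (simp add: lift_q_mult lift_q_numeral)
      then show ?thesis by (simp only: at0_lift_q)
    qed
    ultimately show ?thesis by (simp only: at0_add embed_rat_add)
  qed
  ultimately have "embed_rat (two_sq_ser ^ 2) $ i = embed_rat (1 + 4 * dilate 2 H + 4 * E) $ i" by simp
  moreover have "(1 + 4 * dilate 2 H + 4 * E) $ i = (1 + 4 * dilate 2 gap_lambert + 4 * csch_lambert) $ i"
  proof -
    have "csch_lambert $ i = E $ i" unfolding csch_lambert_def E_def by (subst lambert_ser_approx[OF cs0_0, of _ i]) simp_all
    moreover have "gap_lambert $ j = H $ j" if "j \<le> i" for j
      unfolding gap_lambert_def H_def using that by (subst lambert_ser_approx[OF gap_ser_0, of _ i]) simp_all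
    ultimately show ?thesis by (simp add: num_mult_nth dil_nth)
  qed
  ultimately show "embed_rat (two_sq_ser ^ 2) $ i = embed_rat (1 + 4 * dilate 2 gap_lambert + 4 * csch_lambert) $ i" by (simp only: embed_rat_nth)
qed

lemma gap_lambert_nth: assumes "N > 0" shows "gap_lambert $ N = (\<Sum>j | j dvd N. - 2 * (- 1) ^ j * int j)"
proof -
  have "gap_lambert $ N = (\<Sum>k\<in>{1..N}. if k dvd N then gap_ser $ (N div k) else 0)"
    unfolding gap_lambert_def lambert_ser_def fps_nth_Abs_fps by (intro sum.cong refl) (simp add: dil_nth)
  also have "\<dots> = (\<Sum>k | k dvd N. gap_ser $ (N div k))" by (rule sum_divisors[OF assms])
  also have "\<dots> = (\<Sum>k | k dvd N. gap_ser $ k)" by (rule sum_divisors_flip[OF assms])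
  finally show ?thesis by (simp add: gap_ser_nth)
qed

lemma csch_lambert_nth: assumes "N > 0" shows "csch_lambert $ N = (\<Sum>k | k dvd N \<and> odd (N div k). 2 * int k)"
proof -
  have fin: "finite {k. k dvd N}" using assms by simp
  have "csch_lambert $ N = (\<Sum>k\<in>{1..N}. if k dvd N then int k * csch_ser $ (N div k) else 0)"
    unfolding csch_lambert_def lambert_ser_def fps_nth_Abs_fps by (intro sum.cong refl) (simp add: dil_nth)
  also have "\<dots> = (\<Sum>k | k dvd N. int k * csch_ser $ (N div k))" by (rule sum_divisors[OF assms])
  also have "\<dots> = (\<Sum>k | k dvd N. if odd (N div k) then 2 * int k else 0)"
    by (intro sum.cong refl) (simp add: csch_ser_def)
  also have "\<dots> = (\<Sum>k | k dvd N \<and> odd (N div k). 2 * int k)"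
    using fin by (subst sum.inter_filter[symmetric]) simp_all
  finally show ?thesis .
qed

lemma gap_lambert_Cc_odd: assumes "odd N" shows "gap_lambert $ N = csch_lambert $ N"
proof -
  have N: "N > 0" using assms by (cases N) auto
  have "odd j" if "j dvd N" for j using assms that dvd_trans by blast
  moreover have "odd (N div j)" if "j dvd N" for j using assms that by (metis dvd_div_mult_self even_mult_iff)
  ultimately show ?thesis unfolding gap_lambert_nth[OF N] csch_lambert_nth[OF N] by (intro sum.cong) auto
qed

lemma gap_lambert_Cc_even: assumes "M > 0" shows "gap_lambert $ (2 * M) + csch_lambert $ (2 * M) = gap_lambert $ M"
proof -
  have N: "2 * M > 0" using assms by simp
  have fin: "finite {j. j dvd 2 * M}" using assms by simp
  have split: "{j. j dvd 2 * M} = {j. j dvd M} \<union> {j. j dvd 2 * M \<and> odd (2 * M div j)}"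
    "{j. j dvd M} \<inter> {j. j dvd 2 * M \<and> odd (2 * M div j)} = {}"
  proof -
    have a: "j dvd M \<longleftrightarrow> even (2 * M div j)" if j: "j dvd 2 * M" for j
    proof -
      obtain i where i: "2 * M = j * i" using j by blast
      have j0: "j > 0" using i assms by (cases j) auto
      show ?thesis
      proof
        assume "j dvd M"
        then obtain m where "M = j * m" by blast
        then show "even (2 * M div j)" using j0 by simp
      next
        assume "even (2 * M div j)"
        then have "even i" using i j0 by simp
        then obtain m where "i = 2 * m" by blast
        then have "M = j * m" using i by simp
        then show "j dvd M" by simp
      qed
    qed
    have b: "j dvd 2 * M" if "j dvd M" for j using that by simp
    show "{j. j dvd 2 * M} = {j. j dvd M} \<union> {j. j dvd 2 * M \<and> odd (2 * M div j)}" using a b by blast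
    show "{j. j dvd M} \<inter> {j. j dvd 2 * M \<and> odd (2 * M div j)} = {}" using a b by blast
  qed
  have ev: "even j" if "j dvd 2 * M" "odd (2 * M div j)" for j
    using that by (metis dvd_mult_div_cancel even_mult_iff dvd_triv_left)
  have "gap_lambert $ (2 * M) = gap_lambert $ M + (\<Sum>j | j dvd 2 * M \<and> odd (2 * M div j). - 2 * (- 1) ^ j * int j)"
    unfolding gap_lambert_nth[OF N] gap_lambert_nth[OF assms] using fin split(2)
    by (subst split(1), intro sum.union_disjoint) (auto intro: finite_subset[of _ "{j. j dvd 2 * M}"])
  also have "(\<Sum>j | j dvd 2 * M \<and> odd (2 * M div j). - 2 * (- 1) ^ j * int j) = - (csch_lambert $ (2 * M))"
    unfolding csch_lambert_nth[OF N] sum_negf[symmetric]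
  proof (rule sum.cong[OF refl])
    fix j assume "j \<in> {j. j dvd 2 * M \<and> odd (2 * M div j)}"
    then have "even j" using ev by blast
    then show "- 2 * (- 1) ^ j * int j = - (2 * int j)" by simp
  qed
  finally show ?thesis by simp
qed

lemma csch_lambert_double: assumes "M > 0" shows "csch_lambert $ (2 * M) = 2 * csch_lambert $ M"
proof -
  have N: "2 * M > 0" using assms by simp
  have "csch_lambert $ (2 * M) = (\<Sum>k | k dvd M \<and> odd (M div k). 2 * (2 * int k))"
    unfolding csch_lambert_nth[OF N]
  proof (rule sum.reindex_bij_witness[of _ "\<lambda>k. 2 * k" "\<lambda>k. k div 2"])
    fix k assume k: "k \<in> {k. k dvd 2 * M \<and> odd (2 * M div k)}"
    then have "even k" by (metis (no_types, lifting) dvd_mult_div_cancel even_mult_iff dvd_triv_left mem_Collect_eq)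
    then obtain j where j: "k = 2 * j" by blast
    show "2 * (k div 2) = k" using j by simp
    show "k div 2 \<in> {k. k dvd M \<and> odd (M div k)}" using k j by simp
    show "2 * (2 * int (k div 2)) = 2 * int k" using j by simp
  qed auto
  then show ?thesis unfolding csch_lambert_nth[OF assms] by (simp add: sum_distrib_left)
qed

text \<open>
Both sides are divisor sums, and they agree by a comparison of odd and even divisors.
\<close>

lemma ode_coeff_two_sq: "ode_coeff = 2 * two_sq_ser ^ 2 - neg_arg (two_sq_ser ^ 2)"
proof (rule fps_ext)
  fix N
  show "ode_coeff $ N = (2 * two_sq_ser ^ 2 - neg_arg (two_sq_ser ^ 2)) $ N"
  proof (cases "N = 0")
    case True
    have "gap_lambert $ 0 = 0" "csch_lambert $ 0 = 0" by (simp_all add: gap_lambert_def csch_lambert_def lambert_ser_def)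
    then show ?thesis using True by (simp add: ode_coeff_def two_sq_ser_sq neg_nth dil_nth num_mult_nth)
  next
    case False
    have c: "ode_coeff $ N = 4 * gap_lambert $ N + 8 * csch_lambert $ N" using False by (simp add: ode_coeff_def num_mult_nth)
    have a: "(two_sq_ser ^ 2) $ N = 4 * (if even N then gap_lambert $ (N div 2) else 0) + 4 * csch_lambert $ N"
      using False by (simp add: two_sq_ser_sq num_mult_nth dil_nth)
    show ?thesis
    proof (cases "even N")
      case True
      then obtain M where M: "N = 2 * M" by blast
      have "M > 0" using False M by simp
      from gap_lambert_Cc_even[OF this] show ?thesis
        unfolding fps_sub_nth num_mult_nth neg_nth a c using M by simp
    next
      case odd: False
      then show ?thesis unfolding fps_sub_nth num_mult_nth neg_nth a c using gap_lambert_Cc_odd[OF odd] by simp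
    qed
  qed
qed

lemma two_sq_ser_sq_double: "(two_sq_ser ^ 2) $ (2 * M) = (2 - (- 1) ^ M) * (two_sq_ser ^ 2) $ M"
proof (cases "M = 0")
  case True then show ?thesis by simp
next
  case False
  then have "(two_sq_ser ^ 2) $ (2 * M) = 4 * gap_lambert $ M + 8 * csch_lambert $ M"
    using csch_lambert_double[of M] by (simp add: two_sq_ser_sq num_mult_nth dil_nth)
  also have "\<dots> = ode_coeff $ M" using False by (simp add: ode_coeff_def num_mult_nth)
  also have "\<dots> = 2 * (two_sq_ser ^ 2) $ M - (- 1) ^ M * (two_sq_ser ^ 2) $ M"
    unfolding ode_coeff_two_sq by (simp add: num_mult_nth neg_nth)
  finally show ?thesis by (simp add: left_diff_distrib)
qed

lemma chi_divisors_double: assumes "n > 0" shows "(\<Sum>d | d dvd 2 * n. chi d) = (\<Sum>d | d dvd n. chi d)"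
proof (rule sum.mono_neutral_right)
  show "\<forall>d\<in>{d. d dvd 2 * n} - {d. d dvd n}. chi d = 0"
  proof
    fix d assume d: "d \<in> {d. d dvd 2 * n} - {d. d dvd n}"
    have "even d"
    proof (rule ccontr)
      assume "odd d" then have "coprime d 2" by simp
      then show False using d by (simp add: coprime_dvd_mult_right_iff)
    qed
    then show "chi d = 0" by (simp add: chi_def)
  qed
qed (use assms in auto)

lemma two_sq_ser_double: "two_sq_ser $ (2 * n) = two_sq_ser $ n"
  by (cases "n = 0") (simp_all add: two_sq_ser_def chi_divisors_double)

text \<open>
The same product rule that the square of \<open>phi\<close> satisfies, derived here from divisor
sums.
\<close>

lemma two_sq_ser_neg: "two_sq_ser * neg_arg two_sq_ser = dilate 2 (neg_arg two_sq_ser ^ 2)"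
proof -
  have "two_sq_ser + neg_arg two_sq_ser = 2 * dilate 2 two_sq_ser"
  proof (rule fps_ext)
    fix n show "(two_sq_ser + neg_arg two_sq_ser) $ n = (2 * dilate 2 two_sq_ser) $ n"
      by (cases "even n") (auto simp: neg_nth num_mult_nth dil_nth two_sq_ser_double elim!: evenE)
  qed
  then have "(two_sq_ser + neg_arg two_sq_ser) ^ 2 = 4 * dilate 2 (two_sq_ser ^ 2)" by (simp add: power_mult_distrib dil_power)
  moreover have "(two_sq_ser + neg_arg two_sq_ser) ^ 2 = two_sq_ser ^ 2 + neg_arg (two_sq_ser ^ 2) + 2 * (two_sq_ser * neg_arg two_sq_ser)"
    by (simp add: neg_mult power2_eq_square algebra_simps)
  ultimately have e: "2 * (two_sq_ser * neg_arg two_sq_ser) = 4 * dilate 2 (two_sq_ser ^ 2) - (two_sq_ser ^ 2 + neg_arg (two_sq_ser ^ 2))"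
    by (metis add_diff_cancel_left')
  have "2 * (two_sq_ser * neg_arg two_sq_ser) = 2 * dilate 2 (neg_arg (two_sq_ser ^ 2))"
  proof (rule fps_ext)
    fix n
    show "(2 * (two_sq_ser * neg_arg two_sq_ser)) $ n = (2 * dilate 2 (neg_arg (two_sq_ser ^ 2))) $ n"
    proof (cases "even n")
      case True
      then obtain M where M: "n = 2 * M" by blast
      show ?thesis
        unfolding e fps_sub_nth fps_add_nth num_mult_nth neg_nth M two_sq_ser_sq_double
        by (simp add: dil_nth neg_nth algebra_simps)
    next
      case False
      then show ?thesis unfolding e fps_sub_nth fps_add_nth num_mult_nth by (simp add: dil_nth neg_nth)
    qed
  qed
  then show ?thesis by (simp add: neg_power)
qed

text \<open>
The product rule determines a coefficient with odd index \<open>n\<close> through the coefficient of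
the product at \<open>n + 1\<close>, since the coefficient at 1 is known and not zero; coefficients
with even index reduce to smaller ones.
\<close>

lemma agm_unique:
  fixes f g :: "int fps"
  assumes f: "f $ 0 = 1" "f $ 1 = 4" "\<And>n. f $ (2 * n) = f $ n" "f * neg_arg f = dilate 2 (neg_arg f ^ 2)"
    and g: "g $ 0 = 1" "g $ 1 = 4" "\<And>n. g $ (2 * n) = g $ n" "g * neg_arg g = dilate 2 (neg_arg g ^ 2)"
  shows "f = g"
proof (rule fps_ext)
  fix n show "f $ n = g $ n"
  proof (induction n rule: less_induct)
    case (less n)
    consider "n = 0" | "n = 1" | "n > 0" "even n" | "n \<ge> 3" "odd n"
      by (metis One_nat_def Suc_leI dvd_refl even_Suc gr0I less_2_cases numeral_2_eq_2 numeral_3_eq_3 not_less_eq_eq le_less_Suc_eq not_le)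
    then show ?case
    proof cases
      case 3
      then obtain m where "n = 2 * m" by blast
      then show ?thesis using 3 less[of m] f(3) g(3) by simp
    next
      case 4
      then obtain k where k: "n = 2 * k + 1" by (metis oddE)
      have k1: "k \<ge> 1" using 4 k by simp
      have key: "2 * 4 * h $ n = (\<Sum>i\<in>{2..n - 1}. h $ i * neg_arg h $ (Suc n - i)) + 2 * h $ (k + 1) - (neg_arg h ^ 2) $ (k + 1)"
        if h: "h $ 0 = 1" "h $ 1 = 4" "\<And>n. h $ (2 * n) = h $ n" "h * neg_arg h = dilate 2 (neg_arg h ^ 2)" for h :: "int fps"
      proof -
        have "(h * neg_arg h) $ Suc n = (\<Sum>i\<in>{0..Suc n}. h $ i * neg_arg h $ (Suc n - i))" by (simp add: fps_mult_nth)
        also have "{0..Suc n} = insert 0 (insert 1 (insert n (insert (Suc n) {2..n - 1})))" using 4 by auto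
        also have "(\<Sum>i\<in>insert 0 (insert 1 (insert n (insert (Suc n) {2..n - 1}))). h $ i * neg_arg h $ (Suc n - i)) =
          h $ 0 * neg_arg h $ Suc n + (h $ 1 * neg_arg h $ n + (h $ n * neg_arg h $ 1 + (h $ Suc n * neg_arg h $ 0 + (\<Sum>i\<in>{2..n - 1}. h $ i * neg_arg h $ (Suc n - i)))))"
          using 4 by (subst sum.insert; simp)+
        also have "\<dots> = 2 * h $ Suc n - 2 * 4 * h $ n + (\<Sum>i\<in>{2..n - 1}. h $ i * neg_arg h $ (Suc n - i))"
          using 4 h(1,2) by (simp add: neg_nth)
        also have "h $ Suc n = h $ (k + 1)" using h(3)[of "k + 1"] k by simp
        finally have "(h * neg_arg h) $ Suc n = 2 * h $ (k + 1) - 2 * 4 * h $ n + (\<Sum>i\<in>{2..n - 1}. h $ i * neg_arg h $ (Suc n - i))" .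
        moreover have "(h * neg_arg h) $ Suc n = (neg_arg h ^ 2) $ (k + 1)"
          unfolding h(4) using k by (simp add: dil_nth)
        ultimately show ?thesis by simp
      qed
      have IH: "f $ i = g $ i" if "i < n" for i using less that by blast
      have "(\<Sum>i\<in>{2..n - 1}. f $ i * neg_arg f $ (Suc n - i)) = (\<Sum>i\<in>{2..n - 1}. g $ i * neg_arg g $ (Suc n - i))"
      proof (rule sum.cong[OF refl])
        fix i assume "i \<in> {2..n - 1}"
        then have "i < n" "Suc n - i < n" using 4 by auto
        then show "f $ i * neg_arg f $ (Suc n - i) = g $ i * neg_arg g $ (Suc n - i)" using IH by (simp add: neg_nth)
      qed
      moreover have "f $ (k + 1) = g $ (k + 1)" using IH[of "k + 1"] k k1 by simp
      moreover have "(neg_arg f ^ 2) $ (k + 1) = (neg_arg g ^ 2) $ (k + 1)"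
        unfolding power2_eq_square fps_mult_nth
      proof (rule sum.cong[OF refl])
        fix i assume "i \<in> {0..k + 1}"
        then have "i < n" "k + 1 - i < n" using k k1 by auto
        then show "neg_arg f $ i * neg_arg f $ (k + 1 - i) = neg_arg g $ i * neg_arg g $ (k + 1 - i)" using IH by (simp add: neg_nth)
      qed
      ultimately have "2 * 4 * f $ n = 2 * 4 * g $ n" using key[OF f] key[OF g] by simp
      then show ?thesis by simp
    qed (use f g in simp_all)
  qed
qed

text \<open>
Jacobi's two squares theorem: both series satisfy the recursion of the arithmetic-geometric mean.
\<close>

theorem two_squares: "two_sq_ser = phi ^ 2"
proof (rule agm_unique)
  have "{d. d dvd 1} = {1 :: nat}" by auto
  then show "two_sq_ser $ 1 = 4" by (simp add: two_sq_ser_def)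
  have 1: "\<exists>x. 1 = (x::nat)\<^sup>2" by (rule exI[of _ 1]) simp
  then have "phi $ 1 = 2" by (simp add: phi_nth)
  then show "(phi ^ 2) $ 1 = 4" by (simp add: power2_eq_square fps_mult_nth)
  show "two_sq_ser * neg_arg two_sq_ser = dilate 2 (neg_arg two_sq_ser ^ 2)" by (rule two_sq_ser_neg)
  have "phi ^ 2 * neg_arg (phi ^ 2) = (phi * neg_arg phi) ^ 2" by (simp add: neg_power power_mult_distrib)
  also have "\<dots> = dilate 2 (neg_arg (phi ^ 2) ^ 2)"
    unfolding phi_neg_phi by (simp add: dil_power neg_power)
  finally show "phi ^ 2 * neg_arg (phi ^ 2) = dilate 2 (neg_arg (phi ^ 2) ^ 2)" .
qed (simp_all add: two_sq_ser_def two_sq_ser_double[unfolded two_sq_ser_def] phi_sq_double fps_power_zeroth chi_divisors_double)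

text \<open>
Identifies the coefficient of the differential equation as a modular form.
\<close>

theorem ode_coeff_phi: "ode_coeff = phi ^ 4 + 16 * F_ser"
proof -
  have "ode_coeff = 2 * phi ^ 4 - neg_arg phi ^ 4"
    unfolding ode_coeff_two_sq two_squares by (simp add: neg_power flip: power_mult)
  then show ?thesis unfolding F_ser_eq by simp
qed

lemma dz_nth: "dz f $ n = fps_deriv (f $ n)" by (simp add: dz_def)

lemma dz_sech_sum_nth: "(dz ^^ m) sech_sum $ N = (\<Sum>n\<in>window N. (dz ^^ m) (sech_at n) $ N)"
proof -
  have a: "(dz ^^ m) f $ N = (dz ^^ m) g $ N" if "f $ N = g $ N" for f g
    using that by (induction m) (simp_all add: dz_nth)
  have b: "(dz ^^ m) (sum f S) = (\<Sum>i\<in>S. (dz ^^ m) (f i))" for f and S :: "int set"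
    by (induction m) (simp_all add: dz_sum)
  have "sech_sum $ N = sech_win N $ N" by (simp add: sech_sum_def)
  from a[OF this] show ?thesis by (simp add: sech_win_def b fps_sum_nth)
qed

lemma at0_exp_at_0: "at0 (exp_at 0) = 1"
  by (rule fps_ext) (auto simp: at0_nth exp_at_def exp_minus_def)

text \<open>
The function is even in \<open>z\<close>: the terms with index \<open>n\<close> and
\<open>-n\<close> are exchanged.
\<close>

lemma at0_dz_sech_sum: "at0 (dz sech_sum) = 0"
proof (rule fps_ext)
  fix N
  let ?f = "\<lambda>n. at0 (dz (sech_at n)) $ N"
  have odd: "at0 (dz (sech_at (- n))) = - at0 (dz (sech_at n))" for n
  proof (cases "n = 0")
    case True
    have "at0 (dz (sech_at 0)) = 0"
      by (simp add: dz_sech_at tanh_at_def at0_mult at0_uminus at0_diff at0_1 at0_sech_at_0 at0_exp_at_0 side_def)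
    then show ?thesis using True by simp
  next
    case False
    then have "side (- n) = - side n" by (simp add: side_def)
    then show ?thesis
      by (simp add: dz_sech_at tanh_at_def at0_mult at0_uminus at0_diff at0_1 at0_sech_at_neg at0_exp_at_neg)
  qed
  have "(\<Sum>n\<in>window N. ?f n) = (\<Sum>n\<in>window N. ?f (- n))"
    by (rule sum.reindex_bij_witness[of _ uminus uminus]) (auto simp: window_def)
  also have "\<dots> = - (\<Sum>n\<in>window N. ?f n)" by (simp add: odd sum_negf)
  finally have z: "(\<Sum>n\<in>window N. ?f n) = 0" by simp
  have "at0 (dz sech_sum) $ N = (\<Sum>n\<in>window N. ?f n)"
    using dz_sech_sum_nth[of 1 N] by (simp add: at0_nth fps_sum_nth)
  then show "at0 (dz sech_sum) $ N = 0 $ N" using z by simp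
qed

lemma dz_zero: assumes "dz f = 0" "at0 f = 0" shows "f = 0"
proof (rule fps_ext)
  fix n
  have "fps_deriv (f $ n) = 0" using assms(1) dz_nth[of f n] by simp
  then have "f $ n = fps_const (f $ n $ 0)" by (simp add: fps_deriv_eq_0_iff)
  moreover have "f $ n $ 0 = 0" using assms(2) at0_nth[of f n] by simp
  ultimately show "f $ n = 0 $ n" by simp
qed

definition char_div_sum :: "nat \<Rightarrow> nat \<Rightarrow> int" where "char_div_sum r N = (\<Sum>k | k dvd N. chi k * int k ^ (2 * r))"

lemma at0_dz_sech_at_nth:
  assumes "n \<noteq> 0"
  shows "at0 ((dz ^^ (2 * r)) (sech_at n)) $ N =
    (if nat \<bar>n\<bar> dvd N then of_int (2 * chi (N div nat \<bar>n\<bar>) * int (N div nat \<bar>n\<bar>) ^ (2 * r)) else 0)"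
proof -
  have d: "(fps_deriv ^^ m) (fps_const c * fps_exp a ^ k) = fps_const (c * (of_nat k * a) ^ m) * fps_exp a ^ k"
    for c a :: rat and k m
    by (induction m) (simp_all add: fps_exp_power_mult mult.assoc ac_simps)
  have dn: "(dz ^^ m) f $ N = (fps_deriv ^^ m) (f $ N)" for m and f :: bser
    by (induction m) (simp_all add: dz_nth)
  have c: "(2 * of_int (chi k) :: rat fps) = fps_const (2 * of_int (chi k))" for k
    by (simp add: numeral_fps_const flip: fps_of_int)
  have p: "at0 ((dz ^^ (2 * r)) (sech_exp (fps_exp a) k)) $ N =
      (if k dvd N then of_int (2 * chi (N div k) * int (N div k) ^ (2 * r)) else 0)"
    if a: "a = 1 \<or> a = - 1" for a k
  proof (cases "k dvd N")
    case True
    have "a ^ (2 * r) = 1" using a by (auto simp: power_mult)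
    then show ?thesis using True
      by (simp add: at0_nth dn sech_exp_def c d fps_power_zeroth power_mult_distrib)
  next
    case False
    have "(fps_deriv ^^ m) 0 = (0 :: rat fps)" for m by (induction m) simp_all
    then show ?thesis using False by (simp add: at0_nth dn sech_exp_def)
  qed
  show ?thesis using assms p[of "- 1" "nat n"] p[of 1 "nat (- n)"]
    by (cases "n > 0") (simp_all add: sech_at_def exp_minus_def exp_plus_def)
qed

lemma at0_dz_sech_sum_nth: assumes "N > 0"
  shows "at0 ((dz ^^ (2 * r)) sech_sum) $ N = of_int (4 * char_div_sum r N)"
proof -
  let ?f = "\<lambda>n. at0 ((dz ^^ (2 * r)) (sech_at n)) $ N"
  have s0: "?f 0 = 0"
  proof -
    have "(dz ^^ m) (sech_at 0) $ N = 0" for m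
      using assms by (induction m) (simp_all add: dz_nth sech_at_def)
    then show ?thesis by (simp add: at0_nth)
  qed
  have "at0 ((dz ^^ (2 * r)) sech_sum) $ N = (\<Sum>n\<in>window N. ?f n)"
    by (simp add: at0_nth dz_sech_sum_nth fps_sum_nth)
  also have "\<dots> = 2 * (\<Sum>k\<in>{1..N}. ?f (int k))"
  proof (subst sum_window_even)
    show "?f (- j) = ?f j" for j
      by (cases "j = 0") (simp_all add: at0_dz_sech_at_nth)
  qed (simp_all add: s0)
  also have "(\<Sum>k\<in>{1..N}. ?f (int k)) =
      (\<Sum>k\<in>{1..N}. if k dvd N then of_int (2 * chi (N div k) * int (N div k) ^ (2 * r)) else 0)"
    by (rule sum.cong[OF refl]) (simp add: at0_dz_sech_at_nth)
  also have "\<dots> = (\<Sum>k | k dvd N. of_int (2 * chi (N div k) * int (N div k) ^ (2 * r)))"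
    by (rule sum_divisors[OF assms])
  also have "\<dots> = (\<Sum>k | k dvd N. of_int (2 * chi k * int k ^ (2 * r)))"
    by (rule sum_divisors_flip[OF assms])
  also have "\<dots> = of_int (2 * char_div_sum r N)" by (simp add: char_div_sum_def sum_distrib_left mult.assoc)
  finally show ?thesis by simp
qed

definition finite_supp :: "int fps \<Rightarrow> bool" where "finite_supp f \<longleftrightarrow> (\<exists>K. \<forall>n\<ge>K. f $ n = 0)"

lemma finite_supp_add: assumes "finite_supp f" "finite_supp g" shows "finite_supp (f + g)"
proof -
  obtain K L where "\<forall>n\<ge>K. f $ n = 0" "\<forall>n\<ge>L. g $ n = 0" using assms by (auto simp: finite_supp_def)
  then have "\<forall>n\<ge>max K L. (f + g) $ n = 0" by simp
  then show ?thesis unfolding finite_supp_def by blast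
qed

lemma finite_supp_int: "finite_supp f \<Longrightarrow> finite_supp (of_int c * f)"
  by (auto simp: finite_supp_def of_int_fps)

lemma finite_supp_X: assumes "finite_supp f" shows "finite_supp (fps_X * f)"
proof -
  obtain K where "\<forall>n\<ge>K. f $ n = 0" using assms by (auto simp: finite_supp_def)
  then have "\<forall>n\<ge>Suc K. (fps_X * f) $ n = 0" by simp
  then show ?thesis unfolding finite_supp_def by blast
qed

lemma finite_supp_0: "finite_supp 0" and fin_1: "finite_supp 1"
  unfolding finite_supp_def by (simp, rule exI[of _ 1], simp)

definition "psi = sech_sum * lift_q (inv_phi ^ 2)"

lemma phi_q: "phi ^ k * inv_phi ^ k = 1"
  using phi_inv_phi by (simp flip: power_mult_distrib)

lemma sech_sum_psi: "sech_sum = lift_q (phi ^ 2) * psi"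
proof -
  have "lift_q (phi ^ 2) * psi = sech_sum * lift_q (phi ^ 2 * inv_phi ^ 2)" by (simp only: psi_def lift_q_mult ac_simps)
  then show ?thesis by (simp only: phi_q lift_q_1) simp
qed

lemma at0_psi: "at0 psi = 1"
proof -
  have "at0 psi = embed_rat (phi ^ 2 * inv_phi ^ 2)" by (simp add: psi_def at0_mult at0_sech_sum two_squares at0_lift_q embed_rat_mult)
  then show ?thesis by (simp only: phi_q embed_rat_1)
qed

lemma dz_lift_q_mult: "dz (lift_q f * g) = lift_q f * dz g" by (simp add: dz_mult dz_lift_q)

lemma dz_psi: "dz psi = dz sech_sum * lift_q (inv_phi ^ 2)"
  by (simp add: psi_def dz_mult dz_lift_q)

lemma psi_ode: "dz (dz psi) = lift_q (phi ^ 4) * (lift_q (1 + 16 * t_ser) * psi - 2 * psi ^ 3)"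
proof -
  have c: "ode_coeff = phi ^ 4 * (1 + 16 * t_ser)"
  proof -
    have "phi ^ 4 * (1 + 16 * t_ser) = phi ^ 4 + 16 * F_ser * (phi ^ 4 * inv_phi ^ 4)"
      by (simp only: t_ser_def distrib_left mult_1_right mult_1_left ac_simps)
    then show ?thesis by (simp only: phi_q ode_coeff_phi) simp
  qed
  have "dz (dz psi) = lift_q (inv_phi ^ 2) * (lift_q ode_coeff * sech_sum - 2 * sech_sum ^ 3)"
    by (simp add: dz_psi dz_mult dz_lift_q sech_sum_ode mult.commute)
  also have "\<dots> = lift_q (inv_phi ^ 2 * phi ^ 2 * ode_coeff) * psi - lift_q (inv_phi ^ 2 * phi ^ 2 * phi ^ 4) * (2 * psi ^ 3)"
    unfolding sech_sum_psi lift_q_mult lift_q_power by (simp add: power2_eq_square power3_eq_cube power4_eq_xxxx algebra_simps)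
  also have "inv_phi ^ 2 * phi ^ 2 = 1" using phi_q[of 2] by (simp only: mult.commute)
  finally show ?thesis unfolding c mult_1_left lift_q_mult by (simp only: right_diff_distrib mult.assoc)
qed

text \<open>
The first integral of the differential equation. The constant of integration is read off at \<open>z
= 0\<close>, where \<open>psi = 1\<close> and the derivative vanishes; this is the reason for
normalising by the square of \<open>inv_phi\<close>.
\<close>

lemma psi_integral: "dz psi ^ 2 = lift_q (phi ^ 4) * (lift_q (1 + 16 * t_ser) * psi ^ 2 - psi ^ 4 - lift_q (16 * t_ser))"
proof -
  define H where "H = dz psi ^ 2 - lift_q (phi ^ 4) * (lift_q (1 + 16 * t_ser) * psi ^ 2 - psi ^ 4 - lift_q (16 * t_ser))"
  have "H = 0"
  proof (rule dz_zero)
    have "dz H = 2 * dz psi * dz (dz psi) - lift_q (phi ^ 4) * (lift_q (1 + 16 * t_ser) * (2 * psi * dz psi) - 4 * psi ^ 3 * dz psi)"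
      unfolding H_def by (simp add: power2_eq_square power3_eq_cube power4_eq_xxxx dz_diff dz_mult dz_lift_q)
    also have "\<dots> = 0" unfolding psi_ode by (simp add: power2_eq_square power3_eq_cube algebra_simps)
    finally show "dz H = 0" .
    have "at0 (dz psi) = 0" by (simp add: dz_psi at0_mult at0_dz_sech_sum)
    moreover have "embed_rat (1 + 16 * t_ser) - 1 - embed_rat (16 * t_ser) = 0" by (simp add: embed_rat_add embed_rat_1)
    ultimately show "at0 H = 0"
      unfolding H_def by (simp add: at0_diff at0_mult at0_power at0_psi at0_lift_q)
  qed
  then show ?thesis by (simp add: H_def)
qed

text \<open>
For \<open>k = 0\<close> the last term has coefficient 0, so the truncated difference in its
exponent does no harm.
\<close>

lemma dz_dz_psi_power: "dz (dz (psi ^ (2 * k + 1))) = lift_q (phi ^ 4) * (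
    of_int ((2 * int k + 1) ^ 2) * lift_q (1 + 16 * t_ser) * psi ^ (2 * k + 1)
    - of_int ((2 * int k + 1) * (2 * int k + 2)) * psi ^ (2 * Suc k + 1)
    - of_int ((2 * int k + 1) * (2 * int k)) * lift_q (16 * t_ser) * psi ^ (2 * (k - 1) + 1))"
proof (cases k)
  case 0
  then show ?thesis by (simp add: psi_ode algebra_simps power3_eq_cube)
next
  case (Suc j)
  have pw: "dz (psi ^ Suc m) = of_nat (Suc m) * psi ^ m * dz psi" for m
  proof (induction m)
    case (Suc m)
    have "dz (psi ^ Suc (Suc m)) = psi * dz (psi ^ Suc m) + dz psi * psi ^ Suc m" by (simp only: power_Suc dz_mult)
    then show ?case unfolding Suc by (simp add: algebra_simps)
  qed simp
  have oc: "dz (of_nat m) = 0" for m using dz_lift_q[of "of_nat m"] by (simp add: lift_q_of_nat)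
  have e: "2 * k + 1 = Suc (Suc (2 * j + 1))" using Suc by simp
  have "dz (dz (psi ^ (2 * k + 1))) = of_nat (Suc (Suc (2 * j + 1))) * (of_nat (Suc (2 * j + 1)) * psi ^ (2 * j + 1) * dz psi ^ 2
      + psi ^ Suc (2 * j + 1) * dz (dz psi))"
    unfolding e pw dz_mult oc by (simp only: pw power2_eq_square) (simp add: algebra_simps)
  also have "\<dots> = lift_q (phi ^ 4) * (of_nat (Suc (Suc (2 * j + 1))) * (of_nat (Suc (2 * j + 1)) * psi ^ (2 * j + 1) * (lift_q (1 + 16 * t_ser) * psi ^ 2 - psi ^ 4 - lift_q (16 * t_ser))
      + psi ^ Suc (2 * j + 1) * (lift_q (1 + 16 * t_ser) * psi - 2 * psi ^ 3)))"
    unfolding psi_ode psi_integral by (simp only: distrib_left ac_simps)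
  also have "\<dots> = lift_q (phi ^ 4) * (
    of_int ((2 * int k + 1) ^ 2) * lift_q (1 + 16 * t_ser) * psi ^ (2 * k + 1)
    - of_int ((2 * int k + 1) * (2 * int k + 2)) * psi ^ (2 * Suc k + 1)
    - of_int ((2 * int k + 1) * (2 * int k)) * lift_q (16 * t_ser) * psi ^ (2 * (k - 1) + 1))"
    unfolding Suc by (rule arg_cong[where f = "(*) _"])
      (simp add: power2_eq_square power3_eq_cube power4_eq_xxxx algebra_simps)
  finally show ?thesis .
qed

text \<open>
Odd polynomials in \<open>psi\<close> whose coefficients are polynomials in \<open>t_ser\<close>,
together with the sum of the coefficients, which is the value at \<open>psi = 1\<close>.
\<close>

inductive odd_poly :: "bser \<Rightarrow> int fps \<Rightarrow> bool" where
  odd_poly_0: "odd_poly 0 0"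
| odd_poly_step: "odd_poly h f \<Longrightarrow> finite_supp g \<Longrightarrow> odd_poly (h + lift_q (g oo t_ser) * psi ^ (2 * k + 1)) (f + g)"

lemma odd_poly_fin: "odd_poly h f \<Longrightarrow> finite_supp f"
  by (induction rule: odd_poly.induct) (simp_all add: finite_supp_0 finite_supp_add)

lemma odd_poly_ev0: "odd_poly h f \<Longrightarrow> at0 h = embed_rat (f oo t_ser)"
proof (induction rule: odd_poly.induct)
  case odd_poly_0
  then show ?case by (simp add: at0_def at0.map_0 embed_rat_def embed_rat.map_0)
next
  case (odd_poly_step h f g k)
  then show ?case
    by (simp add: at0_add at0_mult at0_power at0_psi at0_lift_q fps_compose_add_distrib embed_rat_add)
qed

text \<open>
Modulo 2 and at \<open>t_ser = 0\<close> the coefficient of \<open>psi^(2 k + 1)\<close> is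
multiplied by \<open>(2 k + 1)^2 - (2 k + 1) (2 k + 2) = -(2 k + 1)\<close>, which is odd. So the
parity of the constant term is preserved.
\<close>

lemma odd_poly_dz2:
  assumes "odd_poly h f"
  shows "\<exists>h' f'. dz (dz h) = lift_q (phi ^ 4) * h' \<and> odd_poly h' f' \<and> even (f' $ 0 - f $ 0)"
  using assms
proof (induction rule: odd_poly.induct)
  case odd_poly_0
  show ?case by (intro exI[of _ 0] conjI odd_poly.odd_poly_0) (simp_all add: dz_0)
next
  case (odd_poly_step h f g k)
  then obtain h' f' where h: "dz (dz h) = lift_q (phi ^ 4) * h'" "odd_poly h' f'" "even (f' $ 0 - f $ 0)" by blast
  define a b c where "a = (2 * int k + 1) ^ 2" and "b = (2 * int k + 1) * (2 * int k + 2)" and "c = (2 * int k + 1) * (2 * int k)"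
  define g1 g2 g3 where "g1 = of_int a * g + of_int (16 * a) * (fps_X * g)" and "g2 = of_int (- b) * g"
    and "g3 = of_int (- (16 * c)) * (fps_X * g)"
  have fn: "finite_supp g1" "finite_supp g2" "finite_supp g3"
    unfolding g1_def g2_def g3_def by (intro finite_supp_add finite_supp_int finite_supp_X odd_poly_step.hyps)+
  have co: "of_int m * f oo t_ser = of_int m * (f oo t_ser)" for m f
    by (simp add: of_int_fps fps_compose_mult_distrib t_ser_0)
  have cX: "fps_X * f oo t_ser = t_ser * (f oo t_ser)" for f
    by (simp add: fps_compose_mult_distrib t_ser_0)
  have Ji: "lift_q (of_int m) = of_int m" for m by (simp add: lift_q_def lift_q.map_of_int)
  have "dz (dz (lift_q (g oo t_ser) * psi ^ (2 * k + 1))) = lift_q (g oo t_ser) * dz (dz (psi ^ (2 * k + 1)))"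
    by (simp add: dz_mult dz_lift_q)
  also have "\<dots> = lift_q (phi ^ 4) * (lift_q (g1 oo t_ser) * psi ^ (2 * k + 1) + lift_q (g2 oo t_ser) * psi ^ (2 * Suc k + 1) + lift_q (g3 oo t_ser) * psi ^ (2 * (k - 1) + 1))"
    unfolding dz_dz_psi_power a_def[symmetric] b_def[symmetric] c_def[symmetric] g1_def g2_def g3_def
      fps_compose_add_distrib co cX lift_q_add lift_q_mult Ji lift_q_1 lift_q_numeral
    by (simp only: of_int_minus of_int_mult of_int_numeral) (simp add: algebra_simps)
  finally have "dz (dz (h + lift_q (g oo t_ser) * psi ^ (2 * k + 1))) =
    lift_q (phi ^ 4) * (h' + lift_q (g1 oo t_ser) * psi ^ (2 * k + 1) + lift_q (g2 oo t_ser) * psi ^ (2 * Suc k + 1) + lift_q (g3 oo t_ser) * psi ^ (2 * (k - 1) + 1))"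
    unfolding dz_add h(1) by (simp only: distrib_left add.assoc)
  moreover have "odd_poly (h' + lift_q (g1 oo t_ser) * psi ^ (2 * k + 1) + lift_q (g2 oo t_ser) * psi ^ (2 * Suc k + 1) + lift_q (g3 oo t_ser) * psi ^ (2 * (k - 1) + 1)) (f' + g1 + g2 + g3)"
    by (intro odd_poly.odd_poly_step h fn)
  moreover have "even ((f' + g1 + g2 + g3) $ 0 - (f + g) $ 0)"
  proof -
    have "(f' + g1 + g2 + g3) $ 0 - (f + g) $ 0 = (f' $ 0 - f $ 0) + (a - b - 1) * g $ 0"
      by (simp add: g1_def g2_def g3_def of_int_fps algebra_simps)
    moreover have "even (a - b - 1)" by (simp add: a_def b_def)
    ultimately show ?thesis using h(3) by (metis even_add even_mult_iff)
  qed
  ultimately show ?case by blast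
qed

lemma odd_poly_dz:
  "\<exists>h f. (dz ^^ (2 * r)) psi = lift_q (phi ^ (4 * r)) * h \<and> odd_poly h f \<and> odd (f $ 0)"
proof (induction r)
  case 0
  have "odd_poly (0 + lift_q (1 oo t_ser) * psi ^ (2 * 0 + 1)) (0 + 1)" by (intro odd_poly.intros fin_1)
  then have "odd_poly psi 1" by (simp add: lift_q_1 fps_compose_1)
  then show ?case by (intro exI[of _ psi] exI[of _ 1]) (simp add: lift_q_1)
next
  case (Suc r)
  then obtain h f where h: "(dz ^^ (2 * r)) psi = lift_q (phi ^ (4 * r)) * h" "odd_poly h f" "odd (f $ 0)" by blast
  obtain h' f' where h': "dz (dz h) = lift_q (phi ^ 4) * h'" "odd_poly h' f'" "even (f' $ 0 - f $ 0)"
    using odd_poly_dz2[OF h(2)] by blast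
  have "(dz ^^ (2 * Suc r)) psi = dz (dz ((dz ^^ (2 * r)) psi))" by simp
  also have "\<dots> = lift_q (phi ^ (4 * r)) * dz (dz h)" unfolding h(1) dz_lift_q_mult ..
  also have "\<dots> = lift_q (phi ^ (4 * Suc r)) * h'" unfolding h'(1) by (simp add: power_add lift_q_mult ac_simps)
  finally have "(dz ^^ (2 * Suc r)) psi = lift_q (phi ^ (4 * Suc r)) * h'" .
  moreover have "odd (f' $ 0)" using h'(3) h(3) by simp
  ultimately show ?case using h'(2) by blast
qed

text \<open>
At \<open>z = 0\<close> the derivative of order \<open>2 r\<close> of the elliptic function is the
Lambert series by termwise differentiation, and a power of \<open>phi\<close> times a polynomial in
\<open>t_ser\<close> by the differential equation.
\<close>

theorem lambert_modular:
  "\<exists>f. finite_supp f \<and> odd (f $ 0) \<and> (\<forall>N>0. (phi ^ (4 * r + 2) * (f oo t_ser)) $ N = 4 * char_div_sum r N)"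
proof -
  obtain h f where h: "(dz ^^ (2 * r)) psi = lift_q (phi ^ (4 * r)) * h" "odd_poly h f" "odd (f $ 0)"
    using odd_poly_dz by blast
  have m: "(dz ^^ m) (lift_q g * k) = lift_q g * (dz ^^ m) k" for m g k
    by (induction m) (simp_all add: dz_lift_q_mult)
  have "(dz ^^ (2 * r)) sech_sum = lift_q (phi ^ 2) * (lift_q (phi ^ (4 * r)) * h)" unfolding sech_sum_psi m h(1) ..
  also have "\<dots> = lift_q (phi ^ (4 * r + 2)) * h" by (simp only: power_add lift_q_mult ac_simps)
  finally have "at0 ((dz ^^ (2 * r)) sech_sum) = embed_rat (phi ^ (4 * r + 2) * (f oo t_ser))"
    by (simp add: at0_mult at0_lift_q odd_poly_ev0[OF h(2)] embed_rat_mult)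
  then have "(phi ^ (4 * r + 2) * (f oo t_ser)) $ N = 4 * char_div_sum r N" if "N > 0" for N
    using at0_dz_sech_sum_nth[OF that, of r] by (metis embed_rat_nth of_int_eq_iff)
  then show ?thesis using h(3) odd_poly_fin[OF h(2)] by blast
qed

section \<open>The congruence\<close>

text \<open>
Induction by squaring, starting from \<open>phi = 1\<close> modulo 2.
\<close>

lemma phi_power_two_power: "coeffs_dvd (2 ^ Suc M) (phi ^ (2 ^ M) - 1)"
proof (induction M)
  case 0
  show ?case using cong2_phi by (simp add: cong2_ser_def)
next
  case (Suc M)
  define h where "h = phi ^ (2 ^ M) - 1"
  have h: "coeffs_dvd (2 ^ Suc M) h" using Suc by (simp add: h_def)
  have s: "coeffs_dvd 2 (h + 2)"
  proof -
    have "coeffs_dvd 2 h" using h unfolding coeffs_dvd_def by (metis dvd_mult_left power_Suc)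
    then show ?thesis by (intro coeffs_dvd_add) (simp_all add: coeffs_dvd_def numeral_fps_const)
  qed
  have "phi ^ (2 ^ Suc M) - 1 = h * (h + 2)"
    by (simp add: h_def power_mult power2_eq_square algebra_simps)
  moreover have "coeffs_dvd (2 ^ Suc (Suc M)) (h * (h + 2))"
    unfolding coeffs_dvd_def fps_mult_nth
  proof (intro allI dvd_sum)
    fix n i
    have "(2::int) ^ Suc M * 2 dvd h $ i * (h + 2) $ (n - i)"
      using h s unfolding coeffs_dvd_def by (intro mult_dvd_mono) blast+
    then show "2 ^ Suc (Suc M) dvd h $ i * (h + 2) $ (n - i)" by (simp add: mult.commute)
  qed
  ultimately show ?case by simp
qed

lemma contr_iter_linear: "(contr ^^ k) (fps_const c * f + g) = fps_const c * (contr ^^ k) f + (contr ^^ k) g"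
  by (induction k) (simp_all add: contr_add contr_const_mult)

text \<open>
A polynomial becomes an element of the contracted lattice after multiplication by a fixed power of
2, and the iterates of the contraction eventually outweigh that power.
\<close>

lemma contr_limit:
  assumes "finite_supp f" "odd (f $ 0)"
  shows "\<exists>j0. \<forall>j\<ge>j0. \<forall>n. 2 ^ M dvd (inv_phi * (f oo t_ser)) $ (4 ^ j * n) - f $ 0 * pb (4 ^ j * n)"
proof -
  obtain K where K: "\<forall>n\<ge>K. f $ n = 0" using assms by (auto simp: finite_supp_def)
  define g where "g = f - fps_const (f $ 0)"
  have f: "f = fps_const (f $ 0) * 1 + g" by (simp add: g_def)
  have lat: "dyadic 2 0 (fps_const (2 ^ (2 * K)) * g)"
    unfolding dyadic_def
  proof (intro conjI allI impI)
    fix i :: nat assume i: "i \<ge> 1"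
    have "(2::int) ^ (0 + 2 * i) dvd 2 ^ (2 * K)" if "i < K" using that by (intro le_imp_power_dvd) simp
    then show "2 ^ (0 + 2 * i) dvd (fps_const (2 ^ (2 * K)) * g) $ i"
      using K i by (cases "i < K") (auto simp: g_def)
  qed (simp add: g_def)
  have "2 ^ M dvd (inv_phi * (f oo t_ser)) $ (4 ^ j * n) - f $ 0 * pb (4 ^ j * n)" if j: "j \<ge> K + M + 1" for j n
  proof -
    have "coeffs_dvd (2 ^ (0 + 3 * j + 2)) ((contr ^^ j) (fps_const (2 ^ (2 * K)) * g))"
      by (rule dyadic_coeffs_dvd[OF contr_iter_dyadic[OF lat]])
    moreover have "(contr ^^ j) (fps_const (2 ^ (2 * K)) * g) = fps_const (2 ^ (2 * K)) * (contr ^^ j) g"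
    proof -
      have "(contr ^^ j) 0 = 0"
        by (induction j) (use contr_const_mult[of 0 0] in simp_all)
      then show ?thesis using contr_iter_linear[of j "2 ^ (2 * K)" g 0] by simp
    qed
    ultimately have "(2::int) ^ (2 * K) * 2 ^ M dvd 2 ^ (2 * K) * (contr ^^ j) g $ i" for i
    proof -
      have "(2::int) ^ (2 * K) * 2 ^ M dvd 2 ^ (0 + 3 * j + 2)"
        unfolding power_add[symmetric] using j by (intro le_imp_power_dvd) simp
      also have "\<dots> dvd 2 ^ (2 * K) * (contr ^^ j) g $ i"
        using \<open>coeffs_dvd _ _\<close> unfolding \<open>(contr ^^ j) _ = _\<close> coeffs_dvd_def by simp
      finally show ?thesis .
    qed
    then have "coeffs_dvd (2 ^ M) ((contr ^^ j) g)" by (simp add: coeffs_dvd_def)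
    then have "2 ^ M dvd (inv_phi * ((contr ^^ j) g oo t_ser)) $ n"
      using coeffs_dvd_def coeffs_dvd_compose coeffs_dvd_mult by blast
    moreover have "(inv_phi * (f oo t_ser)) $ (4 ^ j * n) = (inv_phi * ((contr ^^ j) f oo t_ser)) $ n"
      by (rule U4_steps)
    moreover have "(contr ^^ j) f = fps_const (f $ 0) * (contr ^^ j) 1 + (contr ^^ j) g"
      using f contr_iter_linear by metis
    moreover have "pb (4 ^ j * n) = (inv_phi * ((contr ^^ j) 1 oo t_ser)) $ n"
      using j by (intro overpartition_contr) simp
    moreover have "inv_phi * ((fps_const c * a + b) oo t_ser) = fps_const c * (inv_phi * (a oo t_ser)) + inv_phi * (b oo t_ser)"
      for c a b by (simp add: fps_compose_add_distrib fps_compose_mult_distrib distrib_left mult.left_commute)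
    ultimately show ?thesis by simp
  qed
  then show ?thesis by blast
qed

lemma cube_mult_not_square:
  fixes l m :: nat and b :: int
  assumes l: "prime l" and m: "\<not> l dvd m" shows "b\<^sup>2 \<noteq> int (l ^ 3 * m)"
proof
  have l0: "l > 0" using l by (rule prime_gt_0_nat)
  assume "b\<^sup>2 = int (l ^ 3 * m)"
  then have "int ((nat \<bar>b\<bar>)\<^sup>2) = int (l ^ 3 * m)" by simp
  then have c: "(nat \<bar>b\<bar>)\<^sup>2 = l ^ 3 * m" by linarith
  then have "l dvd (nat \<bar>b\<bar>)\<^sup>2" by (simp add: power3_eq_cube)
  then have "l dvd nat \<bar>b\<bar>" using l prime_dvd_power by blast
  then obtain x where "nat \<bar>b\<bar> = l * x" by blast
  then have "l ^ 2 * x\<^sup>2 = l ^ 2 * (l * m)" using c l0 by (simp add: power_mult_distrib power3_eq_cube power2_eq_square)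
  then have x: "x\<^sup>2 = l * m" using l0 by simp
  then have "l dvd x" using l prime_dvd_power by (metis dvd_triv_left)
  then obtain z where "x = l * z" by blast
  then have "l * (l * z\<^sup>2) = l * m" using x by (simp add: power2_eq_square ac_simps)
  then have "l * z\<^sup>2 = m" using l0 by simp
  then show False using m by auto
qed

lemma weight_int: "weight r (int k) = chi k * int k ^ (2 * r)"
proof -
  have "int k mod 4 = 1 \<longleftrightarrow> k mod 4 = 1" by presburger
  then show ?thesis by (simp add: weight_def chi_def)
qed

text \<open>
Choose \<open>r\<close> with \<open>4 r + 4 = 2^M\<close>, so that \<open>phi\<close> times the
Lambert series is congruent to \<open>inv_phi * (f oo t_ser)\<close>. Its coefficient at the
nonsquare \<open>4^j * l^3 * n\<close> is a multiple of the divisor sum that vanishes by the Hecke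
relation.
\<close>

lemma high_power_dvd:
  fixes l n :: nat
  assumes l: "prime l" "odd l" "[int l = - 1] (mod 2 ^ M)" and M: "M \<ge> 2" and n: "\<not> l dvd n"
  shows "\<exists>j0. \<forall>j\<ge>j0. 2 ^ M dvd pb (4 ^ j * (l ^ 3 * n))"
proof -
  define r :: nat where "r = 2 ^ (M - 2) - 1"
  obtain K where "M = K + 2" using M by (metis le_add_diff_inverse2)
  then have "(2::nat) ^ M = 2 ^ (M - 2) * 4" by simp
  moreover have "(2::nat) ^ (M - 2) \<ge> 1" by simp
  ultimately have r: "4 * r + 4 = 2 ^ M" unfolding r_def by arith
  obtain f where f: "finite_supp f" "odd (f $ 0)"
    and fN: "\<And>N. N > 0 \<Longrightarrow> (phi ^ (4 * r + 2) * (f oo t_ser)) $ N = 4 * char_div_sum r N"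
    using lambert_modular[of r] by blast
  obtain j1 where j1: "\<forall>j\<ge>j1. 2 ^ M dvd (\<Sum>b | b\<^sup>2 < int (4 ^ j * l ^ 3 * n).
      \<Sum>d | d dvd nat (int (4 ^ j * l ^ 3 * n) - b\<^sup>2). weight r (int d))"
    using divisor_sum_vanish[OF l M n] by blast
  obtain j2 where j2: "\<forall>j\<ge>j2. \<forall>n. 2 ^ M dvd (inv_phi * (f oo t_ser)) $ (4 ^ j * n) - f $ 0 * pb (4 ^ j * n)"
    using contr_limit[OF f] by blast
  have "2 ^ M dvd pb (4 ^ j * (l ^ 3 * n))" if j: "j \<ge> max j1 j2" for j
  proof -
    define D where "D = 4 ^ j * (l ^ 3 * n)"
    define g where "g = phi ^ (4 * r + 2) * (f oo t_ser)"
    have lj: "\<not> l dvd 4 ^ j * n"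
    proof
      assume "l dvd 4 ^ j * n"
      then have "l dvd 2 * 2" using l n by (metis mult_2 numeral_Bit0 prime_dvd_mult_iff prime_dvd_power one_add_one)
      then have "l dvd 2" using l prime_dvd_mult_iff by blast
      then show False using l by (metis primes_dvd_imp_eq two_is_prime_nat dvd_refl)
    qed
    have ns: "b\<^sup>2 \<noteq> int D" for b
      using cube_mult_not_square[OF l(1) lj, of b] by (simp add: D_def ac_simps)
    have "(phi * g) $ D = (\<Sum>b | b\<^sup>2 < int D. g $ nat (int D - b\<^sup>2))"
      unfolding phi_mult_nth using ns by (intro sum.cong) (auto simp: order.strict_iff_order)
    also have "\<dots> = (\<Sum>b | b\<^sup>2 < int D. 4 * (\<Sum>d | d dvd nat (int D - b\<^sup>2). weight r (int d)))"
    proof (rule sum.cong[OF refl])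
      fix b assume "b \<in> {b. b\<^sup>2 < int D}"
      then have N: "nat (int D - b\<^sup>2) > 0" by simp
      show "g $ nat (int D - b\<^sup>2) = 4 * (\<Sum>d | d dvd nat (int D - b\<^sup>2). weight r (int d))"
        unfolding g_def fN[OF N] char_div_sum_def weight_int ..
    qed
    also have "\<dots> = 4 * (\<Sum>b | b\<^sup>2 < int D. \<Sum>d | d dvd nat (int D - b\<^sup>2). weight r (int d))"
      by (simp add: sum_distrib_left)
    also have "2 ^ M dvd \<dots>" using j1 j by (intro dvd_mult) (simp add: D_def mult.assoc)
    finally have a: "2 ^ M dvd (phi * g) $ D" .
    have "phi * g - inv_phi * (f oo t_ser) = (inv_phi * (f oo t_ser)) * (phi ^ (2 ^ M) - 1)"
    proof -
      have "phi ^ (2 ^ M) = phi * (phi * phi ^ (4 * r + 2))"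
        unfolding r[symmetric] by (simp add: numeral_eq_Suc)
      then have "inv_phi * phi ^ (2 ^ M) = (phi * inv_phi) * (phi * phi ^ (4 * r + 2))"
        by (simp only: ac_simps)
      then have e: "inv_phi * phi ^ (2 ^ M) = phi * phi ^ (4 * r + 2)" by (simp only: phi_inv_phi mult_1_left)
      have "(inv_phi * (f oo t_ser)) * (phi ^ (2 ^ M) - 1) = (inv_phi * phi ^ (2 ^ M)) * (f oo t_ser) - inv_phi * (f oo t_ser)"
        by (simp only: right_diff_distrib mult_1_right mult_1_left ac_simps)
      then show ?thesis unfolding e g_def by (simp only: mult.assoc)
    qed
    moreover have "coeffs_dvd (2 ^ Suc M) ((inv_phi * (f oo t_ser)) * (phi ^ (2 ^ M) - 1))"
      by (rule coeffs_dvd_mult[OF phi_power_two_power])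
    ultimately have "2 ^ Suc M dvd (phi * g) $ D - (inv_phi * (f oo t_ser)) $ D"
      by (simp only: coeffs_dvd_def flip: fps_sub_nth)
    then have "2 ^ M dvd (phi * g) $ D - (inv_phi * (f oo t_ser)) $ D"
      by (rule dvd_trans[rotated]) simp
    then have "2 ^ M dvd (inv_phi * (f oo t_ser)) $ D" using a dvd_diff_right_iff by metis
    moreover have "2 ^ M dvd (inv_phi * (f oo t_ser)) $ D - f $ 0 * pb D" using j2 j by (simp add: D_def)
    ultimately have "2 ^ M dvd f $ 0 * pb D" using dvd_diff_right_iff by metis
    moreover have "coprime (2 ^ M) (f $ 0)" using f(2) by simp
    ultimately show ?thesis by (simp add: coprime_dvd_mult_right_iff D_def)
  qed
  then show ?thesis by blast
qed

text \<open>
Otherwise \<open>-1\<close> would be a square modulo \<open>l\<close>; raising to the odd power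
\<open>(l - 1) / 2\<close> contradicts Fermat's theorem.
\<close>

lemma prime_3_mod_4_dvd_sum_squares:
  fixes l x y :: nat
  assumes l: "prime l" "l mod 4 = 3" and d: "l dvd x\<^sup>2 + y\<^sup>2"
  shows "l dvd x"
proof (rule ccontr)
  assume x: "\<not> l dvd x"
  have y: "\<not> l dvd y"
  proof
    assume "l dvd y"
    then have "l dvd y\<^sup>2" by (simp add: power2_eq_square)
    then have "l dvd x\<^sup>2" using d by (simp add: dvd_add_left_iff)
    then show False using x l prime_dvd_power by blast
  qed
  define h where "h = (l - 1) div 2"
  have h: "l - 1 = 2 * h" "odd h" using l(2) unfolding h_def by presburger+
  have fermat: "[int z ^ (2 * h) = 1] (mod int l)" if "\<not> l dvd z" for z
    using fermat_theorem[OF l(1) that] unfolding h by (simp flip: cong_int_iff)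
  have "int l dvd int (x\<^sup>2 + y\<^sup>2)" using d by (simp only: of_nat_dvd_iff)
  then have "[(int x)\<^sup>2 = - ((int y)\<^sup>2)] (mod int l)" by (simp add: cong_iff_dvd_diff)
  then have "[((int x)\<^sup>2) ^ h = (- ((int y)\<^sup>2)) ^ h] (mod int l)" by (rule cong_pow)
  then have "[int x ^ (2 * h) = - (int y ^ (2 * h))] (mod int l)" using h(2) by (simp add: power_mult)
  moreover have "[- (int y ^ (2 * h)) = - 1] (mod int l)" using fermat[OF y] by (simp add: cong_minus_minus_iff)
  ultimately have "[1 = - 1] (mod int l)" using fermat[OF x] cong_trans cong_sym by metis
  then have "int l dvd 2" by (simp add: cong_iff_dvd_diff)
  then have "l \<le> 2" by (auto dest: zdvd_imp_le)
  then show False using l(2) by (cases "l = 2"; cases "l = 1"; cases "l = 0") auto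
qed

lemma cube_mult_not_sum_squares:
  fixes l m x y :: nat
  assumes l: "prime l" "l mod 4 = 3" and m: "\<not> l dvd m" shows "l ^ 3 * m \<noteq> x\<^sup>2 + y\<^sup>2"
proof
  have l0: "l > 0" using l(1) by (rule prime_gt_0_nat)
  have dvd_both: "l dvd x" "l dvd y" if "l dvd x\<^sup>2 + y\<^sup>2" for x y
    using that prime_3_mod_4_dvd_sum_squares[OF l, of x y] prime_3_mod_4_dvd_sum_squares[OF l, of y x]
    by (simp_all add: add.commute)
  have red: "\<exists>x' y'. x = l * x' \<and> y = l * y' \<and> k = x'\<^sup>2 + y'\<^sup>2" if "l * (l * k) = x\<^sup>2 + y\<^sup>2" for k x y :: nat
  proof -
    have "l dvd x\<^sup>2 + y\<^sup>2" using that by (metis dvd_triv_left)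
    then have "l dvd x" "l dvd y" by (rule dvd_both)+
    then obtain x' y' where xy: "x = l * x'" "y = l * y'" by blast
    then have "l * (l * k) = l * (l * (x'\<^sup>2 + y'\<^sup>2))" using that by (simp add: power2_eq_square algebra_simps)
    then have "k = x'\<^sup>2 + y'\<^sup>2" using l0 by simp
    then show ?thesis using xy by blast
  qed
  assume "l ^ 3 * m = x\<^sup>2 + y\<^sup>2"
  then have "l * (l * (l * m)) = x\<^sup>2 + y\<^sup>2" by (simp add: power3_eq_cube)
  then obtain x' y' where k: "l * m = x'\<^sup>2 + y'\<^sup>2" using red by blast
  have "l dvd x'\<^sup>2 + y'\<^sup>2" by (simp flip: k)
  then have "l dvd x'" "l dvd y'" by (rule dvd_both)+
  then obtain a b where "x' = l * a" "y' = l * b" by blast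
  then have "l * m = l * (l * (a\<^sup>2 + b\<^sup>2))" using k by (simp add: power2_eq_square algebra_simps)
  then have "m = l * (a\<^sup>2 + b\<^sup>2)" using l0 by simp
  then show False using m by simp
qed

text \<open>
An odd factor is invertible modulo a power of 2.
\<close>

lemma descend:
  assumes h: "\<exists>a b. odd a \<and> 2 ^ M dvd a * (x :: int) - b * y" and y: "2 ^ M dvd y" shows "2 ^ M dvd x"
proof -
  obtain a b where ab: "odd a" "2 ^ M dvd a * x - b * y" using h by blast
  have "2 ^ M dvd b * y" using y by simp
  then have "2 ^ M dvd a * x" using ab(2) dvd_diff_left_iff by blast
  moreover have "coprime (2 ^ M) a" using ab(1) by simp
  ultimately show ?thesis by (simp add: coprime_dvd_mult_right_iff)
qed

text \<open>
The six smallest valuations are treated one by one with the comparison lemmas. From valuation 6 on,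
the exponent \<open>16 + 3 k\<close> of stability with \<open>v \<le> 2 k + 5\<close> exceeds
\<open>v + 12\<close>.
\<close>

lemma overpartition_dvd:
  fixes l m v M :: nat
  assumes l: "prime l" "odd l" "[int l = - 1] (mod 2 ^ M)" and M: "2 \<le> M" "M \<le> v + 12"
    and m: "\<not> l dvd m" "odd m"
  shows "2 ^ M dvd pb (2 ^ v * (l ^ 3 * m))"
proof -
  define c where "c = l ^ 3 * m"
  have c: "odd c" using l m by (simp add: c_def)
  have high: "\<exists>j0. \<forall>j\<ge>j0. 2 ^ M dvd pb (4 ^ j * (2 ^ i * c))" for i
  proof -
    have "\<not> l dvd 2 ^ i * m"
    proof
      assume "l dvd 2 ^ i * m"
      then have "l dvd 2" using l(1) m(1) by (metis prime_dvd_mult_iff prime_dvd_power)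
      then show False using l by (metis primes_dvd_imp_eq two_is_prime_nat dvd_refl)
    qed
    from high_power_dvd[OF l M(1) this] show ?thesis by (simp add: c_def ac_simps)
  qed
  have from_16: "2 ^ M dvd pb (16 * (2 ^ i * c))" if M16: "M \<le> 16" for i
  proof -
    obtain j0 where j0: "\<forall>j\<ge>j0. 2 ^ M dvd pb (4 ^ j * (2 ^ i * c))" using high by blast
    have "(2::int) ^ M dvd 2 ^ (16 + 3 * 0)" using M16 by (intro le_imp_power_dvd) simp
    also have "\<dots> dvd pb (4 ^ (2 + 0 + j0) * (2 ^ i * c)) - pb (4 ^ (2 + 0) * (2 ^ i * c))"
      by (rule overpartition_stable)
    finally have "2 ^ M dvd pb (4 ^ (2 + j0) * (2 ^ i * c)) - pb (16 * (2 ^ i * c))" by simp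
    moreover have "2 ^ M dvd pb (4 ^ (2 + j0) * (2 ^ i * c))" using j0[rule_format, of "2 + j0"] by simp
    ultimately show ?thesis using dvd_diff_right_iff by blast
  qed
  have l4: "l mod 4 = 3"
  proof -
    have "(4::int) dvd 2 ^ M" using le_imp_power_dvd[OF M(1), of "2::int"] by simp
    then have "[int l = - 1] (mod 4)" using l(3) cong_dvd_modulus by blast
    then have "int l mod 4 = 3" by (simp add: cong_def)
    then show ?thesis by presburger
  qed
  have weaken: "\<exists>a b. odd a \<and> 2 ^ M dvd a * x - b * (y::int)"
    if "\<exists>a b. odd a \<and> 2 ^ K dvd a * x - b * y" "M \<le> K" for K x y
    using that by (meson dvd_trans le_imp_power_dvd)
  consider "v = 0" | "v = 1" | "v = 2" | "v = 3" | "v = 4" | "v = 5" | "v \<ge> 6" by linarith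
  then have "2 ^ M dvd pb (2 ^ v * c)"
  proof cases
    case 1
    have M: "M \<le> 12" using M 1 by simp
    have "2 ^ M dvd pb (16 * c)" using from_16[of 0] M by simp
    then have "2 ^ M dvd pb c" by (rule descend[OF weaken[OF compare_odd[OF c] M]])
    then show ?thesis using 1 by simp
  next
    case 2
    have n: "[2 * c = 2] (mod 4)" using c unfolding cong_def by presburger
    have "2 * c \<noteq> 2 * (x\<^sup>2 + (2 * y)\<^sup>2)" for x y
      using cube_mult_not_sum_squares[OF l(1) l4 m(1), of x "2 * y"] by (simp add: c_def)
    then have h: "\<exists>a b. odd a \<and> 2 ^ 13 dvd a * pb (2 * c) - b * pb (16 * (2 * c))" by (rule compare_twice_odd[OF n])
    have M: "M \<le> 13" using M 2 by simp
    have "2 ^ M dvd pb (16 * (2 * c))" using from_16[of 1] M by simp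
    then have "2 ^ M dvd pb (2 * c)" by (rule descend[OF weaken[OF h M]])
    then show ?thesis using 2 by simp
  next
    case 3
    have M: "M \<le> 14" using M 3 by simp
    have "2 ^ M dvd pb (16 * c)" using from_16[of 0] M by simp
    then have "2 ^ M dvd pb (4 * c)" by (rule descend[OF weaken[OF compare_4_odd[OF c] M]])
    then show ?thesis using 3 by simp
  next
    case 4
    have n: "[2 * c = 2] (mod 4)" using c unfolding cong_def by presburger
    have M: "M \<le> 15" using M 4 by simp
    have "2 ^ M dvd pb (16 * (2 * c))" using from_16[of 1] M by simp
    then have "2 ^ M dvd pb (4 * (2 * c))" by (rule descend[OF weaken[OF compare_4_twice_odd[OF n] M]])
    then show ?thesis using 4 by simp
  next
    case 5
    then show ?thesis using from_16[of 0] M by simp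
  next
    case 6
    obtain j0 where j0: "\<forall>j\<ge>j0. 2 ^ M dvd pb (4 ^ j * (2 ^ 1 * c))" using high by blast
    have "(2::int) ^ M dvd 2 ^ 17" using M 6 by (intro le_imp_power_dvd) simp
    also have "\<dots> dvd pb (4 ^ (2 + j0) * (2 * c)) - pb (4 ^ 2 * (2 * c))" by (rule overpartition_stable_even) simp
    finally have "2 ^ M dvd pb (4 ^ (2 + j0) * (2 * c)) - pb (2 ^ v * c)" using 6 by simp
    moreover have "2 ^ M dvd pb (4 ^ (2 + j0) * (2 * c))" using j0[rule_format, of "2 + j0"] by simp
    ultimately show ?thesis using dvd_diff_right_iff by blast
  next
    case 7
    define k i where "k = v div 2 - 2" and "i = v mod 2"
    have v: "v = 2 * (2 + k) + i" "i \<le> 1" "k \<ge> 1" using 7 unfolding k_def i_def by presburger+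
    obtain j0 where j0: "\<forall>j\<ge>j0. 2 ^ M dvd pb (4 ^ j * (2 ^ i * c))" using high by blast
    have "(2::int) ^ M dvd 2 ^ (16 + 3 * k)" using M v by (intro le_imp_power_dvd) simp
    also have "\<dots> dvd pb (4 ^ (2 + k + j0) * (2 ^ i * c)) - pb (4 ^ (2 + k) * (2 ^ i * c))" by (rule overpartition_stable)
    also have "4 ^ (2 + k) * (2 ^ i * c) = 2 ^ v * c"
    proof -
      have "(4::nat) ^ (2 + k) = 2 ^ (2 * (2 + k))" by (simp only: power_mult) simp
      then show ?thesis by (subst v(1)) (simp only: power_add mult.assoc)
    qed
    finally have "2 ^ M dvd pb (4 ^ (2 + k + j0) * (2 ^ i * c)) - pb (2 ^ v * c)" .
    moreover have "2 ^ M dvd pb (4 ^ (2 + k + j0) * (2 ^ i * c))" using j0[rule_format, of "2 + k + j0"] by simp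
    ultimately show ?thesis using dvd_diff_right_iff by blast
  qed
  then show ?thesis by (simp add: c_def)
qed

theorem mainTheorem2:
  fixes \<alpha> l n :: nat
  assumes "prime l" and "odd l"
    and "[int l = - 1] (mod 2 ^ (\<alpha> + 12))"
    and "\<not> l dvd n"
  shows "[overpartition_number (2 ^ \<alpha> * l ^ 3 * n) = 0] (mod 2 ^ (\<alpha> + 12))"
proof -
  have "n \<noteq> 0" using assms(4) by (metis dvd_0_right)
  then obtain m where m: "n = 2 ^ multiplicity 2 n * m" "odd m"
    using multiplicity_decompose'[of n 2] by auto
  define a where "a = multiplicity 2 n"
  have n: "n = 2 ^ a * m" using m by (simp add: a_def)
  have "\<not> l dvd m" using assms(4) by (metis n dvd_mult)
  then have "2 ^ (\<alpha> + 12) dvd pb (2 ^ (\<alpha> + a) * (l ^ 3 * m))"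
    using assms m(2) by (intro overpartition_dvd) simp_all
  moreover have "2 ^ (\<alpha> + a) * (l ^ 3 * m) = 2 ^ \<alpha> * l ^ 3 * n"
    by (simp add: n power_add ac_simps)
  ultimately have "int (2 ^ (\<alpha> + 12)) dvd int (overpartition_number (2 ^ \<alpha> * l ^ 3 * n))" by simp
  then have "2 ^ (\<alpha> + 12) dvd overpartition_number (2 ^ \<alpha> * l ^ 3 * n)" by (simp only: of_nat_dvd_iff)
  then show ?thesis by (simp add: cong_0_iff)
qed

end
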